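(* Let $U$ be a finite dimensional DG algebra over an algebraically closed field $F$, and let $W$ be a finite dimensional graded $F$-vector space. Let $M\in\operatorname{Mod}^U(W)$. Then the quotient of tangent spaces $\mathsf{T}^{\operatorname{Mod}^U(W)}_M/\mathsf{T}^{\operatorname{GL}(W)_0\cdot M}_M$ is isomorphic to the Yoneda Ext group $\operatorname{YExt}^1_U(M,M)$.
   Context: A DG $F$-algebra is a (positively graded commutative) differential graded $F$-algebra: a chain complex $U$ of $F$-vector spaces (indexed homologically, differential of degree $-1$) with $U_i=0$ for $i<0$, equipped with a chain map $U\otimes_F U\to U$ giving an associative, unital, graded commutative ($ab=(-1)^{|a||b|}ba$) product; it is finite dimensional if $\bigoplus_i U_i$ is finite dimensional over $F$. A DG $U$-module is a complex $M$ with a chain map $U\otimes_F M\to M$ that is an associative, unital scalar multiplication (so $\partial(um)=\partial(u)m+(-1)^{|u|}u\,\partial(m)$). Morphisms of DG $U$-modules are the $U$-linear chain maps of degree $0$. $\operatorname{Mod}^U(W)$ is the set of all pairs $(\partial,\mu)$, with $\partial\in\operatorname{Hom}_F(W,W)_{-1}$ (homogeneous of degree $-1$) and $\mu\in\operatorname{Hom}_F(U\otimes_F W,W)_0$ (homogeneous of degree $0$), making $W$ into a DG $U$-module. It is the closed subset of a finite dimensional affine space over $F$ cut out by the polynomial equations expressing $\partial\partial=0$, associativity and unitality of $\mu$, and the Leibniz rule. A pair $(\partial,\mu)$ is identified with the DG $U$-module $M=(W,\partial,\mu)$. $\operatorname{GL}(W)_0$ is the algebraic group of $F$-linear automorphisms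 of $W$ that are homogeneous of degree $0$. It acts on $\operatorname{Mod}^U(W)$ by $\alpha\cdot(\partial,\mu)=(\alpha\circ\partial\circ\alpha^{-1},\ \alpha\circ\mu\circ(U\otimes_F\alpha^{-1}))$, and $\operatorname{GL}(W)_0\cdot M$ denotes the orbit of $M$, a locally closed subvariety of $\operatorname{Mod}^U(W)$. $\mathsf{T}^X_x$ denotes the Zariski tangent space of $X$ at $x$. The tangent space $\mathsf{T}^{\operatorname{Mod}^U(W)}_M$ is taken with respect to the polynomial equations expressing $\partial\partial=0$, associativity and unitality of $\mu$, and the Leibniz rule: with $F[\epsilon]=F\oplus F\epsilon$, $\epsilon^2=0$, $|\epsilon|=0$, $U[\epsilon]=F[\epsilon]\otimes_FU$ and $W[\epsilon]=F[\epsilon]\otimes_F W$, it is the set of DG $U[\epsilon]$-module structures on $W[\epsilon]$ ($F[\epsilon]$-linear) that reduce to $M$ modulo $\epsilon$. The tangent space $\mathsf{T}^{\operatorname{GL}(W)_0\cdot M}_M$ of the orbit is identified with a subspace of it via the inclusion of the orbit in $\operatorname{Mod}^U(W)$. $\operatorname{YExt}^1_U(M,N)$ is the set of equivalence classes (usual Yoneda equivalence) of short exact sequences $0\to N\to X\to M\to 0$ in the abelian category of DG $U$-modules, an abelian group under the Baer sum. *)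

theory Defs
  imports
    "HOL-Algebra.Coset"
    "HOL-Computational_Algebra.Polynomial"
    "HOL-Library.Function_Algebras"
    "HOL-Library.Product_Plus"
begin

section \<open>Dual numbers\<close>

text \<open>
  \<open>Dual a b\<close> is the element \<open>a + b \<epsilon>\<close> of \<open>F[\<epsilon>]\<close>, \<open>\<epsilon>\<^sup>2 = 0\<close>.
\<close>

datatype 'f dual = Dual (dual_re: 'f) (dual_eps: 'f)

instantiation dual :: (comm_ring_1) comm_ring_1
begin

definition "0 = Dual 0 0"
definition "1 = Dual 1 0"
definition "a + b = Dual (dual_re a + dual_re b) (dual_eps a + dual_eps b)"
definition "a - b = Dual (dual_re a - dual_re b) (dual_eps a - dual_eps b)"
definition "- a = Dual (- dual_re a) (- dual_eps a)"
definition "a * b = Dual (dual_re a * dual_re b) (dual_re a * dual_eps b + dual_eps a * dual_re b)"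

instance
  by standard
    (simp_all add: zero_dual_def one_dual_def plus_dual_def minus_dual_def uminus_dual_def
      times_dual_def algebra_simps)

end


section \<open>Graded modules, DG algebras and DG modules\<close>

text \<open>
  The base ring \<open>'r\<close> is the field \<open>F\<close> or \<open>F[\<epsilon>]\<close>. The underlying module of a graded object is
  a whole type, and \<open>gr V i\<close> is its homogeneous part of degree \<open>i\<close>.
\<close>

record ('r, 'a) graded_mod =
  scl :: "'r \<Rightarrow> 'a \<Rightarrow> 'a"
  gr :: "int \<Rightarrow> 'a set"

record ('r, 'u) dg_alg = "('r, 'u) graded_mod" +
  dif :: "'u \<Rightarrow> 'u"
  mul :: "'u \<Rightarrow> 'u \<Rightarrow> 'u"
  unit :: 'u

record ('r, 'u, 'a) dg_mod = "('r, 'a) graded_mod" +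
  mdif :: "'a \<Rightarrow> 'a"
  act :: "'u \<Rightarrow> 'a \<Rightarrow> 'a"

definition graded_module :: "('r::comm_ring_1, 'a::ab_group_add, 'z) graded_mod_scheme \<Rightarrow> bool" where
  "graded_module V \<longleftrightarrow>
     module (scl V) \<and>
     (\<forall>i. module.subspace (scl V) (gr V i)) \<and>
     (\<forall>x. \<exists>!c. (\<forall>i. c i \<in> gr V i) \<and> finite {i. c i \<noteq> 0} \<and> x = (\<Sum>i | c i \<noteq> 0. c i))"

definition finite_dim :: "('f::field, 'a::ab_group_add, 'z) graded_mod_scheme \<Rightarrow> bool" where
  "finite_dim V \<longleftrightarrow> (\<exists>B. finite B \<and> module.span (scl V) B = UNIV)"

definition Hom_deg ::
  "int \<Rightarrow> ('r::comm_ring_1, 'a::ab_group_add, 'y) graded_mod_scheme \<Rightarrow>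
    ('r, 'b::ab_group_add, 'z) graded_mod_scheme \<Rightarrow> ('a \<Rightarrow> 'b) set" where
  "Hom_deg k V W = {f. module_hom (scl V) (scl W) f \<and> (\<forall>i. \<forall>x \<in> gr V i. f x \<in> gr W (i + k))}"

text \<open>
  Homomorphisms \<open>V \<otimes> W \<rightarrow> Z\<close> of degree 0, given as bilinear maps.
\<close>

definition Bil_deg0 ::
  "('r::comm_ring_1, 'a::ab_group_add, 'x) graded_mod_scheme \<Rightarrow>
    ('r, 'b::ab_group_add, 'y) graded_mod_scheme \<Rightarrow>
    ('r, 'c::ab_group_add, 'z) graded_mod_scheme \<Rightarrow> ('a \<Rightarrow> 'b \<Rightarrow> 'c) set" where
  "Bil_deg0 V W Z = {m.
     (\<forall>v. module_hom (scl W) (scl Z) (m v)) \<and>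
     (\<forall>w. module_hom (scl V) (scl Z) (\<lambda>v. m v w)) \<and>
     (\<forall>i j. \<forall>v \<in> gr V i. \<forall>w \<in> gr W j. m v w \<in> gr Z (i + j))}"

text \<open>\<open>ksign i x = (-1)\<^sup>i x\<close>\<close>

definition ksign :: "int \<Rightarrow> 'a::ab_group_add \<Rightarrow> 'a" where
  "ksign i x = (if even i then x else - x)"

definition dg_algebra :: "('r::comm_ring_1, 'u::ab_group_add) dg_alg \<Rightarrow> bool" where
  "dg_algebra U \<longleftrightarrow>
     graded_module U \<and>
     (\<forall>i<0. gr U i = {0}) \<and>
     dif U \<in> Hom_deg (- 1) U U \<and>
     (\<forall>a. dif U (dif U a) = 0) \<and>
     mul U \<in> Bil_deg0 U U U \<and>
     (\<forall>i. \<forall>a \<in> gr U i. \<forall>b.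
        dif U (mul U a b) = mul U (dif U a) b + ksign i (mul U a (dif U b))) \<and>
     (\<forall>a b c. mul U (mul U a b) c = mul U a (mul U b c)) \<and>
     unit U \<in> gr U 0 \<and>
     (\<forall>a. mul U (unit U) a = a \<and> mul U a (unit U) = a) \<and>
     (\<forall>i j. \<forall>a \<in> gr U i. \<forall>b \<in> gr U j. mul U a b = ksign (i * j) (mul U b a))"

definition dg_module ::
  "('r::comm_ring_1, 'u::ab_group_add) dg_alg \<Rightarrow> ('r, 'u, 'a::ab_group_add) dg_mod \<Rightarrow> bool" where
  "dg_module U M \<longleftrightarrow>
     graded_module M \<and>
     mdif M \<in> Hom_deg (- 1) M M \<and>
     (\<forall>x. mdif M (mdif M x) = 0) \<and>
     act M \<in> Bil_deg0 U M M \<and>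
     (\<forall>i. \<forall>a \<in> gr U i. \<forall>x.
        mdif M (act M a x) = act M (dif U a) x + ksign i (act M a (mdif M x))) \<and>
     (\<forall>a b x. act M (mul U a b) x = act M a (act M b x)) \<and>
     (\<forall>x. act M (unit U) x = x)"

definition dg_hom ::
  "('r::comm_ring_1, 'u::ab_group_add, 'a::ab_group_add) dg_mod \<Rightarrow>
    ('r, 'u, 'b::ab_group_add) dg_mod \<Rightarrow> ('a \<Rightarrow> 'b) set" where
  "dg_hom M N = {f \<in> Hom_deg 0 M N.
     (\<forall>x. f (mdif M x) = mdif N (f x)) \<and> (\<forall>a x. f (act M a x) = act N a (f x))}"


section \<open>The variety of DG module structures and the action of the general linear group\<close>

type_synonym ('u, 'w) dg_struct = "('w \<Rightarrow> 'w) \<times> ('u \<Rightarrow> 'w \<Rightarrow> 'w)"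

definition with_struct ::
  "('r, 'w) graded_mod \<Rightarrow> ('u, 'w) dg_struct \<Rightarrow> ('r, 'u, 'w) dg_mod" where
  "with_struct W M = \<lparr>scl = scl W, gr = gr W, mdif = fst M, act = snd M\<rparr>"

definition Mod_var ::
  "('r::comm_ring_1, 'u::ab_group_add) dg_alg \<Rightarrow> ('r, 'w::ab_group_add) graded_mod \<Rightarrow>
    ('u, 'w) dg_struct set" where
  "Mod_var U W = {M. dg_module U (with_struct W M)}"

definition ambient ::
  "('r::comm_ring_1, 'u::ab_group_add) dg_alg \<Rightarrow> ('r, 'w::ab_group_add) graded_mod \<Rightarrow>
    ('u, 'w) dg_struct set" where
  "ambient U W = Hom_deg (- 1) W W \<times> Bil_deg0 U W W"

definition struct_scl ::
  "('r, 'w) graded_mod \<Rightarrow> 'r \<Rightarrow> ('u, 'w) dg_struct \<Rightarrow> ('u, 'w) dg_struct" where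
  "struct_scl W r v = (\<lambda>w. scl W r (fst v w), \<lambda>a w. scl W r (snd v a w))"

definition GL0 :: "('r::comm_ring_1, 'w::ab_group_add) graded_mod \<Rightarrow> ('w \<Rightarrow> 'w) set" where
  "GL0 W = {\<alpha> \<in> Hom_deg 0 W W. bij \<alpha>}"

definition GL_act :: "('w \<Rightarrow> 'w) \<Rightarrow> ('u, 'w) dg_struct \<Rightarrow> ('u, 'w) dg_struct" where
  "GL_act \<alpha> M =
     (\<alpha> \<circ> fst M \<circ> inv_into UNIV \<alpha>, \<lambda>a. \<alpha> \<circ> snd M a \<circ> inv_into UNIV \<alpha>)"

definition GL_orbit ::
  "('r::comm_ring_1, 'w::ab_group_add) graded_mod \<Rightarrow> ('u, 'w) dg_struct \<Rightarrow>
    ('u, 'w) dg_struct set" where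
  "GL_orbit W M = (\<lambda>\<alpha>. GL_act \<alpha> M) ` GL0 W"


section \<open>Tangent spaces\<close>

text \<open>
  \<open>F[\<epsilon>] \<otimes> V\<close> is realised as \<open>V \<times> V\<close>, the pair \<open>(x, y)\<close> standing for \<open>x + y \<epsilon>\<close>; likewise
  \<open>with_eps\<close> is the \<open>F[\<epsilon>]\<close>-linear extension of \<open>(\<partial> + \<partial>' \<epsilon>, \<mu> + \<mu>' \<epsilon>)\<close> to \<open>W[\<epsilon>]\<close>.
\<close>

definition graded_eps :: "('f::comm_ring_1, 'a::ab_group_add) graded_mod \<Rightarrow> ('f dual, 'a \<times> 'a) graded_mod" where
  "graded_eps V =
     \<lparr>scl = (\<lambda>r (x, y). (scl V (dual_re r) x, scl V (dual_re r) y + scl V (dual_eps r) x)),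
      gr = (\<lambda>i. gr V i \<times> gr V i)\<rparr>"

definition alg_eps :: "('f::comm_ring_1, 'u::ab_group_add) dg_alg \<Rightarrow> ('f dual, 'u \<times> 'u) dg_alg" where
  "alg_eps U =
     \<lparr>scl = (\<lambda>r (a, b). (scl U (dual_re r) a, scl U (dual_re r) b + scl U (dual_eps r) a)),
      gr = (\<lambda>i. gr U i \<times> gr U i),
      dif = (\<lambda>(a, b). (dif U a, dif U b)),
      mul = (\<lambda>(a, b) (a', b'). (mul U a a', mul U a b' + mul U b a')),
      unit = (unit U, 0)\<rparr>"

definition with_eps ::
  "('u::ab_group_add, 'w::ab_group_add) dg_struct \<Rightarrow> ('u, 'w) dg_struct \<Rightarrow>
    ('u \<times> 'u, 'w \<times> 'w) dg_struct" where
  "with_eps M v =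
     (\<lambda>(x, y). (fst M x, fst M y + fst v x),
      \<lambda>(a, b) (x, y). (snd M a x, snd M a y + snd M b x + snd v a x))"

text \<open>
  The tangent space of the scheme cut out by the equations of DG module structures: the
  structures on \<open>W[\<epsilon>]\<close> that reduce to \<open>M\<close> are the \<open>with_eps M v\<close>, see \<open>Mod_var_eps_iff\<close> below,
  and are recorded by \<open>v\<close>.
\<close>

definition tangent_Mod ::
  "('f::field, 'u::ab_group_add) dg_alg \<Rightarrow> ('f, 'w::ab_group_add) graded_mod \<Rightarrow>
    ('u, 'w) dg_struct \<Rightarrow> ('u, 'w) dg_struct set" where
  "tangent_Mod U W M = {v. with_eps M v \<in> Mod_var (alg_eps U) (graded_eps W)}"

inductive_set poly_functions :: "('f::field \<Rightarrow> 'a::ab_group_add \<Rightarrow> 'a) \<Rightarrow> ('a \<Rightarrow> 'f) set"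
  for s :: "'f \<Rightarrow> 'a \<Rightarrow> 'a" where
  const: "(\<lambda>_. c) \<in> poly_functions s"
| functional: "module_hom s (*) l \<Longrightarrow> l \<in> poly_functions s"
| add: "f \<in> poly_functions s \<Longrightarrow> g \<in> poly_functions s \<Longrightarrow> (\<lambda>x. f x + g x) \<in> poly_functions s"
| mult: "f \<in> poly_functions s \<Longrightarrow> g \<in> poly_functions s \<Longrightarrow> (\<lambda>x. f x * g x) \<in> poly_functions s"

text \<open>
  Zariski tangent space at \<open>x\<close> of a locally closed subvariety \<open>X\<close> of the affine space \<open>A\<close> (a
  subspace of a vector space with scalar multiplication \<open>s\<close>): the common kernel of the differentials
  at \<open>x\<close> of the polynomial functions vanishing on \<open>X\<close>. The value at \<open>v\<close> of the differential of \<open>f\<close>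
  is the linear coefficient of the polynomial \<open>t \<mapsto> f (x + t v)\<close>. That polynomial exists for every
  polynomial function \<open>f\<close>, and it is unique since the field is meant to be infinite.
\<close>

definition zariski_tangent ::
  "('f::field \<Rightarrow> 'a::ab_group_add \<Rightarrow> 'a) \<Rightarrow> 'a set \<Rightarrow> 'a set \<Rightarrow> 'a \<Rightarrow> 'a set" where
  "zariski_tangent s A X x = {v \<in> A.
     \<forall>f \<in> poly_functions s. (\<forall>y \<in> X. f y = 0) \<longrightarrow>
       (\<forall>p. (\<forall>t. poly p t = f (x + s t v)) \<longrightarrow> coeff p 1 = 0)}"

definition tangent_orbit ::
  "('f::field, 'u::ab_group_add) dg_alg \<Rightarrow> ('f, 'w::ab_group_add) graded_mod \<Rightarrow>
    ('u, 'w) dg_struct \<Rightarrow> ('u, 'w) dg_struct set" where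
  "tangent_orbit U W M = zariski_tangent (struct_scl W) (ambient U W) (GL_orbit W M) M"

definition add_group :: "'a::ab_group_add set \<Rightarrow> 'a monoid" where
  "add_group S = \<lparr>carrier = S, monoid.mult = (+), one = 0\<rparr>"


section \<open>Yoneda extensions\<close>

text \<open>
  A triple \<open>(X, f, g)\<close> is the sequence \<open>0 \<rightarrow> N \<rightarrow> X \<rightarrow> M \<rightarrow> 0\<close> with maps \<open>f\<close> and \<open>g\<close>.
\<close>

type_synonym ('r, 'u, 'm, 'n, 'x) ses = "('r, 'u, 'x) dg_mod \<times> ('n \<Rightarrow> 'x) \<times> ('x \<Rightarrow> 'm)"

definition extension ::
  "('r::comm_ring_1, 'u::ab_group_add) dg_alg \<Rightarrow> ('r, 'u, 'm::ab_group_add) dg_mod \<Rightarrow>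
    ('r, 'u, 'n::ab_group_add) dg_mod \<Rightarrow> ('r, 'u, 'm, 'n, 'x::ab_group_add) ses \<Rightarrow> bool" where
  "extension U M N = (\<lambda>(X, f, g).
     dg_module U X \<and> f \<in> dg_hom N X \<and> g \<in> dg_hom X M \<and>
     inj f \<and> surj g \<and> range f = {x. g x = 0})"

definition yoneda_equiv ::
  "('r::comm_ring_1, 'u::ab_group_add, 'm, 'n, 'x::ab_group_add) ses \<Rightarrow>
    ('r, 'u, 'm, 'n, 'y::ab_group_add) ses \<Rightarrow> bool" where
  "yoneda_equiv = (\<lambda>(X, f, g) (X', f', g').
     \<exists>h \<in> dg_hom X X'. bij h \<and> h \<circ> f = f' \<and> g' \<circ> h = g)"

text \<open>
  \<open>(X, f, g)\<close> is a Baer sum of \<open>(X\<^sub>1, f\<^sub>1, g\<^sub>1)\<close> and \<open>(X\<^sub>2, f\<^sub>2, g\<^sub>2)\<close>: the map \<open>q\<close> identifies \<open>X\<close> with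
  the quotient of the fibre product \<open>P\<close> of \<open>g\<^sub>1\<close> and \<open>g\<^sub>2\<close> by \<open>{(f\<^sub>1 n, - f\<^sub>2 n) | n}\<close>. The values of
  \<open>q\<close> outside \<open>P\<close> are irrelevant.
\<close>

definition baer_sum ::
  "('r::comm_ring_1, 'u::ab_group_add, 'm, 'n::ab_group_add, 'x::ab_group_add) ses \<Rightarrow>
    ('r, 'u, 'm, 'n, 'y::ab_group_add) ses \<Rightarrow>
    ('r, 'u, 'm, 'n, 'z::ab_group_add) ses \<Rightarrow> bool" where
  "baer_sum = (\<lambda>(X1, f1, g1) (X2, f2, g2) (X, f, g).
     \<exists>q. let P = {(x1, x2). g1 x1 = g2 x2} in
       (\<forall>(x1, x2) \<in> P. \<forall>(y1, y2) \<in> P. q (x1 + y1, x2 + y2) = q (x1, x2) + q (y1, y2)) \<and>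
       (\<forall>r. \<forall>(x1, x2) \<in> P. q (scl X1 r x1, scl X2 r x2) = scl X r (q (x1, x2))) \<and>
       (\<forall>i. \<forall>(x1, x2) \<in> P. x1 \<in> gr X1 i \<and> x2 \<in> gr X2 i \<longrightarrow> q (x1, x2) \<in> gr X i) \<and>
       (\<forall>(x1, x2) \<in> P. q (mdif X1 x1, mdif X2 x2) = mdif X (q (x1, x2))) \<and>
       (\<forall>a. \<forall>(x1, x2) \<in> P. q (act X1 a x1, act X2 a x2) = act X a (q (x1, x2))) \<and>
       q ` P = UNIV \<and>
       {p \<in> P. q p = 0} = range (\<lambda>n. (f1 n, - f2 n)) \<and>
       (\<forall>n. f n = q (f1 n, 0)) \<and>
       (\<forall>(x1, x2) \<in> P. g (q (x1, x2)) = g1 x1))"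

text \<open>
  The middle terms are DG modules with arbitrary structure on the additive group \<open>'n \<times> 'm\<close>. Every
  extension of \<open>M\<close> by \<open>N\<close> is equivalent to one of these, see \<open>extension_on_product\<close> below.
\<close>

definition YExt_set ::
  "('f::field, 'u::ab_group_add) dg_alg \<Rightarrow> ('f, 'u, 'm::ab_group_add) dg_mod \<Rightarrow>
    ('f, 'u, 'n::ab_group_add) dg_mod \<Rightarrow> ('f, 'u, 'm, 'n, 'n \<times> 'm) ses set set" where
  "YExt_set U M N =
     {E. extension U M N E} //
     {(E, E'). extension U M N E \<and> extension U M N E' \<and> yoneda_equiv E E'}"

definition YExt ::
  "('f::field, 'u::ab_group_add) dg_alg \<Rightarrow> ('f, 'u, 'm::ab_group_add) dg_mod \<Rightarrow>
    ('f, 'u, 'n::ab_group_add) dg_mod \<Rightarrow> ('f, 'u, 'm, 'n, 'n \<times> 'm) ses set monoid" where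
  "YExt U M N =
     \<lparr>carrier = YExt_set U M N,
      monoid.mult = (\<lambda>C D. {E. extension U M N E \<and> (\<exists>E1 \<in> C. \<exists>E2 \<in> D. baer_sum E1 E2 E)}),
      one = {(X, f, g). extension U M N (X, f, g) \<and> (\<exists>\<sigma> \<in> dg_hom M X. g \<circ> \<sigma> = id)}\<rparr>"


section \<open>Adequacy of the encodings\<close>

lemma Mod_var_eps_iff:
  fixes U :: "('f::field, 'u::ab_group_add) dg_alg" and W :: "('f, 'w::ab_group_add) graded_mod"
  assumes U: "dg_algebra U" and M: "M \<in> Mod_var U W"
  shows "D \<in> Mod_var (alg_eps U) (graded_eps W) \<and>
      (\<forall>x y. fst (fst D (x, y)) = fst M x) \<and>
      (\<forall>a b x y. fst (snd D (a, b) (x, y)) = snd M a x) \<longleftrightarrow>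
    (\<exists>!v. v \<in> tangent_Mod U W M \<and> D = with_eps M v)"
    (is "?L \<longleftrightarrow> ?R")
proof
  assume ?R
  then show ?L by (auto simp: tangent_Mod_def with_eps_def)
next
  assume L: ?L
  have uniq: "v = v'" if "with_eps M v = with_eps M v'" for v v'
  proof -
    have "fst (with_eps M v) (x, 0) = fst (with_eps M v') (x, 0)" for x
      using that by simp
    moreover have "snd (with_eps M v) (a, 0) (x, 0) = snd (with_eps M v') (a, 0) (x, 0)" for a x
      using that by simp
    ultimately show ?thesis
      by (auto simp: with_eps_def prod_eq_iff fun_eq_iff)
  qed
  let ?e = "Dual 0 (1::'f)"
  interpret sW: module "scl W"
    using M by (simp add: Mod_var_def dg_module_def graded_module_def with_struct_def)
  interpret sU: module "scl U"
    using U by (simp add: dg_algebra_def graded_module_def)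
  have D: "dg_module (alg_eps U) (with_struct (graded_eps W) D)"
    using L by (simp add: Mod_var_def)
  interpret D1: module_hom "scl (graded_eps W)" "scl (graded_eps W)" "fst D"
    using D by (simp add: dg_module_def with_struct_def Hom_deg_def)
  have D2: "module_hom (scl (graded_eps W)) (scl (graded_eps W)) (snd D a)" for a
    using D by (cases a) (simp add: dg_module_def with_struct_def Bil_deg0_def)
  have D3: "module_hom (scl (alg_eps U)) (scl (graded_eps W)) (\<lambda>a. snd D a x)" for x
    using D by (cases x) (simp add: dg_module_def with_struct_def Bil_deg0_def)
  have eW: "scl (graded_eps W) ?e (x, y) = (0, x)" for x y
    by (simp add: graded_eps_def)
  have eU: "scl (alg_eps U) ?e (x, y) = (0, x)" for x y
    by (simp add: alg_eps_def)
  have splitW: "(x, y) = (x, 0) + scl (graded_eps W) ?e (y, 0)" for x y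
    by (simp add: eW)
  have splitU: "(x, y) = (x, 0) + scl (alg_eps U) ?e (y, 0)" for x y
    by (simp add: eU)
  define v where "v = (\<lambda>x. snd (fst D (x, 0)), \<lambda>a x. snd (snd D (a, 0) (x, 0)))"
  have F: "fst D (x, 0) = (fst M x, fst v x)" for x
    using L by (simp add: v_def prod_eq_iff)
  have S: "snd D (a, 0) (x, 0) = (snd M a x, snd v a x)" for a x
    using L by (simp add: v_def prod_eq_iff)
  have 1: "fst D (x, y) = fst (with_eps M v) (x, y)" for x y
  proof -
    have "fst D (x, y) = fst D (x, 0) + scl (graded_eps W) ?e (fst D (y, 0))"
      by (subst splitW) (simp only: D1.add D1.scale)
    then show ?thesis
      by (simp add: F eW with_eps_def add.commute)
  qed
  have 2: "snd D (a, b) (x, y) = snd (with_eps M v) (a, b) (x, y)" for a b x y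
  proof -
    have A: "snd D (a, b) (z, 0) = (snd M a z, snd v a z + snd M b z)" for z
    proof -
      have "snd D (a, b) (z, 0) = snd D (a, 0) (z, 0) + scl (graded_eps W) ?e (snd D (b, 0) (z, 0))"
        by (subst splitU) (simp only: module_hom.add[OF D3] module_hom.scale[OF D3])
      then show ?thesis
        by (simp add: S eW)
    qed
    have "snd D (a, b) (x, y)
        = snd D (a, b) (x, 0) + scl (graded_eps W) ?e (snd D (a, b) (y, 0))"
      by (subst splitW) (simp only: module_hom.add[OF D2] module_hom.scale[OF D2])
    then show ?thesis
      by (simp add: A eW with_eps_def algebra_simps)
  qed
  have "fst D = fst (with_eps M v)"
    using 1 by (intro ext) (metis surj_pair)
  moreover have "snd D = snd (with_eps M v)"
    using 2 by (intro ext) (metis surj_pair)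
  ultimately have "D = with_eps M v"
    by (simp add: prod_eq_iff)
  then show ?R
    using L uniq unfolding tangent_Mod_def by blast
qed

lemma extension_on_product:
  fixes U :: "('f::field, 'u::ab_group_add) dg_alg"
    and M :: "('f, 'u, 'm::ab_group_add) dg_mod" and N :: "('f, 'u, 'n::ab_group_add) dg_mod"
    and E :: "('f, 'u, 'm, 'n, 'x::ab_group_add) ses"
  assumes "dg_algebra U" "dg_module U M" "dg_module U N" "extension U M N E"
  shows "\<exists>E' :: ('f, 'u, 'm, 'n, 'n \<times> 'm) ses. extension U M N E' \<and> yoneda_equiv E E'"
proof -
  obtain X f g where E: "E = (X, f, g)"
    by (cases E) auto
  have X: "dg_module U X" and f: "f \<in> dg_hom N X" and g: "g \<in> dg_hom X M"
    and inj: "inj f" and surj: "surj g" and ex: "range f = {x. g x = 0}"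
    using assms(4) by (auto simp: E extension_def)
  have mX: "module (scl X)" and mM: "module (scl M)"
    using X assms by (auto simp: dg_module_def graded_module_def)
  interpret f: module_hom "scl N" "scl X" f
    using f by (simp add: dg_hom_def Hom_deg_def)
  interpret g: module_hom "scl X" "scl M" g
    using g by (simp add: dg_hom_def Hom_deg_def)
  have vX: "vector_space (scl X)" and vM: "vector_space (scl M)"
    using mX mM by (simp_all add: module_iff_vector_space)
  interpret pair: vector_space_pair "scl X" "scl M"
    using vX vM by (rule vector_space_pair.intro)
  have "Vector_Spaces.linear (scl X) (scl M) g"
    using g.module_hom_axioms by (simp only: module_hom_iff_linear)
  from pair.linear_surjective_right_inverse[OF this surj]
  obtain \<sigma> where \<sigma>: "Vector_Spaces.linear (scl M) (scl X) \<sigma>" and g\<sigma>: "g \<circ> \<sigma> = id"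
    by blast
  interpret \<sigma>: module_hom "scl M" "scl X" \<sigma>
    using \<sigma> by (simp only: module_hom_iff_linear)
  have g\<sigma>': "g (\<sigma> m) = m" for m
    using g\<sigma> by (simp add: fun_eq_iff)
  have gf: "g (f n) = 0" for n
    using ex by auto
  define h where "h = (\<lambda>(n, m). f n + \<sigma> m)"
  have hadd: "h (p + q) = h p + h q" for p q
    by (cases p; cases q) (simp add: h_def f.add \<sigma>.add)
  have "inj h"
  proof (rule injI)
    fix p q assume "h p = h q"
    moreover obtain n m n' m' where pq: "p = (n, m)" "q = (n', m')"
      by (cases p; cases q) auto
    ultimately have *: "f n + \<sigma> m = f n' + \<sigma> m'" by (simp add: h_def)
    then have "g (f n + \<sigma> m) = g (f n' + \<sigma> m')" by simp
    then have "m = m'" by (simp add: g.add gf g\<sigma>')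
    with * inj show "p = q" by (simp add: pq inj_eq)
  qed
  moreover have "surj h"
  proof (rule surjI)
    fix x
    have "x - \<sigma> (g x) \<in> range f"
      by (simp add: ex g.diff g\<sigma>')
    then show "h (inv_into UNIV f (x - \<sigma> (g x)), g x) = x"
      by (simp add: h_def f_inv_into_f)
  qed
  ultimately have bij: "bij h" by (simp add: bij_def)
  define k where "k = inv_into UNIV h"
  have hk[simp]: "h (k x) = x" and kh[simp]: "k (h p) = p" for x p
    using bij by (auto simp: k_def bij_is_surj surj_f_inv_f bij_is_inj)
  have kadd: "k (x + y) = k x + k y" for x y
    by (metis hadd hk kh)
  have h0[simp]: "h 0 = 0" by (metis add_cancel_right_right hadd)
  have k0[simp]: "k 0 = 0" by (metis h0 kh)
  have hneg: "h (- p) = - h p" for p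
    by (metis h0 hadd add.right_inverse minus_unique)
  have hsum: "h (sum c I) = (\<Sum>i\<in>I. h (c i))" for c and I :: "int set"
    by (induction I rule: infinite_finite_induct) (auto simp: hadd)
  have ksum: "k (sum c I) = (\<Sum>i\<in>I. k (c i))" for c and I :: "int set"
    by (induction I rule: infinite_finite_induct) (auto simp: kadd)
  have hz[simp]: "h p = 0 \<longleftrightarrow> p = 0" for p by (metis h0 kh)
  have kz[simp]: "k p = 0 \<longleftrightarrow> p = 0" for p by (metis k0 hk)
  have kneg: "k (- x) = - k x" for x by (metis hk hneg kh)
  have hks: "k (ksign i x) = ksign i (k x)" for i x
    by (simp add: ksign_def kneg)
  define Y :: "('f, 'u, 'n \<times> 'm) dg_mod" where
    "Y = \<lparr>scl = (\<lambda>r p. k (scl X r (h p))), gr = (\<lambda>i. {p. h p \<in> gr X i}),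
      mdif = (\<lambda>p. k (mdif X (h p))), act = (\<lambda>a p. k (act X a (h p)))\<rparr>"
  have mY: "module (scl Y)"
    by unfold_locales
      (simp_all add: Y_def hadd kadd module.scale_right_distrib[OF mX] module.scale_left_distrib[OF mX])
  have subX: "module.subspace (scl X) (gr X i)" for i
    using X by (simp add: dg_module_def graded_module_def)
  have subY: "module.subspace (scl Y) (gr Y i)" for i
    using subX[of i]
    unfolding module.subspace_def[OF mY] module.subspace_def[OF mX] by (simp add: Y_def hadd)
  have gY: "graded_module Y"
    unfolding graded_module_def
  proof (intro conjI allI mY subY)
    fix p :: "'n \<times> 'm"
    let ?P = "\<lambda>c. (\<forall>i. c i \<in> gr X i) \<and> finite {i. c i \<noteq> 0} \<and> h p = (\<Sum>i | c i \<noteq> 0. c i)"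
    have ex1: "\<exists>!c. ?P c"
      using X by (simp add: dg_module_def graded_module_def)
    then obtain c where c: "?P c" and cu: "\<forall>d. ?P d \<longrightarrow> d = c" by (rule ex1E)
    show "\<exists>!c. (\<forall>i. c i \<in> gr Y i) \<and> finite {i. c i \<noteq> 0} \<and> p = (\<Sum>i | c i \<noteq> 0. c i)"
    proof (rule ex1I)
      have "p = k (h p)" by simp
      also have "\<dots> = (\<Sum>i | c i \<noteq> 0. k (c i))"
        using c by (metis (no_types, lifting) ksum)
      finally show "(\<forall>i. k (c i) \<in> gr Y i) \<and> finite {i. k (c i) \<noteq> 0} \<and>
          p = (\<Sum>i | k (c i) \<noteq> 0. k (c i))"
        using c by (simp add: Y_def)
    next
      fix d assume d: "(\<forall>i. d i \<in> gr Y i) \<and> finite {i. d i \<noteq> 0} \<and> p = (\<Sum>i | d i \<noteq> 0. d i)"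
      then have "h p = (\<Sum>i | d i \<noteq> 0. h (d i))"
        by (metis (no_types, lifting) hsum)
      then have "?P (\<lambda>i. h (d i))"
        using d by (simp add: Y_def)
      then have "(\<lambda>i. h (d i)) = c"
        by (rule cu[rule_format])
      from this[symmetric] show "d = (\<lambda>i. k (c i))" by simp
    qed
  qed
  have hom_hk: "module_hom (scl Y) (scl X) h" "module_hom (scl X) (scl Y) k"
    unfolding module_hom_iff using mX mY by (auto simp: hadd kadd Y_def)
  have h_hom: "h \<in> dg_hom Y X" and k_hom: "k \<in> dg_hom X Y"
    using hom_hk by (auto simp: dg_hom_def Hom_deg_def Y_def)
  have comp: "\<psi> \<circ> \<phi> \<in> dg_hom A C" if "\<phi> \<in> dg_hom A B" "\<psi> \<in> dg_hom B C"
    for \<phi> \<psi> and A :: "('f, 'u, 'a::ab_group_add) dg_mod"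
      and B :: "('f, 'u, 'b::ab_group_add) dg_mod" and C :: "('f, 'u, 'c::ab_group_add) dg_mod"
    using that by (auto simp: dg_hom_def Hom_deg_def intro: module_hom_compose)
  have dX: "module_hom (scl X) (scl X) (mdif X)"
    and aX: "\<And>a. module_hom (scl X) (scl X) (act X a)"
    and aX': "\<And>x. module_hom (scl U) (scl X) (\<lambda>a. act X a x)"
    using X by (auto simp: dg_module_def Hom_deg_def Bil_deg0_def)
  have dY: "module_hom (scl Y) (scl Y) (mdif Y)"
    using module_hom_compose[OF hom_hk(1) module_hom_compose[OF dX hom_hk(2)]]
    by (simp add: Y_def comp_def)
  have aY: "module_hom (scl Y) (scl Y) (act Y a)" for a
    using module_hom_compose[OF hom_hk(1) module_hom_compose[OF aX hom_hk(2)]]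
    by (simp add: Y_def comp_def)
  have aY': "module_hom (scl U) (scl Y) (\<lambda>a. act Y a p)" for p
    using module_hom_compose[OF aX' hom_hk(2), of "h p"]
    by (simp add: Y_def comp_def)
  have "dg_module U Y"
    unfolding dg_module_def
  proof (intro conjI)
    show "mdif Y \<in> Hom_deg (- 1) Y Y"
      using X dY by (auto simp: Y_def dg_module_def Hom_deg_def)
    show "act Y \<in> Bil_deg0 U Y Y"
      using X aY aY' by (auto simp: Y_def dg_module_def Bil_deg0_def)
    show "\<forall>i. \<forall>a\<in>gr U i. \<forall>x. mdif Y (act Y a x) = act Y (dif U a) x + ksign i (act Y a (mdif Y x))"
      using X by (simp add: Y_def dg_module_def flip: hks kadd)
  qed (use X gY in \<open>simp_all add: Y_def dg_module_def\<close>)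
  moreover have "k \<circ> f \<in> dg_hom N Y" "g \<circ> h \<in> dg_hom Y M"
    using comp[OF f k_hom] comp[OF h_hom g] by auto
  moreover have "bij k"
    using bij by (simp add: k_def bij_imp_bij_inv)
  then have "inj (k \<circ> f)" "surj (g \<circ> h)"
    using inj surj \<open>surj h\<close> by (simp_all only: inj_compose comp_surj bij_is_inj)
  moreover have "range (k \<circ> f) = {p. (g \<circ> h) p = 0}"
  proof -
    have "range (k \<circ> f) = k ` {x. g x = 0}" by (simp add: image_comp flip: ex)
    also have "\<dots> = {p. (g \<circ> h) p = 0}"
      by (auto simp: image_iff) (metis kh)
    finally show ?thesis .
  qed
  ultimately have "extension U M N (Y, k \<circ> f, g \<circ> h)"
    by (simp add: extension_def)
  moreover have "yoneda_equiv E (Y, k \<circ> f, g \<circ> h)"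
    using k_hom \<open>bij k\<close> by (auto simp: E yoneda_equiv_def fun_eq_iff intro!: bexI[of _ k])
  ultimately show ?thesis by blast
qed

end

theory Submission
  imports Defs "Jordan_Normal_Form.Determinant"
begin

text \<open>
  Both sides are compared with cocycles modulo coboundaries. Let \<open>M = (W, \<partial>, \<mu>)\<close>.

  A first order deformation of \<open>M\<close> is a pair \<open>v = (\<partial>', \<mu>')\<close>, and the coefficients of \<open>\<epsilon>\<close> in the
  equations of a DG module over \<open>U[\<epsilon>]\<close> are linear equations on \<open>v\<close> (\<open>tangent_Mod_eq_cocycles\<close>).
  They are exactly the equations under which \<open>(n, m) \<mapsto> (\<partial> n + \<partial>' m, \<partial> m)\<close> and
  \<open>a (n, m) = (a n + \<mu>' a m, a m)\<close> turn \<open>W \<times> W\<close> into a DG module, so that each such \<open>v\<close> gives an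
  extension of \<open>M\<close> by itself. Since \<open>F\<close> is a field, the surjection in an arbitrary extension has a
  section that is linear of degree 0, and the failure of this section to be a morphism is such a
  \<open>v\<close>: every extension is obtained (\<open>extension_equiv_twisted\<close>). Adding deformations corresponds to
  the Baer sum, and the extension of \<open>v\<close> splits iff \<open>v = ([\<theta>, \<partial>], [\<theta>, \<mu>])\<close> for an endomorphism
  \<open>\<theta>\<close> of degree 0 of \<open>W\<close> (\<open>twisted_ext_splits_iff\<close>). All this works for two modules \<open>M\<close>, \<open>N\<close> and
  identifies the Yoneda Ext group with cocycles modulo coboundaries
  (\<open>YExt_iso_cocycles_mod_coboundaries\<close>).

  What remains is that the tangent space of the orbit at \<open>M\<close> is the space of coboundaries. In the
  language of group actions, the image of the differential of the orbit map fills the tangent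
  space. This is usually deduced from smoothness of the orbit and of the stabiliser by counting
  dimensions; the argument here is elementary and independent of the characteristic.

  A coboundary is the velocity at \<open>t = 0\<close> of \<open>t \<mapsto> (1 + t \<theta>) \<cdot> M\<close>, a curve in the orbit which is
  rational in \<open>t\<close> because \<open>\<theta>\<close> satisfies a polynomial equation. Clearing denominators shows that the
  differential at \<open>M\<close> of a polynomial function vanishing on the orbit kills it
  (\<open>coboundary_tangent_to_orbit\<close>).

  Conversely, for a structure \<open>N\<close> on \<open>W\<close> consider the linear map
  \<open>\<Phi>\<^sub>N : \<theta> \<mapsto> (\<theta> \<partial>\<^sub>M - \<partial>\<^sub>N \<theta>, \<theta> \<mu>\<^sub>M - \<mu>\<^sub>N \<theta>)\<close>, whose kernel is the space of morphisms from \<open>M\<close> to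
  \<open>N\<close>. On the orbit its rank is constant, so the minors of \<open>\<Phi>\<^sub>N\<close> of the next larger size are
  polynomial functions of \<open>N\<close> vanishing on the orbit. A vector \<open>v\<close> killed by their differentials at
  \<open>M\<close> satisfies \<open>d\<Phi>(v)(\<theta>) \<in> range \<Phi>\<^sub>M\<close> for every \<open>\<theta>\<close> in the kernel of \<open>\<Phi>\<^sub>M\<close>. The identity is in this
  kernel and \<open>d\<Phi>(v)(id) = - v\<close>, so \<open>v\<close> is a coboundary
  (\<open>zariski_tangent_rank_condition\<close>, \<open>tangent_orbit_subset_coboundaries\<close>).
\<close>

section \<open>Homogeneous components\<close>

definition homogeneous_part :: "('r, 'a::ab_group_add, 'z) graded_mod_scheme \<Rightarrow> int \<Rightarrow> 'a \<Rightarrow> 'a" where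
  "homogeneous_part V i x =
     (THE c. (\<forall>i. c i \<in> gr V i) \<and> finite {i. c i \<noteq> 0} \<and> x = (\<Sum>i | c i \<noteq> 0. c i)) i"

lemma homogeneous_part:
  assumes "graded_module V"
  shows "homogeneous_part V i x \<in> gr V i" "finite {i. homogeneous_part V i x \<noteq> 0}"
    "x = (\<Sum>i | homogeneous_part V i x \<noteq> 0. homogeneous_part V i x)"
proof -
  have "\<exists>!c. (\<forall>i. c i \<in> gr V i) \<and> finite {i. c i \<noteq> 0} \<and> x = (\<Sum>i | c i \<noteq> 0. c i)"
    using assms by (simp add: graded_module_def)
  from theI'[OF this] show "homogeneous_part V i x \<in> gr V i" "finite {i. homogeneous_part V i x \<noteq> 0}"
    "x = (\<Sum>i | homogeneous_part V i x \<noteq> 0. homogeneous_part V i x)"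
    unfolding homogeneous_part_def by blast+
qed

lemma homogeneous_part_unique:
  assumes V: "graded_module V" and c: "\<And>i. c i \<in> gr V i"
    and S: "finite S" "\<And>i. i \<notin> S \<Longrightarrow> c i = 0" and x: "x = (\<Sum>i\<in>S. c i)"
  shows "homogeneous_part V i x = c i"
proof -
  let ?P = "\<lambda>c. (\<forall>i. c i \<in> gr V i) \<and> finite {i. c i \<noteq> 0} \<and> x = (\<Sum>i | c i \<noteq> 0. c i)"
  have sub: "{i. c i \<noteq> 0} \<subseteq> S" using S(2) by blast
  have "?P c"
    using c x sub S(1) by (auto intro: finite_subset sum.mono_neutral_right)
  moreover have "\<exists>!c. ?P c"
    using V by (simp add: graded_module_def)
  ultimately have "(THE c. ?P c) = c"
    by (intro the1_equality)
  then show ?thesis by (simp only: homogeneous_part_def)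
qed

text \<open>
  An element is the sum of its components, so linear identities can be checked degree by degree.
\<close>

lemma homogeneous_part_eqI:
  assumes V: "graded_module V" and eq: "\<And>i. homogeneous_part V i x = homogeneous_part V i y"
  shows "x = y"
proof -
  have "x = (\<Sum>i | homogeneous_part V i x \<noteq> 0. homogeneous_part V i x)" by (rule homogeneous_part(3)[OF V])
  also have "\<dots> = (\<Sum>i | homogeneous_part V i y \<noteq> 0. homogeneous_part V i y)" by (simp only: eq)
  also have "\<dots> = y" by (rule homogeneous_part(3)[OF V, symmetric])
  finally show ?thesis .
qed

lemma gr_closed:
  fixes V :: "('r::comm_ring_1, 'a::ab_group_add, 'z) graded_mod_scheme"
  assumes V: "graded_module V"
  shows "0 \<in> gr V i" "x \<in> gr V i \<Longrightarrow> y \<in> gr V i \<Longrightarrow> x + y \<in> gr V i"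
    "x \<in> gr V i \<Longrightarrow> y \<in> gr V i \<Longrightarrow> x - y \<in> gr V i" "x \<in> gr V i \<Longrightarrow> - x \<in> gr V i"
    "x \<in> gr V i \<Longrightarrow> scl V r x \<in> gr V i" "x \<in> gr V i \<Longrightarrow> ksign k x \<in> gr V i"
proof -
  interpret Modules.module "scl V" using V by (simp add: graded_module_def)
  have sub: "subspace (gr V i)" using V by (simp add: graded_module_def)
  show "0 \<in> gr V i" "x \<in> gr V i \<Longrightarrow> y \<in> gr V i \<Longrightarrow> x + y \<in> gr V i"
    "x \<in> gr V i \<Longrightarrow> y \<in> gr V i \<Longrightarrow> x - y \<in> gr V i" "x \<in> gr V i \<Longrightarrow> - x \<in> gr V i"
    "x \<in> gr V i \<Longrightarrow> scl V r x \<in> gr V i" "x \<in> gr V i \<Longrightarrow> ksign k x \<in> gr V i"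
    using sub subspace_0 subspace_add subspace_diff subspace_neg subspace_scale
    by (auto simp: ksign_def)
qed

lemma homogeneous_part_of_homogeneous:
  assumes V: "graded_module V" and x: "x \<in> gr V i"
  shows "homogeneous_part V j x = (if j = i then x else 0)"
  by (rule homogeneous_part_unique[OF V, of _ "{i}"]) (use x gr_closed(1)[OF V] in auto)

lemma homogeneous_part_0: "graded_module V \<Longrightarrow> homogeneous_part V i 0 = 0"
  using homogeneous_part_of_homogeneous[OF _ gr_closed(1), of V i i] by simp

lemma homogeneous_part_add:
  assumes V: "graded_module V"
  shows "homogeneous_part V i (x + y) = homogeneous_part V i x + homogeneous_part V i y"
proof (rule homogeneous_part_unique[OF V, of _ "{i. homogeneous_part V i x \<noteq> 0} \<union> {i. homogeneous_part V i y \<noteq> 0}"])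
  let ?S = "{i. homogeneous_part V i x \<noteq> 0} \<union> {i. homogeneous_part V i y \<noteq> 0}"
  have fin: "finite ?S" using homogeneous_part(2)[OF V] by blast
  have "x = (\<Sum>i\<in>?S. homogeneous_part V i x)" "y = (\<Sum>i\<in>?S. homogeneous_part V i y)"
    using fin by (rule trans[OF homogeneous_part(3)[OF V] sum.mono_neutral_left]; auto)+
  then show "x + y = (\<Sum>i\<in>?S. homogeneous_part V i x + homogeneous_part V i y)"
    unfolding sum.distrib by (rule arg_cong2)
  show "finite ?S" by (rule fin)
qed (use homogeneous_part(1)[OF V] gr_closed(2)[OF V] in auto)

lemma homogeneous_part_hom:
  assumes V: "graded_module V" and W: "graded_module W" and f: "f \<in> Hom_deg 0 V W"
  shows "homogeneous_part W i (f x) = f (homogeneous_part V i x)"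
proof (rule homogeneous_part_unique[OF W, of _ "{i. homogeneous_part V i x \<noteq> 0}"])
  interpret f: module_hom "scl V" "scl W" f using f by (simp add: Hom_deg_def)
  show "f x = (\<Sum>i | homogeneous_part V i x \<noteq> 0. f (homogeneous_part V i x))"
    by (subst homogeneous_part(3)[OF V, of x]) (rule f.sum)
  show "\<And>i. f (homogeneous_part V i x) \<in> gr W i"
    using f homogeneous_part(1)[OF V] by (auto simp: Hom_deg_def)
qed (use homogeneous_part(2)[OF V] f in \<open>auto simp: Hom_deg_def module_hom.zero\<close>)

lemma homogeneous_part_scale:
  assumes V: "graded_module V"
  shows "homogeneous_part V i (scl V r x) = scl V r (homogeneous_part V i x)"
proof (rule homogeneous_part_hom[OF V V])
  interpret Modules.module "scl V" using V by (simp add: graded_module_def)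
  show "scl V r \<in> Hom_deg 0 V V"
    using gr_closed(5)[OF V] module_hom_scale_self by (auto simp: Hom_deg_def)
qed

text \<open>
  The components of \<open>f x\<close> are the images of the components of \<open>x\<close>, so all but the one of degree
  \<open>i\<close> are in the kernel.
\<close>

lemma inj_hom_reflects_degree:
  assumes V: "graded_module V" and W: "graded_module W" and f: "f \<in> Hom_deg 0 V W" "inj f"
    and x: "f x \<in> gr W i"
  shows "x \<in> gr V i"
proof -
  have "f (homogeneous_part V j x) = f (if j = i then x else 0)" for j
    using homogeneous_part_hom[OF V W f(1), of j x] homogeneous_part_of_homogeneous[OF W x, of j] f(1)
    by (auto simp: Hom_deg_def module_hom.zero)
  then have "homogeneous_part V i x = x"
    using injD[OF f(2)] by (metis (full_types))
  then show ?thesis using homogeneous_part(1)[OF V] by metis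
qed

lemma Hom_deg_0_inverse:
  assumes V: "graded_module V" and W: "graded_module W" and f: "f \<in> Hom_deg 0 V W" "bij f"
  shows "inv_into UNIV f \<in> Hom_deg 0 W V"
proof -
  interpret f: module_hom "scl V" "scl W" f using f by (simp add: Hom_deg_def)
  have ff: "f (inv_into UNIV f x) = x" for x
    using f(2) by (simp add: bij_is_surj surj_f_inv_f)
  have inj: "f x = f y \<Longrightarrow> x = y" for x y using f(2) by (simp add: bij_is_inj inj_eq)
  have "module_hom (scl W) (scl V) (inv_into UNIV f)"
    unfolding module_hom_iff
    using f.m1.module_axioms f.m2.module_axioms by (auto intro!: inj simp: ff f.add f.scale)
  then show ?thesis
    using inj_hom_reflects_degree[OF V W f(1) bij_is_inj[OF f(2)]] by (auto simp: Hom_deg_def ff)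
qed

lemma graded_decomposition_Times:
  fixes V :: "('r::comm_ring_1, 'a::ab_group_add, 'y) graded_mod_scheme"
    and W :: "('s::comm_ring_1, 'b::ab_group_add, 'z) graded_mod_scheme"
  assumes V: "graded_module V" and W: "graded_module W"
  shows "\<exists>!c. (\<forall>i. c i \<in> gr V i \<times> gr W i) \<and> finite {i. c i \<noteq> 0} \<and> p = (\<Sum>i | c i \<noteq> 0. c i)"
proof (rule ex1I)
  let ?c = "\<lambda>i. (homogeneous_part V i (fst p), homogeneous_part W i (snd p))"
  have c: "{i. ?c i \<noteq> 0} = {i. homogeneous_part V i (fst p) \<noteq> 0} \<union> {i. homogeneous_part W i (snd p) \<noteq> 0}"
    by (auto simp: prod_eq_iff)
  then have fin: "finite {i. ?c i \<noteq> 0}"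
    using homogeneous_part(2)[OF V] homogeneous_part(2)[OF W] by simp
  have "fst p = (\<Sum>i | ?c i \<noteq> 0. homogeneous_part V i (fst p))"
    by (rule trans[OF homogeneous_part(3)[OF V]], rule sum.mono_neutral_left[OF fin]) (auto simp: prod_eq_iff)
  moreover have "snd p = (\<Sum>i | ?c i \<noteq> 0. homogeneous_part W i (snd p))"
    by (rule trans[OF homogeneous_part(3)[OF W]], rule sum.mono_neutral_left[OF fin]) (auto simp: prod_eq_iff)
  ultimately have "p = (\<Sum>i | ?c i \<noteq> 0. ?c i)"
    by (intro prod_eqI) (simp_all add: fst_sum snd_sum)
  then show "(\<forall>i. ?c i \<in> gr V i \<times> gr W i) \<and> finite {i. ?c i \<noteq> 0} \<and> p = (\<Sum>i | ?c i \<noteq> 0. ?c i)"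
    using fin homogeneous_part(1)[OF V] homogeneous_part(1)[OF W] by blast
next
  fix c assume c: "(\<forall>i. c i \<in> gr V i \<times> gr W i) \<and> finite {i. c i \<noteq> 0} \<and> p = (\<Sum>i | c i \<noteq> 0. c i)"
  then have mem: "\<And>i. fst (c i) \<in> gr V i" "\<And>i. snd (c i) \<in> gr W i"
    and fin: "finite {i. c i \<noteq> 0}" and p: "p = (\<Sum>i | c i \<noteq> 0. c i)"
    by (auto simp: mem_Times_iff)
  have "homogeneous_part V i (fst p) = fst (c i)" for i
    using mem by (intro homogeneous_part_unique[OF V _ fin]) (auto simp: fst_sum p zero_prod_def)
  moreover have "homogeneous_part W i (snd p) = snd (c i)" for i
    using mem by (intro homogeneous_part_unique[OF W _ fin]) (auto simp: snd_sum p zero_prod_def)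
  ultimately show "c = (\<lambda>i. (homogeneous_part V i (fst p), homogeneous_part W i (snd p)))"
    by (simp add: fun_eq_iff prod_eq_iff)
qed

text \<open>
  Over a field \<open>g\<close> has a linear section \<open>\<tau>\<close>. Keeping only the degree 0 part of \<open>\<tau>\<close>, that is
  applying \<open>\<tau>\<close> to the component of degree \<open>i\<close> and projecting the result back to degree \<open>i\<close>, leaves
  a section because \<open>g\<close> commutes with the projections.
\<close>

lemma graded_section:
  fixes V :: "('f::field, 'a::ab_group_add, 'y) graded_mod_scheme"
    and W :: "('f, 'b::ab_group_add, 'z) graded_mod_scheme"
  assumes V: "graded_module V" and W: "graded_module W" and g: "g \<in> Hom_deg 0 V W" "surj g"
  shows "\<exists>\<sigma> \<in> Hom_deg 0 W V. \<forall>x. g (\<sigma> x) = x"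
proof -
  have vV: "vector_space (scl V)" and vW: "vector_space (scl W)"
    using V W by (simp_all add: graded_module_def module_iff_vector_space)
  interpret pair: vector_space_pair "scl V" "scl W"
    using vV vW by (rule vector_space_pair.intro)
  have "Vector_Spaces.linear (scl V) (scl W) g"
    using g(1) by (simp add: Hom_deg_def module_hom_iff_linear)
  from pair.linear_surjective_right_inverse[OF this g(2)]
  obtain \<tau> where \<tau>: "module_hom (scl W) (scl V) \<tau>" and "g \<circ> \<tau> = id"
    by (auto simp: module_hom_iff_linear)
  then have g\<tau>: "g (\<tau> x) = x" for x by (simp add: fun_eq_iff)
  interpret \<tau>: module_hom "scl W" "scl V" \<tau> by (rule \<tau>)
  define \<sigma> where "\<sigma> = (\<lambda>x. \<Sum>i | homogeneous_part W i x \<noteq> 0. homogeneous_part V i (\<tau> (homogeneous_part W i x)))"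
  have comp: "homogeneous_part V i (\<sigma> x) = homogeneous_part V i (\<tau> (homogeneous_part W i x))" for i x
    by (rule homogeneous_part_unique[OF V _ homogeneous_part(2)[OF W, of x]])
      (auto simp: \<sigma>_def homogeneous_part(1)[OF V] \<tau>.zero homogeneous_part_0[OF V])
  have "\<sigma> (x + y) = \<sigma> x + \<sigma> y" for x y
    by (rule homogeneous_part_eqI[OF V]) (simp add: comp homogeneous_part_add[OF V] homogeneous_part_add[OF W] \<tau>.add)
  moreover have "\<sigma> (scl W r x) = scl V r (\<sigma> x)" for r x
    by (rule homogeneous_part_eqI[OF V]) (simp add: comp homogeneous_part_scale[OF V] homogeneous_part_scale[OF W] \<tau>.scale)
  moreover have "\<sigma> x \<in> gr V i" if "x \<in> gr W i" for x i
  proof -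
    have "\<sigma> x = homogeneous_part V i (\<tau> x)"
      by (rule homogeneous_part_eqI[OF V])
        (simp add: comp homogeneous_part_of_homogeneous[OF W that] homogeneous_part_of_homogeneous[OF V homogeneous_part(1)[OF V]]
          homogeneous_part_0[OF V] \<tau>.zero)
    then show ?thesis by (simp add: homogeneous_part(1)[OF V])
  qed
  ultimately have "\<sigma> \<in> Hom_deg 0 W V"
    using pair.vs1.module_axioms pair.vs2.module_axioms by (simp add: Hom_deg_def module_hom_iff)
  moreover have "g (\<sigma> x) = x" for x
  proof (rule homogeneous_part_eqI[OF W])
    fix i
    have "homogeneous_part W i (g (\<sigma> x)) = homogeneous_part W i (g (\<tau> (homogeneous_part W i x)))"
      by (simp add: homogeneous_part_hom[OF V W g(1)] comp)
    then show "homogeneous_part W i (g (\<sigma> x)) = homogeneous_part W i x"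
      by (simp add: g\<tau> homogeneous_part_of_homogeneous[OF W homogeneous_part(1)[OF W]])
  qed
  ultimately show ?thesis by blast
qed
section \<open>Linear algebra and polynomials over an infinite field\<close>

text \<open>
  Over a finite field the product of all \<open>X - a\<close>, increased by 1, has no root.
\<close>

lemma infinite_UNIV_alg_closed_field: "infinite (UNIV :: 'f::alg_closed_field set)"
proof
  assume fin: "finite (UNIV :: 'f set)"
  define p where "p = (\<Prod>a\<in>(UNIV :: 'f set). [:- a, 1:])"
  have "degree p = card (UNIV :: 'f set)"
    unfolding p_def by (subst degree_prod_eq_sum_degree) auto
  moreover have "card (UNIV :: 'f set) > 0"
    using fin by (simp add: card_gt_0_iff)
  ultimately have "degree (p + 1) > 0"
    by (subst degree_add_eq_left) auto
  then obtain z where "poly (p + 1) z = 0"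
    using alg_closed_imp_poly_has_root by blast
  moreover have "poly p z = 0"
    unfolding p_def poly_prod using fin by (auto simp: prod_zero_iff)
  ultimately show False by simp
qed

lemma poly_eqI_cofinite:
  fixes p q :: "'f::idom poly"
  assumes "infinite (UNIV :: 'f set)" "finite T" "\<And>t. t \<notin> T \<Longrightarrow> poly p t = poly q t"
  shows "p = q"
proof (rule ccontr)
  assume "p \<noteq> q"
  then have "finite {t. poly (p - q) t = 0}"
    by (intro poly_roots_finite) simp
  moreover have "UNIV - T \<subseteq> {t. poly (p - q) t = 0}"
    using assms(3) by auto
  ultimately show False
    using assms(1,2) by (meson finite_Diff2 finite_subset)
qed

lemma (in vector_space) span_image_finite:
  assumes "finite S" "x \<in> span (u ` S)"
  shows "\<exists>c. x = (\<Sum>i\<in>S. c i *s u i)"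
  using assms
proof (induction S arbitrary: x rule: finite_induct)
  case (insert i S)
  then obtain k where "x - k *s u i \<in> span (u ` S)"
    by (auto simp: span_breakdown_eq)
  then obtain c where "x - k *s u i = (\<Sum>i\<in>S. c i *s u i)"
    using insert.IH by blast
  moreover have "(\<Sum>j\<in>S. (c(i := k)) j *s u j) = (\<Sum>j\<in>S. c j *s u j)"
    using insert.hyps by (intro sum.cong) auto
  ultimately have "x = (\<Sum>j\<in>insert i S. (c(i := k)) j *s u j)"
    using insert.hyps by (simp add: algebra_simps)
  then show ?case by blast
qed simp

lemma vector_space_pointwise:
  assumes "vector_space s"
  shows "vector_space (\<lambda>r f x. s r (f x))"
proof -
  interpret vector_space s by (rule assms)
  show ?thesis by unfold_locales (auto simp: algebra_simps)
qed

lemma sum_fun_apply: "(\<Sum>i\<in>S. f i) x = (\<Sum>i\<in>S. f i x)"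
  by (induction S rule: infinite_finite_induct) auto

text \<open>
  The matrix units of a finite basis span all linear endomorphisms.
\<close>

lemma finite_span_endomorphisms:
  fixes s :: "'f::field \<Rightarrow> 'w::ab_group_add \<Rightarrow> 'w"
  assumes s: "vector_space s" and B: "finite B" "module.span s B = UNIV"
  shows "\<exists>E. finite E \<and> {\<theta>. module_hom s s \<theta>} \<subseteq> module.span (\<lambda>r f x. s r (f x)) E"
proof -
  interpret vector_space s by (rule s)
  interpret P: vector_space "\<lambda>r (f :: 'w \<Rightarrow> 'w) x. s r (f x)"
    by (rule vector_space_pointwise) (rule s)
  obtain B' where B': "B' \<subseteq> B" "independent B'" "span B' = UNIV"
    using maximal_independent_subset[of B] B(2) by (metis span_span span_mono top.extremum_uniqueI)
  have fin: "finite B'" using B(1) B'(1) finite_subset by blast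
  define e where "e = (\<lambda>b c x. s (representation B' x b) c)"
  have rep: "x = (\<Sum>b\<in>B'. s (representation B' x b) b)" for x
    using sum_representation_eq[OF B'(2), of x B'] B'(3) fin by simp
  have "\<theta> \<in> P.span ((\<lambda>(b, c). e b c) ` (B' \<times> B'))" if "module_hom s s \<theta>" for \<theta>
  proof -
    interpret \<theta>: module_hom s s \<theta> by (rule that)
    have *: "\<theta> x = (\<Sum>b\<in>B'. \<Sum>c\<in>B'. s (representation B' (\<theta> b) c) (e b c x))" for x
    proof -
      have "\<theta> x = (\<Sum>b\<in>B'. s (representation B' x b) (\<theta> b))"
        by (subst rep[of x]) (simp add: \<theta>.sum \<theta>.scale)
      also have "\<dots> = (\<Sum>b\<in>B'. \<Sum>c\<in>B'. s (representation B' (\<theta> b) c) (e b c x))"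
        by (subst rep[of "\<theta> _"]) (simp add: scale_sum_right e_def mult.commute)
      finally show ?thesis .
    qed
    have "\<theta> = (\<Sum>b\<in>B'. \<Sum>c\<in>B'. (\<lambda>x. s (representation B' (\<theta> b) c) (e b c x)))"
      unfolding fun_eq_iff sum_fun_apply by (intro allI *)
    also have "\<dots> \<in> P.span ((\<lambda>(b, c). e b c) ` (B' \<times> B'))"
      by (intro P.span_sum P.span_scale P.span_base) auto
    finally show ?thesis .
  qed
  then show ?thesis
    using fin by (intro exI[of _ "(\<lambda>(b, c). e b c) ` (B' \<times> B')"]) auto
qed

text \<open>
  Applied to the powers of an endomorphism of a finite dimensional space, this yields a monic
  polynomial annihilating the endomorphism.
\<close>

lemma (in vector_space) ex_in_span_initial:
  fixes u :: "nat \<Rightarrow> 'b"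
  assumes "finite E" "range u \<subseteq> span E"
  shows "\<exists>n. u n \<in> span (u ` {..<n})"
proof (rule ccontr)
  assume "\<nexists>n. u n \<in> span (u ` {..<n})"
  then have n: "u n \<notin> span (u ` {..<n})" for n by blast
  have "independent (u ` {..<n}) \<and> card (u ` {..<n}) = n" for n
  proof (induction n)
    case (Suc n)
    have "u n \<notin> u ` {..<n}" using n[of n] span_base[of "u n" "u ` {..<n}"] by auto
    moreover have "u ` {..<Suc n} = insert (u n) (u ` {..<n})"
      by (simp add: lessThan_Suc)
    ultimately show ?case
      using Suc.IH n[of n] by (metis card_insert_disjoint finite_imageI finite_lessThan independent_insert)
  qed (simp add: independent_empty)
  then have "independent (u ` {..<Suc (card E)})" "card (u ` {..<Suc (card E)}) = Suc (card E)"
    by blast+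
  moreover have "u ` {..<Suc (card E)} \<subseteq> span E"
    using assms(2) by (rule order.trans[OF image_mono[OF subset_UNIV]])
  ultimately show False
    using independent_span_bound[OF assms(1)] by (metis not_less_eq_eq order_refl)
qed

section \<open>Zariski tangent vectors: a determinantal upper bound\<close>

lemma poly_functions_sum:
  "(\<And>i. i \<in> S \<Longrightarrow> f i \<in> poly_functions s) \<Longrightarrow> (\<lambda>y. \<Sum>i\<in>S. f i y) \<in> poly_functions s"
  by (induction S rule: infinite_finite_induct)
    (auto intro: poly_functions.const poly_functions.add)

lemma poly_functions_prod:
  "(\<And>i. i \<in> S \<Longrightarrow> f i \<in> poly_functions s) \<Longrightarrow> (\<lambda>y. \<Prod>i\<in>S. f i y) \<in> poly_functions s"
  by (induction S rule: infinite_finite_induct)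
    (auto intro: poly_functions.const poly_functions.mult)

lemma poly_functions_det:
  assumes "\<And>i j. i < n \<Longrightarrow> j < n \<Longrightarrow> a i j \<in> poly_functions s"
  shows "(\<lambda>y. det (mat n n (\<lambda>(i, j). a i j y))) \<in> poly_functions s"
proof -
  have "(\<lambda>y. \<Sum>p | p permutes {0..<n}. signof p * (\<Prod>i = 0..<n. a i (p i) y)) \<in> poly_functions s"
    using assms
    by (intro poly_functions_sum poly_functions.mult[OF poly_functions.const] poly_functions_prod)
      (auto simp: permutes_in_image)
  also have "(\<lambda>y. \<Sum>p | p permutes {0..<n}. signof p * (\<Prod>i = 0..<n. a i (p i) y)) =
      (\<lambda>y. det (mat n n (\<lambda>(i, j). a i j y)))"
    by (intro ext, subst det_def'[of _ n])
      (auto intro!: sum.cong prod.cong simp: permutes_in_image)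
  finally show ?thesis .
qed

lemma det_zero_row:
  assumes "n > 0"
  shows "det (mat n n (\<lambda>(i, j). if i = 0 then 0 else a i j) :: 'f::comm_ring_1 mat) = 0"
proof (subst det_def'[of _ n])
  show "(\<Sum>p | p permutes {0..<n}. signof p *
      (\<Prod>i = 0..<n. mat n n (\<lambda>(i, j). if i = 0 then 0 else a i j) $$ (i, p i))) = (0 :: 'f)"
  proof (intro sum.neutral ballI)
    fix p assume "p \<in> {p. p permutes {0..<n}}"
    then have "p 0 < n" using assms by (auto simp: permutes_in_image)
    then have "(\<Prod>i = 0..<n. mat n n (\<lambda>(i, j). if i = 0 then 0 else a i j) $$ (i, p i)) = (0 :: 'f)"
      using assms by (intro prod_zero) (auto intro!: bexI[of _ 0])
    then show "signof p *
      (\<Prod>i = 0..<n. mat n n (\<lambda>(i, j). if i = 0 then 0 else a i j) $$ (i, p i)) = (0 :: 'f)"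
      by simp
  qed
qed simp

text \<open>
  A family \<open>\<Psi>\<close> of affine maps, evaluated at a point \<open>y\<close>, spans a space whose dimension is the rank
  of the family at \<open>y\<close>. If on \<open>X\<close> this rank is bounded by the rank \<open>r\<close> at \<open>x\<close>, then all minors of
  size \<open>r + 1\<close> of the family vanish on \<open>X\<close>. If a member \<open>\<psi>0\<close> vanishes at \<open>x\<close> and
  \<open>\<psi>0 (x + v)\<close> were outside the span at \<open>x\<close>, then a suitable minor involving \<open>\<psi>0\<close> would have a nonzero
  derivative along \<open>v\<close>. The rank bound is assumed in the form in which it holds along an orbit: the
  values at \<open>y\<close> are images of values at \<open>x\<close> under a linear map \<open>T\<close>.
\<close>

lemma zariski_tangent_rank_condition:
  fixes s :: "'f::field \<Rightarrow> 'a::ab_group_add \<Rightarrow> 'a" and s' :: "'f \<Rightarrow> 'b::ab_group_add \<Rightarrow> 'b"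
  assumes inf: "infinite (UNIV :: 'f set)" and s: "vector_space s" and s': "vector_space s'"
    and v: "v \<in> zariski_tangent s A X x"
    and sub: "module.subspace s' ((\<lambda>\<psi>. \<psi> x) ` \<Psi>)"
    and fin: "finite B" "(\<lambda>\<psi>. \<psi> x) ` \<Psi> \<subseteq> module.span s' B"
    and affine: "\<And>\<psi>. \<psi> \<in> \<Psi> \<Longrightarrow> \<exists>\<phi>. module_hom s s' \<phi> \<and> (\<forall>y. \<psi> y = \<psi> 0 + \<phi> y)"
    and rank: "\<And>y. y \<in> X \<Longrightarrow>
      \<exists>T. module_hom s' s' T \<and> (\<forall>\<psi>\<in>\<Psi>. \<exists>\<psi>'\<in>\<Psi>. \<psi> y = T (\<psi>' x))"
    and \<psi>0: "\<psi>0 \<in> \<Psi>" "\<psi>0 x = 0"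
  shows "\<psi>0 (x + v) \<in> (\<lambda>\<psi>. \<psi> x) ` \<Psi>"
proof (rule ccontr)
  interpret V: vector_space s by (rule s)
  interpret C: vector_space s' by (rule s')
  interpret F: vector_space_pair s' "(*) :: 'f \<Rightarrow> 'f \<Rightarrow> 'f"
    by unfold_locales (auto simp: algebra_simps)
  define I where "I = (\<lambda>\<psi>. \<psi> x) ` \<Psi>"
  define w where "w = \<psi>0 (x + v)"
  assume "\<psi>0 (x + v) \<notin> (\<lambda>\<psi>. \<psi> x) ` \<Psi>"
  then have w: "w \<notin> I" by (simp add: I_def w_def)
  obtain B' where B': "B' \<subseteq> I" "C.independent B'" "I \<subseteq> C.span B'"
    using C.maximal_independent_subset by blast
  then have I: "I = C.span B'"
    using C.span_minimal[OF B'(1)] sub by (auto simp: I_def)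
  have finB': "finite B'"
    using C.independent_span_bound[OF fin(1) B'(2)] B'(1) fin(2) by (auto simp: I_def)
  define n where "n = Suc (card B')"
  have "card {1..<n} = card B'" by (simp add: n_def)
  then obtain e where e: "bij_betw e {1..<n} B'"
    using finite_same_card_bij[of "{1..<n}" B'] finB' by auto
  \<comment> \<open>index 0 is the vector assumed to lie outside \<open>I\<close>, the other indices run through a basis of \<open>I\<close>\<close>
  define b where "b = e(0 := w)"
  have b0: "b 0 = w" by (simp add: b_def)
  have n: "{0..<n} = insert 0 {1..<n}" by (auto simp: n_def)
  have b_image: "b ` {0..<n} = insert w B'"
    using e unfolding n by (auto simp: b_def bij_betw_def)
  have "inj_on b {0..<n}"
  proof (rule eq_card_imp_inj_on)
    show "card (b ` {0..<n}) = card {0..<n}"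
      using w B'(1) finB' by (subst b_image, subst card_insert_disjoint) (auto simp: n_def)
  qed simp
  then have b_inj: "b i = b j \<longleftrightarrow> i = j" if "i < n" "j < n" for i j
    using that by (auto simp: inj_on_def)
  have "C.independent (b ` {0..<n})"
    using w B'(2) by (simp add: b_image I C.independent_insert)
  then have "\<exists>l. Vector_Spaces.linear s' (*) l \<and> (\<forall>j<n. l (b j) = (if i = j then 1 else 0))"
    if "i < n" for i
    using F.linear_independent_extend[of "b ` {0..<n}" "\<lambda>z. if z = b i then 1 else 0"] that b_inj
    by fastforce
  \<comment> \<open>the functionals dual to the independent family \<open>b\<close>\<close>
  then obtain l where l: "\<And>i. i < n \<Longrightarrow> module_hom s' (*) (l i)"
    and lb: "\<And>i j. i < n \<Longrightarrow> j < n \<Longrightarrow> l i (b j) = (if i = j then 1 else 0)"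
    unfolding module_hom_iff_linear by metis
  have "\<exists>\<psi>\<in>\<Psi>. if j = 0 then \<psi> = \<psi>0 else \<psi> x = b j" if "j < n" for j
  proof (cases "j = 0")
    case False
    then have "b j \<in> I"
      using e B'(1) that by (auto simp: b_def bij_betw_def)
    with False show ?thesis by (auto simp: I_def)
  qed (use \<psi>0 in auto)
  then obtain g where g: "\<And>j. j < n \<Longrightarrow> g j \<in> \<Psi>"
    and g0: "\<And>j. j < n \<Longrightarrow> j = 0 \<Longrightarrow> g j = \<psi>0"
    and gb: "\<And>j. j < n \<Longrightarrow> j \<noteq> 0 \<Longrightarrow> g j x = b j"
    by metis
  obtain g' where g': "\<And>j. j < n \<Longrightarrow> module_hom s s' (g' j)"
    and gg': "\<And>j y. j < n \<Longrightarrow> g j y = g j 0 + g' j y"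
    using affine[OF g] by metis
  have g_line: "g j (x + s t v) = g j x + s' t (g' j v)" if "j < n" for j t
  proof -
    interpret g': module_hom s s' "g' j" by (rule g'[OF that])
    have "g j (x + s t v) = g j 0 + g' j (x + s t v)" "g j x = g j 0 + g' j x"
      by (rule gg'[OF that])+
    then show ?thesis by (simp only: g'.add g'.scale add.assoc)
  qed
  have npos: "0 < n" by (simp add: n_def)
  have g'0: "g' 0 v = w"
    using g_line[OF npos, of 1] g0[OF npos] \<psi>0(2) by (simp add: w_def)
  \<comment> \<open>a minor of size one larger than the dimension of \<open>I\<close>\<close>
  define f where "f = (\<lambda>y. det (mat n n (\<lambda>(i, j). l i (g j y))))"
  have "(\<lambda>y. l i (g j y)) \<in> poly_functions s" if "i < n" "j < n" for i j
  proof -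
    interpret l: module_hom s' "(*)" "l i" by (rule l[OF that(1)])
    have "(\<lambda>y. l i (g j 0) + (l i \<circ> g' j) y) \<in> poly_functions s"
      by (intro poly_functions.add[OF poly_functions.const] poly_functions.functional
          module_hom_compose[OF g' l] that)
    also have "(\<lambda>y. l i (g j 0) + (l i \<circ> g' j) y) = (\<lambda>y. l i (g j y))"
      by (subst gg'[OF that(2)]) (simp add: l.add)
    finally show ?thesis .
  qed
  then have f_poly: "f \<in> poly_functions s"
    unfolding f_def by (rule poly_functions_det)
  have f_vanishes: "f y = 0" if y: "y \<in> X" for y
  proof -
    obtain T where T: "module_hom s' s' T" and gT: "\<And>\<psi>. \<psi> \<in> \<Psi> \<Longrightarrow> \<exists>\<psi>'\<in>\<Psi>. \<psi> y = T (\<psi>' x)"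
      using rank[OF y] by blast
    have "\<exists>c. g j y = T (\<Sum>k\<in>{1..<n}. s' (c k) (e k))" if j: "j < n" for j
    proof -
      obtain \<psi>' where "\<psi>' \<in> \<Psi>" "g j y = T (\<psi>' x)" using gT[OF g[OF j]] by blast
      moreover have "e ` {1..<n} = B'" using e by (simp add: bij_betw_def)
      ultimately have "\<psi>' x \<in> C.span (e ` {1..<n})" using I by (auto simp: I_def)
      then show ?thesis
        using C.span_image_finite[of "{1..<n}" "\<psi>' x" e] \<open>g j y = T (\<psi>' x)\<close> by auto
    qed
    then obtain c where c: "\<And>j. j < n \<Longrightarrow> g j y = T (\<Sum>k\<in>{1..<n}. s' (c j k) (e k))"
      by metis
    \<comment> \<open>the values at \<open>y\<close> are combinations of \<open>n - 1\<close> vectors; row 0 of \<open>Q\<close> is padding\<close>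
    define P where "P = mat n n (\<lambda>(i, k). l i (T (e k)))"
    define Q where "Q = mat n n (\<lambda>(k, j). if k = 0 then 0 else c j k)"
    have "mat n n (\<lambda>(i, j). l i (g j y)) = P * Q"
    proof (rule eq_matI)
      fix i j assume "i < dim_row (P * Q)" "j < dim_col (P * Q)"
      then have ij: "i < n" "j < n" by (auto simp: P_def Q_def)
      interpret lT: module_hom s' "(*)" "l i \<circ> T" by (rule module_hom_compose[OF T l[OF ij(1)]])
      have "l i (g j y) = (\<Sum>k\<in>{1..<n}. c j k * l i (T (e k)))"
        using lT.sum[of "\<lambda>k. s' (c j k) (e k)" "{1..<n}"] lT.scale by (simp add: c[OF ij(2)])
      also have "\<dots> = (\<Sum>k\<in>{0..<n}. l i (T (e k)) * (if k = 0 then 0 else c j k))"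
        unfolding n by (subst sum.insert) (auto intro!: sum.cong)
      also have "\<dots> = (P * Q) $$ (i, j)"
        using ij by (simp add: P_def Q_def scalar_prod_def)
      finally show "mat n n (\<lambda>(i, j). l i (g j y)) $$ (i, j) = (P * Q) $$ (i, j)"
        using ij by simp
    qed (simp_all add: P_def Q_def)
    moreover have "det Q = 0"
      unfolding Q_def by (rule det_zero_row) (simp add: n_def)
    moreover have "P \<in> carrier_mat n n" "Q \<in> carrier_mat n n"
      by (simp_all add: P_def Q_def)
    ultimately show ?thesis
      unfolding f_def by (simp add: det_mult[of P n Q])
  qed
  \<comment> \<open>column 0 of the matrix at \<open>x + t v\<close> is \<open>t\<close> times a unit vector; \<open>q\<close> is the cofactor of \<open>t\<close>\<close>
  define q where "q = det (mat n n (\<lambda>(i, j).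
    if j = 0 then (if i = 0 then 1 else 0) else [:if i = j then 1 else 0, l i (g' j v):]))"
  have poly_q: "poly q t = det (mat n n (\<lambda>(i, j).
    if j = 0 then (if i = 0 then 1 else 0) else (if i = j then 1 else 0) + t * l i (g' j v)))" for t
  proof -
    interpret ev: comm_ring_hom "\<lambda>p. poly p t" by unfold_locales auto
    show ?thesis
      unfolding q_def ev.hom_det[symmetric]
      by (intro arg_cong[of _ _ det] eq_matI) (auto simp: one_pCons)
  qed
  have f_line: "f (x + s t v) = t * poly q t" for t
  proof -
    define L where "L = mat n n (\<lambda>(i, j).
      if j = 0 then (if i = 0 then 1 else 0) else (if i = j then 1 else 0) + t * l i (g' j v))"
    \<comment> \<open>multiplication by \<open>multrow_mat n 0 t\<close> on the right scales column 0 by \<open>t\<close>\<close>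
    have "mat n n (\<lambda>(i, j). l i (g j (x + s t v))) = L * multrow_mat n 0 t"
    proof (rule eq_matI)
      fix i j assume "i < dim_row (L * multrow_mat n 0 t)" "j < dim_col (L * multrow_mat n 0 t)"
      then have ij: "i < n" "j < n" by (auto simp: L_def)
      interpret l: module_hom s' "(*)" "l i" by (rule l[OF ij(1)])
      have "(L * multrow_mat n 0 t) $$ (i, j) = (\<Sum>k\<in>{0..<n}. L $$ (i, k) * multrow_mat n 0 t $$ (k, j))"
        using ij by (simp add: L_def scalar_prod_def)
      also have "\<dots> = (\<Sum>k\<in>{0..<n}. if k = j then L $$ (i, j) * (if j = 0 then t else 1) else 0)"
        using ij by (intro sum.cong) (auto simp: multrow_mat_def)
      also have "\<dots> = L $$ (i, j) * (if j = 0 then t else 1)"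
        using ij by simp
      also have "\<dots> = l i (g j (x + s t v))"
      proof (cases "j = 0")
        case True
        then show ?thesis
          using ij lb[OF ij] g_line[OF ij(2), of t] g0[OF ij(2)] \<psi>0(2) g'0
          by (simp add: L_def l.scale b0)
      next
        case False
        then show ?thesis
          using ij lb[OF ij] g_line[OF ij(2), of t] gb[OF ij(2)]
          by (simp add: L_def l.scale l.add)
      qed
      finally show "mat n n (\<lambda>(i, j). l i (g j (x + s t v))) $$ (i, j) = (L * multrow_mat n 0 t) $$ (i, j)"
        using ij by simp
    qed (simp_all add: L_def)
    moreover have "L \<in> carrier_mat n n" by (simp add: L_def)
    ultimately have "f (x + s t v) = det L * det (multrow_mat n 0 t)"
      unfolding f_def by (simp add: det_mult[of L n])
    then show ?thesis
      by (simp add: det_multrow_mat[OF npos] poly_q L_def)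
  qed
  have "\<forall>t. poly ([:0, 1:] * q) t = f (x + s t v)"
    by (simp add: f_line)
  then have "coeff ([:0, 1:] * q) 1 = 0"
    using v f_poly f_vanishes unfolding zariski_tangent_def by blast
  moreover have "coeff ([:0, 1:] * q) 1 = poly q 0"
    by (simp add: poly_0_coeff_0)
  moreover have "poly q 0 = 1"
  proof -
    have "mat n n (\<lambda>(i, j). if j = 0 then (if i = 0 then 1 else 0)
        else (if i = j then 1 else 0) + 0 * l i (g' j v)) = 1\<^sub>m n"
      by (intro eq_matI) auto
    then show ?thesis by (simp add: poly_q)
  qed
  ultimately show False by simp
qed

section \<open>Zariski tangent vectors: velocities of rational curves\<close>

text \<open>
  The equation says that \<open>g t = x + t v + O(t\<^sup>2)\<close> is rational in \<open>t\<close> with denominator \<open>d\<close>. For a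
  polynomial function \<open>f\<close> a power of \<open>d\<close> clears the denominators of \<open>f (g t)\<close>, and the resulting
  polynomial agrees modulo \<open>t\<^sup>2\<close> with this power times \<open>f (x + t v)\<close>. If \<open>f\<close> vanishes on the curve,
  the polynomial has infinitely many zeros, so \<open>f (x + t v)\<close> vanishes to second order.
\<close>

lemma zariski_tangent_rational_curve:
  fixes s :: "'f::field \<Rightarrow> 'a::ab_group_add \<Rightarrow> 'a"
  assumes inf: "infinite (UNIV :: 'f set)" and s: "vector_space s" and v: "v \<in> A"
    and d: "poly d 0 = 1"
    and g: "\<And>t. poly d t \<noteq> 0 \<Longrightarrow> g t \<in> X"
    and g_eq: "\<And>t. poly d t \<noteq> 0 \<Longrightarrow> s (poly d t) (g t) =
      s (poly d t) (x + s t v) + s (t\<^sup>2) (\<Sum>i<n. s (t ^ i) (r i))"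
  shows "v \<in> zariski_tangent s A X x"
proof -
  have key: "\<exists>k P p Q. (\<forall>t. poly p t = f (x + s t v)) \<and>
      (\<forall>t. poly d t \<noteq> 0 \<longrightarrow> poly P t = poly d t ^ k * f (g t)) \<and>
      P = d ^ k * p + monom 1 2 * Q" if "f \<in> poly_functions s" for f
    using that
  proof induction
    case (const c)
    show ?case
      by (intro exI[of _ 0] exI[of _ "[:c:]"] exI[of _ "0 :: 'f poly"]) auto
  next
    case (functional l)
    interpret l: module_hom s "(*)" l by (rule functional)
    define p where "p = [:l x, l v:]"
    define Q where "Q = (\<Sum>i<n. monom (l (r i)) i)"
    have "poly (d * p + monom 1 2 * Q) t = poly d t * l (g t)" if "poly d t \<noteq> 0" for t
    proof -
      have "poly d t * l (g t) = l (s (poly d t) (g t))"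
        by (simp add: l.scale)
      also have "\<dots> = poly d t * (l x + t * l v) + t\<^sup>2 * (\<Sum>i<n. t ^ i * l (r i))"
        unfolding g_eq[OF that] by (simp add: l.add l.scale l.sum)
      also have "(\<Sum>i<n. t ^ i * l (r i)) = poly Q t"
        by (simp add: Q_def poly_sum poly_monom mult.commute)
      also have "poly d t * (l x + t * l v) + t\<^sup>2 * poly Q t = poly (d * p + monom 1 2 * Q) t"
        unfolding p_def poly_add poly_mult poly_pCons poly_0 poly_monom by simp
      finally show ?thesis by (rule sym)
    qed
    moreover have "poly p t = l (x + s t v)" for t
      by (simp add: p_def l.add l.scale)
    ultimately show ?case
      by (intro exI[of _ 1] exI[of _ "d * p + monom 1 2 * Q"] exI[of _ p] exI[of _ Q]) auto
  next
    case (add f1 f2)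
    from add.IH(1) obtain k1 P1 p1 Q1 where 1: "\<forall>t. poly p1 t = f1 (x + s t v)"
      "\<forall>t. poly d t \<noteq> 0 \<longrightarrow> poly P1 t = poly d t ^ k1 * f1 (g t)"
      "P1 = d ^ k1 * p1 + monom 1 2 * Q1"
      by blast
    from add.IH(2) obtain k2 P2 p2 Q2 where 2: "\<forall>t. poly p2 t = f2 (x + s t v)"
      "\<forall>t. poly d t \<noteq> 0 \<longrightarrow> poly P2 t = poly d t ^ k2 * f2 (g t)"
      "P2 = d ^ k2 * p2 + monom 1 2 * Q2"
      by blast
    show ?case
    proof (intro exI conjI allI impI)
      show "d ^ k2 * P1 + d ^ k1 * P2 =
          d ^ (k1 + k2) * (p1 + p2) + monom 1 2 * (d ^ k2 * Q1 + d ^ k1 * Q2)"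
        unfolding 1(3) 2(3) power_add by (simp only: distrib_left distrib_right ac_simps)
      fix t
      show "poly (p1 + p2) t = f1 (x + s t v) + f2 (x + s t v)"
        using 1(1) 2(1) by simp
      assume t: "poly d t \<noteq> 0"
      show "poly (d ^ k2 * P1 + d ^ k1 * P2) t = poly d t ^ (k1 + k2) * (f1 (g t) + f2 (g t))"
        unfolding poly_add poly_mult poly_power 1(2)[rule_format, OF t] 2(2)[rule_format, OF t] power_add
        by (simp only: distrib_left ac_simps)
    qed
  next
    case (mult f1 f2)
    from mult.IH(1) obtain k1 P1 p1 Q1 where 1: "\<forall>t. poly p1 t = f1 (x + s t v)"
      "\<forall>t. poly d t \<noteq> 0 \<longrightarrow> poly P1 t = poly d t ^ k1 * f1 (g t)"
      "P1 = d ^ k1 * p1 + monom 1 2 * Q1"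
      by blast
    from mult.IH(2) obtain k2 P2 p2 Q2 where 2: "\<forall>t. poly p2 t = f2 (x + s t v)"
      "\<forall>t. poly d t \<noteq> 0 \<longrightarrow> poly P2 t = poly d t ^ k2 * f2 (g t)"
      "P2 = d ^ k2 * p2 + monom 1 2 * Q2"
      by blast
    show ?case
    proof (intro exI conjI allI impI)
      show "P1 * P2 =
          d ^ (k1 + k2) * (p1 * p2) + monom 1 2 * (d ^ k1 * p1 * Q2 + d ^ k2 * p2 * Q1 + monom 1 2 * Q1 * Q2)"
        unfolding 1(3) 2(3) power_add by (simp only: distrib_left distrib_right ac_simps)
      fix t
      show "poly (p1 * p2) t = f1 (x + s t v) * f2 (x + s t v)"
        using 1(1) 2(1) by simp
      assume t: "poly d t \<noteq> 0"
      show "poly (P1 * P2) t = poly d t ^ (k1 + k2) * (f1 (g t) * f2 (g t))"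
        unfolding poly_add poly_mult poly_power 1(2)[rule_format, OF t] 2(2)[rule_format, OF t] power_add
        by (simp only: distrib_left ac_simps)
    qed
  qed
  show ?thesis
    unfolding zariski_tangent_def
  proof (intro CollectI conjI v ballI allI impI)
    fix f p' assume f: "f \<in> poly_functions s" "\<forall>y\<in>X. f y = 0"
      and p': "\<forall>t. poly p' t = f (x + s t v)"
    obtain k P p Q where p: "\<forall>t. poly p t = f (x + s t v)"
      and P: "\<forall>t. poly d t \<noteq> 0 \<longrightarrow> poly P t = poly d t ^ k * f (g t)"
      and PQ: "P = d ^ k * p + monom 1 2 * Q"
      using key[OF f(1)] by blast
    have "d \<noteq> 0" using d by auto
    then have "P = 0"
      using poly_roots_finite P f(2) g by (intro poly_eqI_cofinite[OF inf, of "{t. poly d t = 0}"]) auto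
    then have c: "coeff (d ^ k * p) i = 0" if "i < 2" for i
      using that arg_cong[OF PQ, of "\<lambda>P. coeff P i"] by (simp add: coeff_monom_mult)
    have d0: "coeff (d ^ k) 0 = 1"
      using d by (simp add: poly_0_coeff_0[symmetric])
    have "coeff p 0 = 0"
      using c[of 0] d0 by (simp add: coeff_mult)
    then have "coeff p 1 = 0"
      using c[of 1] d0 by (simp add: coeff_mult)
    moreover have "p' = p"
      using p p' by (intro poly_eqI_cofinite[OF inf, of "{}"]) auto
    ultimately show "coeff p' 1 = 0" by simp
  qed
qed

section \<open>Extensions of DG modules and their Yoneda equivalence\<close>

text \<open>
  The equations on \<open>v\<close> for which the twisted differential and action on the direct sum below satisfy
  the DG module axioms.
\<close>

definition cocycles ::
  "('r::comm_ring_1, 'u::ab_group_add) dg_alg \<Rightarrow> ('r, 'u, 'm::ab_group_add) dg_mod \<Rightarrow>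
    ('r, 'u, 'n::ab_group_add) dg_mod \<Rightarrow> (('m \<Rightarrow> 'n) \<times> ('u \<Rightarrow> 'm \<Rightarrow> 'n)) set" where
  "cocycles U M N = {v.
     fst v \<in> Hom_deg (- 1) M N \<and> snd v \<in> Bil_deg0 U M N \<and>
     (\<forall>x. mdif N (fst v x) + fst v (mdif M x) = 0) \<and>
     (\<forall>i. \<forall>a \<in> gr U i. \<forall>x. mdif N (snd v a x) + fst v (act M a x) =
        snd v (dif U a) x + ksign i (snd v a (mdif M x) + act N a (fst v x))) \<and>
     (\<forall>a b x. snd v (mul U a b) x = act N a (snd v b x) + snd v a (act M b x)) \<and>
     (\<forall>x. snd v (unit U) x = 0)}"

definition coboundary ::
  "('r, 'u, 'm) dg_mod \<Rightarrow> ('r, 'u, 'n::ab_group_add) dg_mod \<Rightarrow> ('m \<Rightarrow> 'n) \<Rightarrow> ('m \<Rightarrow> 'n) \<times> ('u \<Rightarrow> 'm \<Rightarrow> 'n)"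
  where
  "coboundary M N \<theta> =
     (\<lambda>x. \<theta> (mdif M x) - mdif N (\<theta> x), \<lambda>a x. \<theta> (act M a x) - act N a (\<theta> x))"

definition twisted_sum ::
  "('r, 'u, 'm) dg_mod \<Rightarrow> ('r, 'u, 'n::ab_group_add) dg_mod \<Rightarrow>
    ('m \<Rightarrow> 'n) \<times> ('u \<Rightarrow> 'm \<Rightarrow> 'n) \<Rightarrow> ('r, 'u, 'n \<times> 'm) dg_mod" where
  "twisted_sum M N v =
     \<lparr>scl = (\<lambda>r (n, m). (scl N r n, scl M r m)), gr = (\<lambda>i. gr N i \<times> gr M i),
      mdif = (\<lambda>(n, m). (mdif N n + fst v m, mdif M m)),
      act = (\<lambda>a (n, m). (act N a n + snd v a m, act M a m))\<rparr>"

definition twisted_ext ::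
  "('r, 'u, 'm::zero) dg_mod \<Rightarrow> ('r, 'u, 'n::ab_group_add) dg_mod \<Rightarrow>
    ('m \<Rightarrow> 'n) \<times> ('u \<Rightarrow> 'm \<Rightarrow> 'n) \<Rightarrow> ('r, 'u, 'm, 'n, 'n \<times> 'm) ses" where
  "twisted_ext M N v = (twisted_sum M N v, \<lambda>n. (n, 0), snd)"

definition ext_class ::
  "('f::field, 'u::ab_group_add) dg_alg \<Rightarrow> ('f, 'u, 'm::ab_group_add) dg_mod \<Rightarrow>
    ('f, 'u, 'n::ab_group_add) dg_mod \<Rightarrow> ('m \<Rightarrow> 'n) \<times> ('u \<Rightarrow> 'm \<Rightarrow> 'n) \<Rightarrow>
    ('f, 'u, 'm, 'n, 'n \<times> 'm) ses set" where
  "ext_class U M N v = {E. extension U M N E \<and> yoneda_equiv (twisted_ext M N v) E}"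

lemma ksign_add: "ksign i (x + y) = ksign i x + ksign i y"
  and ksign_diff: "ksign i (x - y) = ksign i x - ksign i y"
  by (simp_all add: ksign_def)

lemma module_hom_ksign: "module_hom s s' f \<Longrightarrow> f (ksign i x) = ksign i (f x)"
  by (simp add: ksign_def module_hom.neg)

lemma dg_moduleD:
  assumes "dg_module U M"
  shows "graded_module M" "Modules.module (scl M)" "module_hom (scl M) (scl M) (mdif M)"
    "module_hom (scl M) (scl M) (act M a)" "module_hom (scl U) (scl M) (\<lambda>a. act M a x)"
    "mdif M (mdif M x) = 0" "act M (mul U a b) x = act M a (act M b x)" "act M (unit U) x = x"
    "x \<in> gr M i \<Longrightarrow> mdif M x \<in> gr M (i - 1)"
    "a \<in> gr U i \<Longrightarrow> x \<in> gr M j \<Longrightarrow> act M a x \<in> gr M (i + j)"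
    "a \<in> gr U i \<Longrightarrow> mdif M (act M a x) = act M (dif U a) x + ksign i (act M a (mdif M x))"
  using assms by (auto simp: dg_module_def graded_module_def Hom_deg_def Bil_deg0_def)

lemma dg_homD:
  assumes "f \<in> dg_hom M N"
  shows "f \<in> Hom_deg 0 M N" "module_hom (scl M) (scl N) f" "x \<in> gr M i \<Longrightarrow> f x \<in> gr N i"
    "f (mdif M x) = mdif N (f x)" "f (act M a x) = act N a (f x)"
  using assms by (auto simp: dg_hom_def Hom_deg_def)

lemma cocyclesD:
  assumes "v \<in> cocycles U M N"
  shows "module_hom (scl M) (scl N) (fst v)" "module_hom (scl M) (scl N) (snd v a)"
    "module_hom (scl U) (scl N) (\<lambda>a. snd v a x)"
    "x \<in> gr M i \<Longrightarrow> fst v x \<in> gr N (i - 1)"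
    "a \<in> gr U i \<Longrightarrow> x \<in> gr M j \<Longrightarrow> snd v a x \<in> gr N (i + j)"
    "mdif N (fst v x) + fst v (mdif M x) = 0"
    "a \<in> gr U i \<Longrightarrow> mdif N (snd v a x) + fst v (act M a x) =
        snd v (dif U a) x + ksign i (snd v a (mdif M x) + act N a (fst v x))"
    "snd v (mul U a b) x = act N a (snd v b x) + snd v a (act M b x)"
    "snd v (unit U) x = 0"
  using assms by (auto simp: cocycles_def Hom_deg_def Bil_deg0_def)

lemma dg_hom_compose:
  assumes "f \<in> dg_hom A B" "g \<in> dg_hom B C"
  shows "g \<circ> f \<in> dg_hom A C"
  using assms by (auto simp: dg_hom_def Hom_deg_def intro: module_hom_compose)

lemma dg_hom_id: "Modules.module (scl M) \<Longrightarrow> id \<in> dg_hom M M"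
  by (auto simp: dg_hom_def Hom_deg_def module_hom_iff)

lemma dg_hom_inverse:
  assumes A: "dg_module U A" and B: "dg_module U B" and f: "f \<in> dg_hom A B" "bij f"
  shows "inv_into UNIV f \<in> dg_hom B A"
proof -
  have ff: "f (inv_into UNIV f x) = x" for x
    using f(2) by (simp add: bij_is_surj surj_f_inv_f)
  have inj: "f x = f y \<Longrightarrow> x = y" for x y using f(2) by (simp add: bij_is_inj inj_eq)
  have "inv_into UNIV f (mdif B x) = mdif A (inv_into UNIV f x)" for x
    by (rule inj) (simp add: ff dg_homD(4)[OF f(1)])
  moreover have "inv_into UNIV f (act B a x) = act A a (inv_into UNIV f x)" for a x
    by (rule inj) (simp add: ff dg_homD(5)[OF f(1)])
  ultimately show ?thesis
    using Hom_deg_0_inverse[OF dg_moduleD(1)[OF A] dg_moduleD(1)[OF B] dg_homD(1)[OF f(1)] f(2)]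
    by (simp add: dg_hom_def)
qed

lemma extensionD:
  assumes "extension U M N (X, f, g)"
  shows "dg_module U X" "f \<in> dg_hom N X" "g \<in> dg_hom X M" "inj f" "surj g"
    "g x = 0 \<Longrightarrow> \<exists>n. x = f n" "g (f n) = 0"
  using assms by (auto simp: extension_def)

text \<open>
  The short five lemma.
\<close>

lemma morphism_of_extensions_bij:
  assumes E: "extension U M N (X, f, g)" and E': "extension U M N (X', f', g')"
    and h: "module_hom (scl X) (scl X') h" "\<And>n. h (f n) = f' n" "\<And>x. g' (h x) = g x"
  shows "bij h"
proof (rule bijI)
  interpret h: module_hom "scl X" "scl X'" h by (rule h)
  interpret f': module_hom "scl N" "scl X'" f' using extensionD(2)[OF E'] by (rule dg_homD)
  interpret g: module_hom "scl X" "scl M" g using extensionD(3)[OF E] by (rule dg_homD)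
  interpret g': module_hom "scl X'" "scl M" g' using extensionD(3)[OF E'] by (rule dg_homD)
  show "inj h"
    unfolding h.inj_iff_eq_0
  proof (intro allI impI)
    fix x assume "h x = 0"
    then have "g x = 0" using h(3)[of x] by (simp add: g'.zero)
    then obtain n where n: "x = f n" using extensionD(6)[OF E] by blast
    then have "f' n = f' 0" using h(2)[of n] \<open>h x = 0\<close> by (simp add: f'.zero)
    then have "n = 0" by (rule injD[OF extensionD(4)[OF E']])
    then show "x = 0"
      using n dg_homD(2)[OF extensionD(2)[OF E]] by (simp add: module_hom.zero)
  qed
  show "surj h"
    unfolding surj_def
  proof
    fix y
    obtain x where x: "g x = g' y" using extensionD(5)[OF E] by (metis surjD)
    then have "g' (y - h x) = 0" by (simp add: g'.diff h(3))
    then obtain n where "y - h x = f' n" using extensionD(6)[OF E'] by blast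
    then have "y = h (x + f n)" by (simp add: h.add h(2) algebra_simps)
    then show "\<exists>x. y = h x" by blast
  qed
qed

lemma yoneda_equivI:
  assumes "extension U M N (X, f, g)" and "extension U M N (X', f', g')"
    and "h \<in> dg_hom X X'" "\<And>n. h (f n) = f' n" "\<And>x. g' (h x) = g x"
  shows "yoneda_equiv (X, f, g) (X', f', g')"
  using assms morphism_of_extensions_bij[OF assms(1,2) dg_homD(2)[OF assms(3)] assms(4,5)]
  by (auto simp: yoneda_equiv_def fun_eq_iff)

lemma yoneda_equivE:
  assumes "yoneda_equiv (X, f, g) (X', f', g')"
  obtains h where "h \<in> dg_hom X X'" "bij h" "\<And>n. h (f n) = f' n" "\<And>x. g' (h x) = g x"
  using assms by (auto simp: yoneda_equiv_def fun_eq_iff)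

lemma yoneda_equiv_refl:
  assumes "extension U M N E"
  shows "yoneda_equiv E E"
proof (cases E)
  case (fields X f g)
  show ?thesis
    unfolding fields
  proof (rule yoneda_equivI)
    show E: "extension U M N (X, f, g)" "extension U M N (X, f, g)"
      using assms by (simp_all add: fields)
    show "id \<in> dg_hom X X"
      by (rule dg_hom_id[OF dg_moduleD(2)[OF extensionD(1)[OF E(1)]]])
  qed simp_all
qed

lemma yoneda_equiv_sym:
  assumes "extension U M N E" "extension U M N E'" "yoneda_equiv E E'"
  shows "yoneda_equiv E' E"
proof (cases E; cases E')
  fix X f g X' f' g' assume E: "E = (X, f, g)" "E' = (X', f', g')"
  obtain h where h: "h \<in> dg_hom X X'" "bij h" "\<And>n. h (f n) = f' n" "\<And>x. g' (h x) = g x"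
    using assms(3) unfolding E by (rule yoneda_equivE) (rule that)
  have h_inv: "h (inv_into UNIV h x) = x" "inv_into UNIV h (h y) = y" for x y
    using h(2) by (simp_all add: bij_is_surj surj_f_inv_f bij_is_inj)
  show ?thesis
    unfolding E
  proof (rule yoneda_equivI)
    show "extension U M N (X', f', g')" "extension U M N (X, f, g)"
      using assms E by simp_all
    then show "inv_into UNIV h \<in> dg_hom X' X"
      using h by (intro dg_hom_inverse) (auto dest: extensionD(1))
    show "inv_into UNIV h (f' n) = f n" for n by (simp add: h_inv flip: h(3))
    show "g (inv_into UNIV h x) = g' x" for x by (simp add: h_inv flip: h(4))
  qed
qed

lemma yoneda_equiv_trans:
  assumes "yoneda_equiv E E'" "yoneda_equiv E' E''"
  shows "yoneda_equiv E E''"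
proof (cases E; cases E'; cases E'')
  fix X f g X' f' g' X'' f'' g''
  assume E: "E = (X, f, g)" "E' = (X', f', g')" "E'' = (X'', f'', g'')"
  obtain h h' where "h \<in> dg_hom X X'" "bij h" "\<And>n. h (f n) = f' n" "\<And>x. g' (h x) = g x"
    "h' \<in> dg_hom X' X''" "bij h'" "\<And>n. h' (f' n) = f'' n" "\<And>x. g'' (h' x) = g' x"
    using assms unfolding E by (metis yoneda_equivE)
  then show ?thesis
    using dg_hom_compose[of h X X' h' X''] bij_comp[of h h']
    by (auto simp: E yoneda_equiv_def fun_eq_iff intro!: bexI[of _ "h' \<circ> h"])
qed

lemma yoneda_equiv_relation:
  "equiv {E. extension U M N E}
     {(E, E'). extension U M N E \<and> extension U M N E' \<and> yoneda_equiv E E'}"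
  unfolding equiv_def refl_on_def sym_def trans_def
  by (auto intro: yoneda_equiv_refl yoneda_equiv_sym yoneda_equiv_trans)

section \<open>Twisted direct sums represent all extensions\<close>

locale dg_module_pair =
  fixes U :: "('f::field, 'u::ab_group_add) dg_alg" and M :: "('f, 'u, 'm::ab_group_add) dg_mod"
    and N :: "('f, 'u, 'n::ab_group_add) dg_mod"
  assumes M: "dg_module U M" and N: "dg_module U N"
begin

sublocale dM: module_hom "scl M" "scl M" "mdif M" by (rule dg_moduleD[OF M])
sublocale dN: module_hom "scl N" "scl N" "mdif N" by (rule dg_moduleD[OF N])
sublocale aM: module_hom "scl M" "scl M" "act M a" for a by (rule dg_moduleD[OF M])
sublocale aN: module_hom "scl N" "scl N" "act N a" for a by (rule dg_moduleD[OF N])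
sublocale aM': module_hom "scl U" "scl M" "\<lambda>a. act M a x" for x by (rule dg_moduleD[OF M])
sublocale aN': module_hom "scl U" "scl N" "\<lambda>a. act N a x" for x by (rule dg_moduleD[OF N])

lemmas gM = dg_moduleD(1)[OF M]
lemmas gN = dg_moduleD(1)[OF N]

lemma twisted_sum_module: "Modules.module (scl (twisted_sum M N v))"
  by unfold_locales
    (auto simp: twisted_sum_def dM.m1.scale_right_distrib dM.m1.scale_left_distrib
      dN.m1.scale_right_distrib dN.m1.scale_left_distrib)

lemma twisted_sum_graded: "graded_module (twisted_sum M N v)"
  unfolding graded_module_def
proof (intro conjI allI)
  show "Modules.module (scl (twisted_sum M N v))" by (rule twisted_sum_module)
  show "module.subspace (scl (twisted_sum M N v)) (gr (twisted_sum M N v) i)" for i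
    unfolding module.subspace_def[OF twisted_sum_module]
    using gr_closed[OF gM] gr_closed[OF gN] by (auto simp: twisted_sum_def zero_prod_def)
  show "\<exists>!c. (\<forall>i. c i \<in> gr (twisted_sum M N v) i) \<and> finite {i. c i \<noteq> 0} \<and> p = (\<Sum>i | c i \<noteq> 0. c i)" for p
    using graded_decomposition_Times[OF gN gM, of p] by (simp add: twisted_sum_def)
qed

lemma twisted_sum_dg_module:
  assumes v: "v \<in> cocycles U M N"
  shows "dg_module U (twisted_sum M N v)"
proof -
  note D = cocyclesD[OF v]
  interpret v1: module_hom "scl M" "scl N" "fst v" by (rule D)
  interpret v2: module_hom "scl M" "scl N" "snd v a" for a by (rule D)
  interpret v2': module_hom "scl U" "scl N" "\<lambda>a. snd v a x" for x by (rule D)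
  let ?T = "twisted_sum M N v"
  show ?thesis
    unfolding dg_module_def
  proof (intro conjI allI ballI)
    show "graded_module ?T" by (rule twisted_sum_graded)
    have "module_hom (scl ?T) (scl ?T) (mdif ?T)"
      unfolding module_hom_iff using twisted_sum_module
      by (auto simp: twisted_sum_def dM.add dM.scale dN.add dN.scale v1.add v1.scale dN.m1.scale_right_distrib)
    then show "mdif ?T \<in> Hom_deg (- 1) ?T ?T"
      using D(4) dg_moduleD(9)[OF M] dg_moduleD(9)[OF N] gr_closed(2)[OF gN]
      by (auto simp: Hom_deg_def twisted_sum_def)
    show "mdif ?T (mdif ?T p) = 0" for p
      using D(6)
      by (cases p) (simp add: twisted_sum_def zero_prod_def dN.add dg_moduleD(6)[OF M] dg_moduleD(6)[OF N])
    have "module_hom (scl ?T) (scl ?T) (act ?T a)" for a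
      unfolding module_hom_iff using twisted_sum_module
      by (auto simp: twisted_sum_def aM.add aM.scale aN.add aN.scale v2.add v2.scale dN.m1.scale_right_distrib)
    moreover have "module_hom (scl U) (scl ?T) (\<lambda>a. act ?T a p)" for p
      unfolding module_hom_iff using twisted_sum_module aM'.m1.module_axioms
      by (cases p) (auto simp: twisted_sum_def aM'.add aM'.scale aN'.add aN'.scale v2'.add v2'.scale
        dN.m1.scale_right_distrib)
    ultimately show "act ?T \<in> Bil_deg0 U ?T ?T"
      using D(5) dg_moduleD(10)[OF M] dg_moduleD(10)[OF N] gr_closed(2)[OF gN]
      by (auto simp: Bil_deg0_def twisted_sum_def)
    show "mdif ?T (act ?T a p) = act ?T (dif U a) p + ksign i (act ?T a (mdif ?T p))"
      if a: "a \<in> gr U i" for i a p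
    proof (cases p)
      case (Pair n m)
      show ?thesis
        using D(7)[OF a, of m] dg_moduleD(11)[OF M a, of m] dg_moduleD(11)[OF N a, of n]
        by (cases "even i") (auto simp: Pair twisted_sum_def ksign_def dN.add aN.add algebra_simps)
    qed
    show "act ?T (mul U a b) p = act ?T a (act ?T b p)" for a b p
      by (cases p) (simp add: twisted_sum_def D(8) dg_moduleD(7)[OF M] dg_moduleD(7)[OF N] aN.add algebra_simps)
    show "act ?T (unit U) p = p" for p
      by (cases p) (simp add: twisted_sum_def D(9) dg_moduleD(8)[OF M] dg_moduleD(8)[OF N])
  qed
qed

lemma twisted_ext_extension:
  assumes v: "v \<in> cocycles U M N"
  shows "extension U M N (twisted_ext M N v)"
proof -
  interpret v1: module_hom "scl M" "scl N" "fst v" by (rule cocyclesD[OF v])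
  interpret v2: module_hom "scl M" "scl N" "snd v a" for a by (rule cocyclesD[OF v])
  have "(\<lambda>n. (n, 0)) \<in> dg_hom N (twisted_sum M N v)"
    using gr_closed(1)[OF gM]
    by (auto simp: dg_hom_def Hom_deg_def module_hom_iff twisted_sum_module dN.m1.module_axioms)
      (auto simp: twisted_sum_def dM.zero aM.zero v1.zero v2.zero)
  moreover have "snd \<in> dg_hom (twisted_sum M N v) M"
    by (auto simp: dg_hom_def Hom_deg_def module_hom_iff twisted_sum_module dM.m1.module_axioms)
      (auto simp: twisted_sum_def)
  moreover have "inj (\<lambda>n :: 'n. (n, 0 :: 'm))" "surj (snd :: 'n \<times> 'm \<Rightarrow> 'm)"
    by (auto simp: inj_def)
  moreover have "range (\<lambda>n :: 'n. (n, 0 :: 'm)) = {x. snd x = 0}"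
    by auto
  ultimately show ?thesis
    using twisted_sum_dg_module[OF v] by (simp add: extension_def twisted_ext_def)
qed
text \<open>
  A section \<open>\<sigma>\<close> of \<open>g\<close> of degree 0 identifies the middle term with \<open>N \<times> M\<close> as a graded space. In
  these coordinates the differential and the action differ from those of the direct sum by the
  failure of \<open>\<sigma>\<close> to commute with them, which has values in \<open>N\<close> and is the required cocycle.
\<close>

lemma extension_equiv_twisted:
  assumes E: "extension U M N (X, f, g)"
  shows "\<exists>v \<in> cocycles U M N. yoneda_equiv (twisted_ext M N v) (X, f, g)"
proof -
  note X = extensionD(1)[OF E]
  note f = dg_homD[OF extensionD(2)[OF E]] and g = dg_homD[OF extensionD(3)[OF E]]
  note gX = dg_moduleD(1)[OF X]
  interpret dX: module_hom "scl X" "scl X" "mdif X" by (rule dg_moduleD[OF X])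
  interpret aX: module_hom "scl X" "scl X" "act X a" for a by (rule dg_moduleD[OF X])
  interpret aX': module_hom "scl U" "scl X" "\<lambda>a. act X a x" for x by (rule dg_moduleD[OF X])
  interpret f: module_hom "scl N" "scl X" f by (rule f)
  interpret g: module_hom "scl X" "scl M" g by (rule g)
  have inj: "x = y" if "f x = f y" for x y
    by (rule injD[OF extensionD(4)[OF E] that])
  obtain \<sigma> where \<sigma>: "\<sigma> \<in> Hom_deg 0 M X" and g\<sigma>: "\<And>x. g (\<sigma> x) = x"
    using graded_section[OF gX gM g(1) extensionD(5)[OF E]] by blast
  interpret \<sigma>: module_hom "scl M" "scl X" \<sigma> using \<sigma> by (simp add: Hom_deg_def)
  have \<sigma>_gr: "\<sigma> x \<in> gr X i" if "x \<in> gr M i" for x i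
    using \<sigma> that by (auto simp: Hom_deg_def)
  define k where "k = inv_into UNIV f"
  have fk: "f (k x) = x" if "g x = 0" for x
    using extensionD(6)[OF E that] by (auto simp: k_def f_inv_into_f)
  define v where "v = (\<lambda>x. k (mdif X (\<sigma> x) - \<sigma> (mdif M x)), \<lambda>a x. k (act X a (\<sigma> x) - \<sigma> (act M a x)))"
  have f1: "f (fst v x) = mdif X (\<sigma> x) - \<sigma> (mdif M x)" for x
    by (simp add: v_def fk g.diff g g\<sigma>)
  have f2: "f (snd v a x) = act X a (\<sigma> x) - \<sigma> (act M a x)" for a x
    by (simp add: v_def fk g.diff g g\<sigma>)
  have fN: "f (mdif N n) = mdif X (f n)" "f (act N a n) = act X a (f n)" for a n
    by (rule f)+
  have f_gr: "n \<in> gr N i" if "f n \<in> gr X i" for n i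
    by (rule inj_hom_reflects_degree[OF gN gX f(1) extensionD(4)[OF E] that])
  have v: "v \<in> cocycles U M N"
    unfolding cocycles_def
  proof (intro CollectI conjI allI ballI)
    have "module_hom (scl M) (scl N) (fst v)"
      unfolding module_hom_iff using dM.m1.module_axioms dN.m1.module_axioms
      by (auto intro!: inj simp: f1 f.add f.scale dX.add \<sigma>.add dM.add dX.scale \<sigma>.scale dM.scale
          dX.m1.scale_right_diff_distrib)
    moreover have "fst v x \<in> gr N (i - 1)" if "x \<in> gr M i" for x i
      using that by (intro f_gr) (auto simp: f1 intro!: gr_closed(3)[OF gX] \<sigma>_gr dg_moduleD(9)[OF X] dg_moduleD(9)[OF M])
    ultimately show "fst v \<in> Hom_deg (- 1) M N"
      by (simp add: Hom_deg_def)
    have "module_hom (scl M) (scl N) (snd v a)" for a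
      unfolding module_hom_iff using dM.m1.module_axioms dN.m1.module_axioms
      by (auto intro!: inj simp: f2 f.add f.scale aX.add \<sigma>.add aM.add aX.scale \<sigma>.scale aM.scale
          dX.m1.scale_right_diff_distrib)
    moreover have "module_hom (scl U) (scl N) (\<lambda>a. snd v a x)" for x
      unfolding module_hom_iff using aM'.m1.module_axioms dN.m1.module_axioms
      by (auto intro!: inj simp: f2 f.add f.scale aX'.add \<sigma>.add aM'.add aX'.scale \<sigma>.scale aM'.scale
          dX.m1.scale_right_diff_distrib)
    moreover have "snd v a x \<in> gr N (i + j)" if "a \<in> gr U i" "x \<in> gr M j" for a x i j
      using that
      by (intro f_gr) (auto simp: f2 intro!: gr_closed(3)[OF gX] \<sigma>_gr dg_moduleD(10)[OF X] dg_moduleD(10)[OF M])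
    ultimately show "snd v \<in> Bil_deg0 U M N"
      by (simp add: Bil_deg0_def)
    show "mdif N (fst v x) + fst v (mdif M x) = 0" for x
      by (rule inj) (simp add: f.add f.zero fN f1 dX.diff dg_moduleD(6)[OF X] dg_moduleD(6)[OF M] \<sigma>.zero)
    show "mdif N (snd v a x) + fst v (act M a x) =
        snd v (dif U a) x + ksign i (snd v a (mdif M x) + act N a (fst v x))"
      if a: "a \<in> gr U i" for i a x
      by (rule inj)
        (simp add: f.add fN f1 f2 dX.diff aX.diff module_hom_ksign[OF f(2)] ksign_add ksign_diff
          dg_moduleD(11)[OF X a] dg_moduleD(11)[OF M a] \<sigma>.add module_hom_ksign[OF \<sigma>.module_hom_axioms]
          algebra_simps)
    show "snd v (mul U a b) x = act N a (snd v b x) + snd v a (act M b x)" for a b x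
      by (rule inj) (simp add: f.add fN f2 aX.diff dg_moduleD(7)[OF X] dg_moduleD(7)[OF M])
    show "snd v (unit U) x = 0" for x
      by (rule inj) (simp add: f.zero f2 dg_moduleD(8)[OF X] dg_moduleD(8)[OF M])
  qed
  let ?h = "\<lambda>(n, m). f n + \<sigma> m"
  have "?h \<in> dg_hom (twisted_sum M N v) X"
    unfolding dg_hom_def Hom_deg_def
  proof (intro CollectI conjI allI ballI)
    show "module_hom (scl (twisted_sum M N v)) (scl X) ?h"
      unfolding module_hom_iff using twisted_sum_module dX.m1.module_axioms
      by (auto simp: twisted_sum_def f.add f.scale \<sigma>.add \<sigma>.scale dX.m1.scale_right_distrib)
    show "?h x \<in> gr X (i + 0)" if "x \<in> gr (twisted_sum M N v) i" for i x
      using that f(3) \<sigma>_gr gr_closed(2)[OF gX] by (auto simp: twisted_sum_def)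
    show "?h (mdif (twisted_sum M N v) x) = mdif X (?h x)" for x
      by (cases x) (simp add: twisted_sum_def f.add fN f1 dX.add)
    show "?h (act (twisted_sum M N v) a x) = act X a (?h x)" for a x
      by (cases x) (simp add: twisted_sum_def f.add fN f2 aX.add)
  qed
  then have "yoneda_equiv (twisted_ext M N v) (X, f, g)"
    using twisted_ext_extension[OF v] E unfolding twisted_ext_def
    by (intro yoneda_equivI) (auto simp: \<sigma>.zero g.add g\<sigma> extensionD(7)[OF E])
  with v show ?thesis by blast
qed

end

section \<open>Baer sums\<close>

text \<open>
  The properties of the quotient map that are enough to recover the sum up to equivalence.
\<close>

lemma baer_sumE:
  assumes "baer_sum (X1, f1, g1) (X2, f2, g2) (X, f, g)"
  obtains q where
    "\<And>x1 x2 y1 y2. g1 x1 = g2 x2 \<Longrightarrow> g1 y1 = g2 y2 \<Longrightarrow> q (x1 + y1, x2 + y2) = q (x1, x2) + q (y1, y2)"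
    "\<And>r x1 x2. g1 x1 = g2 x2 \<Longrightarrow> q (scl X1 r x1, scl X2 r x2) = scl X r (q (x1, x2))"
    "\<And>i x1 x2. g1 x1 = g2 x2 \<Longrightarrow> x1 \<in> gr X1 i \<Longrightarrow> x2 \<in> gr X2 i \<Longrightarrow> q (x1, x2) \<in> gr X i"
    "\<And>x1 x2. g1 x1 = g2 x2 \<Longrightarrow> q (mdif X1 x1, mdif X2 x2) = mdif X (q (x1, x2))"
    "\<And>a x1 x2. g1 x1 = g2 x2 \<Longrightarrow> q (act X1 a x1, act X2 a x2) = act X a (q (x1, x2))"
    "\<And>n. q (f1 n, - f2 n) = 0" "\<And>n. q (f1 n, 0) = f n"
    "\<And>x1 x2. g1 x1 = g2 x2 \<Longrightarrow> g (q (x1, x2)) = g1 x1"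
proof -
  define P where "P = {(x1, x2). g1 x1 = g2 x2}"
  have P: "(x1, x2) \<in> P \<longleftrightarrow> g1 x1 = g2 x2" for x1 x2 by (simp add: P_def)
  obtain q where
    1: "\<forall>(x1, x2) \<in> P. \<forall>(y1, y2) \<in> P. q (x1 + y1, x2 + y2) = q (x1, x2) + q (y1, y2)" and
    2: "\<forall>r. \<forall>(x1, x2) \<in> P. q (scl X1 r x1, scl X2 r x2) = scl X r (q (x1, x2))" and
    3: "\<forall>i. \<forall>(x1, x2) \<in> P. x1 \<in> gr X1 i \<and> x2 \<in> gr X2 i \<longrightarrow> q (x1, x2) \<in> gr X i" and
    4: "\<forall>(x1, x2) \<in> P. q (mdif X1 x1, mdif X2 x2) = mdif X (q (x1, x2))" and
    5: "\<forall>a. \<forall>(x1, x2) \<in> P. q (act X1 a x1, act X2 a x2) = act X a (q (x1, x2))" and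
    6: "{p \<in> P. q p = 0} = range (\<lambda>n. (f1 n, - f2 n))" and
    7: "\<forall>n. f n = q (f1 n, 0)" and
    8: "\<forall>(x1, x2) \<in> P. g (q (x1, x2)) = g1 x1"
    using assms unfolding baer_sum_def Let_def prod.case P_def[symmetric]
    by (elim exE conjE) (rule that)
  have 6: "q (f1 n, - f2 n) = 0" for n
    using 6 by blast
  show thesis
  proof (rule that[of q])
    show "g1 x1 = g2 x2 \<Longrightarrow> g1 y1 = g2 y2 \<Longrightarrow> q (x1 + y1, x2 + y2) = q (x1, x2) + q (y1, y2)"
      for x1 x2 y1 y2 using 1 unfolding P[symmetric] by blast
    show "g1 x1 = g2 x2 \<Longrightarrow> q (scl X1 r x1, scl X2 r x2) = scl X r (q (x1, x2))" for r x1 x2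
      using 2 unfolding P[symmetric] by blast
    show "g1 x1 = g2 x2 \<Longrightarrow> x1 \<in> gr X1 i \<Longrightarrow> x2 \<in> gr X2 i \<Longrightarrow> q (x1, x2) \<in> gr X i" for i x1 x2
      using 3 unfolding P[symmetric] by blast
    show "g1 x1 = g2 x2 \<Longrightarrow> q (mdif X1 x1, mdif X2 x2) = mdif X (q (x1, x2))" for x1 x2
      using 4 unfolding P[symmetric] by blast
    show "g1 x1 = g2 x2 \<Longrightarrow> q (act X1 a x1, act X2 a x2) = act X a (q (x1, x2))" for a x1 x2
      using 5 unfolding P[symmetric] by blast
    show "q (f1 n, - f2 n) = 0" "q (f1 n, 0) = f n" for n
      using 6 7 by simp_all
    show "g1 x1 = g2 x2 \<Longrightarrow> g (q (x1, x2)) = g1 x1" for x1 x2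
      using 8 unfolding P[symmetric] by blast
  qed
qed

context dg_module_pair
begin

text \<open>
  On the fibre product of two twisted sums, addition of the \<open>N\<close>-components exhibits the twisted sum
  of \<open>v + w\<close> as the quotient that defines the Baer sum.
\<close>

lemma baer_sum_twisted_ext:
  assumes v: "v \<in> cocycles U M N" and w: "w \<in> cocycles U M N"
    and h: "h \<in> dg_hom (twisted_sum M N (v + w)) X" "bij h"
      "\<And>n. h (n, 0) = f n" "\<And>x. g (h x) = snd x"
  shows "baer_sum (twisted_ext M N v) (twisted_ext M N w) (X, f, g)"
proof -
  interpret h: module_hom "scl (twisted_sum M N (v + w))" "scl X" h by (rule dg_homD[OF h(1)])
  have h_act: "mdif X (h (n, m)) = h (mdif N n + (fst v m + fst w m), mdif M m)"
    "act X a (h (n, m)) = h (act N a n + (snd v a m + snd w a m), act M a m)" for a n m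
    using dg_homD(4)[OF h(1), of "(n, m)"] dg_homD(5)[OF h(1), of a "(n, m)"]
    by (simp_all add: twisted_sum_def)
  have h_scl: "scl X r (h (n, m)) = h (scl N r n, scl M r m)" for r n m
    using h.scale[of r "(n, m)"] by (simp add: twisted_sum_def)
  have h_gr: "h (n, m) \<in> gr X i" if "n \<in> gr N i" "m \<in> gr M i" for n m i
    using dg_homD(3)[OF h(1), of "(n, m)" i] that by (simp add: twisted_sum_def)
  have h_eq_0: "h p = 0 \<longleftrightarrow> p = 0" for p
    using bij_is_inj[OF h(2)] h.inj_iff_eq_0 h.zero by blast
  have h_add: "h (n, m) + h (n', m') = h (n + n', m + m')" for n m n' m'
    using h.add[of "(n, m)" "(n', m')"] by simp
  let ?q = "\<lambda>((n, m), (n', m' :: 'm)). h (n + n', m)"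
  let ?P = "{(x, y). snd x = snd (y :: 'n \<times> 'm)} :: (('n \<times> 'm) \<times> ('n \<times> 'm)) set"
  have "?q ` ?P = UNIV"
  proof (intro equalityI subset_UNIV subsetI)
    fix x
    obtain n m where "x = h (n, m)" using bij_is_surj[OF h(2)] by (metis surj_pair surjD)
    then show "x \<in> ?q ` ?P" by (intro image_eqI[of _ _ "((n, m), (0, m))"]) auto
  qed
  moreover have "{p \<in> ?P. ?q p = 0} = range (\<lambda>n. ((n, 0), - (n, 0)))"
    by (auto simp: h_eq_0 zero_prod_def image_iff add_eq_0_iff)
  ultimately show ?thesis
    unfolding baer_sum_def twisted_ext_def
    by (auto simp: Let_def h_add h_scl h_act aN.add dN.add h_gr gr_closed[OF gN] h(3,4) twisted_sum_def
        dN.m1.scale_right_distrib zero_prod_def algebra_simps intro!: exI[of _ ?q])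
qed

text \<open>
  The quotient map \<open>q\<close> of the Baer sum, restricted to pairs whose second entry lies in the chosen
  complement of \<open>N\<close>, is a bijection from \<open>N \<times> M\<close>. It is compatible with the structure twisted by
  \<open>v + w\<close> because \<open>q\<close> allows an element of \<open>N\<close> to be moved from one entry to the other.
\<close>

lemma yoneda_equiv_baer_sum:
  assumes v: "v \<in> cocycles U M N" and w: "w \<in> cocycles U M N" and vw: "v + w \<in> cocycles U M N"
    and E1: "extension U M N (X1, f1, g1)" "yoneda_equiv (twisted_ext M N v) (X1, f1, g1)"
    and E2: "extension U M N (X2, f2, g2)" "yoneda_equiv (twisted_ext M N w) (X2, f2, g2)"
    and E: "extension U M N (X, f, g)"
    and sum: "baer_sum (X1, f1, g1) (X2, f2, g2) (X, f, g)"
  shows "yoneda_equiv (twisted_ext M N (v + w)) (X, f, g)"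
proof -
  obtain h1 where h1: "h1 \<in> dg_hom (twisted_sum M N v) X1" "\<And>n. h1 (n, 0) = f1 n" "\<And>x. g1 (h1 x) = snd x"
    using E1(2) unfolding twisted_ext_def by (rule yoneda_equivE) (rule that)
  obtain h2 where h2: "h2 \<in> dg_hom (twisted_sum M N w) X2" "\<And>n. h2 (n, 0) = f2 n" "\<And>x. g2 (h2 x) = snd x"
    using E2(2) unfolding twisted_ext_def by (rule yoneda_equivE) (rule that)
  interpret h1: module_hom "scl (twisted_sum M N v)" "scl X1" h1 by (rule dg_homD[OF h1(1)])
  interpret h2: module_hom "scl (twisted_sum M N w)" "scl X2" h2 by (rule dg_homD[OF h2(1)])
  have h1_d: "h1 (mdif N n + fst v m, mdif M m) = mdif X1 (h1 (n, m))"
    and h1_a: "h1 (act N a n + snd v a m, act M a m) = act X1 a (h1 (n, m))"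
    and h1_s: "h1 (scl N r n, scl M r m) = scl X1 r (h1 (n, m))" for n m a r
    using dg_homD(4)[OF h1(1), of "(n, m)"] dg_homD(5)[OF h1(1), of a "(n, m)"] h1.scale[of r "(n, m)"]
    by (simp_all add: twisted_sum_def)
  have h2_d: "h2 (fst w m, mdif M m) = mdif X2 (h2 (0, m))"
    and h2_a: "h2 (snd w a m, act M a m) = act X2 a (h2 (0, m))"
    and h2_s: "h2 (0, scl M r m) = scl X2 r (h2 (0, m))" for m a r
    using dg_homD(4)[OF h2(1), of "(0, m)"] dg_homD(5)[OF h2(1), of a "(0, m)"] h2.scale[of r "(0, m)"]
    by (simp_all add: twisted_sum_def dN.zero aN.zero)
  obtain q where
    q_add: "\<And>x1 x2 y1 y2. g1 x1 = g2 x2 \<Longrightarrow> g1 y1 = g2 y2 \<Longrightarrow> q (x1 + y1, x2 + y2) = q (x1, x2) + q (y1, y2)"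
    and q_scl: "\<And>r x1 x2. g1 x1 = g2 x2 \<Longrightarrow> q (scl X1 r x1, scl X2 r x2) = scl X r (q (x1, x2))"
    and q_gr: "\<And>i x1 x2. g1 x1 = g2 x2 \<Longrightarrow> x1 \<in> gr X1 i \<Longrightarrow> x2 \<in> gr X2 i \<Longrightarrow> q (x1, x2) \<in> gr X i"
    and q_d: "\<And>x1 x2. g1 x1 = g2 x2 \<Longrightarrow> q (mdif X1 x1, mdif X2 x2) = mdif X (q (x1, x2))"
    and q_a: "\<And>a x1 x2. g1 x1 = g2 x2 \<Longrightarrow> q (act X1 a x1, act X2 a x2) = act X a (q (x1, x2))"
    and q_0: "\<And>n. q (f1 n, - f2 n) = 0" and q_f: "\<And>n. q (f1 n, 0) = f n"
    and q_g: "\<And>x1 x2. g1 x1 = g2 x2 \<Longrightarrow> g (q (x1, x2)) = g1 x1"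
    using sum by (rule baer_sumE) (rule that)
  \<comment> \<open>\<open>q\<close> vanishes on \<open>(f1 b, - f2 b)\<close>\<close>
  have shift: "q (h1 (a + b, m), h2 (c, m)) = q (h1 (a, m), h2 (b + c, m))" for a b c m
  proof -
    have "g1 (f1 b) = g2 (- f2 b)"
      using h1(3)[of "(b, 0)"] h2(3)[of "(- b, 0)"] h2.neg[of "(b, 0)"] by (simp add: h1(2) h2(2))
    moreover have "h1 (a + b, m) = h1 (a, m) + f1 b"
      using h1.add[of "(a, m)" "(b, 0)"] by (simp add: h1(2))
    moreover have "h2 (c, m) = h2 (b + c, m) + - f2 b"
      using h2.add[of "(c, m)" "(b, 0)"] by (simp add: h2(2) add.commute)
    ultimately show ?thesis
      using q_add[of "h1 (a, m)" "h2 (b + c, m)" "f1 b" "- f2 b"] by (simp add: h1(3) h2(3) q_0)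
  qed
  define h where "h = (\<lambda>(n, m). q (h1 (n, m), h2 (0, m)))"
  let ?T = "twisted_sum M N (v + w)"
  have "h \<in> dg_hom ?T X"
    unfolding dg_hom_def Hom_deg_def
  proof (intro CollectI conjI allI ballI)
    have "h (p + p') = h p + h p'" for p p'
    proof (cases p; cases p')
      fix n m n' m' assume "p = (n, m)" "p' = (n', m')"
      then show ?thesis
        using h1.add[of "(n, m)" "(n', m')"] h2.add[of "(0, m)" "(0, m')"]
          q_add[of "h1 (n, m)" "h2 (0, m)" "h1 (n', m')" "h2 (0, m')"]
        by (simp add: h_def h1(3) h2(3))
    qed
    moreover have "h (scl ?T r p) = scl X r (h p)" for r p
      by (cases p) (simp add: h_def twisted_sum_def h1_s h2_s q_scl h1(3) h2(3))
    ultimately show "module_hom (scl ?T) (scl X) h"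
      unfolding module_hom_iff using twisted_sum_module dg_moduleD(2)[OF extensionD(1)[OF E]] by simp
    show "h p \<in> gr X (i + 0)" if "p \<in> gr ?T i" for p i
    proof (cases p)
      case (Pair n m)
      then have "h1 (n, m) \<in> gr X1 i" "h2 (0, m) \<in> gr X2 i"
        using that gr_closed(1)[OF gN]
        by (auto intro!: dg_homD(3)[OF h1(1)] dg_homD(3)[OF h2(1)] simp: twisted_sum_def)
      then show ?thesis using q_gr by (simp add: Pair h_def h1(3) h2(3))
    qed
    show "h (mdif ?T p) = mdif X (h p)" for p
    proof (cases p)
      case (Pair n m)
      show ?thesis
        using shift[of "mdif N n + fst v m" "fst w m" "mdif M m" 0]
        by (simp add: Pair h_def twisted_sum_def h1_d h2_d q_d h1(3) h2(3) flip: add.assoc)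
    qed
    show "h (act ?T a p) = act X a (h p)" for a p
    proof (cases p)
      case (Pair n m)
      show ?thesis
        using shift[of "act N a n + snd v a m" "snd w a m" "act M a m" 0]
        by (simp add: Pair h_def twisted_sum_def h1_a h2_a q_a h1(3) h2(3) flip: add.assoc)
    qed
  qed
  moreover have "h (n, 0) = f n" for n
    using h2.zero by (simp add: h_def h1(2) q_f zero_prod_def)
  moreover have "g (h p) = snd p" for p
    by (cases p) (simp add: h_def q_g h1(3) h2(3))
  ultimately show ?thesis
    using twisted_ext_extension[OF vw] E unfolding twisted_ext_def by (intro yoneda_equivI)
qed

end

section \<open>The Yoneda Ext group as cocycles modulo coboundaries\<close>

context dg_module_pair
begin

lemma cocycles_0: "0 \<in> cocycles U M N"
  using gr_closed(1)[OF gN] dM.m1.module_axioms dN.m1.module_axioms aM'.m1.module_axioms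
  by (auto simp: cocycles_def Hom_deg_def Bil_deg0_def module_hom_iff ksign_def dN.zero aN.zero)

lemma cocycles_diff:
  assumes v: "v \<in> cocycles U M N" and w: "w \<in> cocycles U M N"
  shows "v - w \<in> cocycles U M N"
proof -
  note V = cocyclesD[OF v] and W = cocyclesD[OF w]
  interpret v1: module_hom "scl M" "scl N" "fst v" by (rule V)
  interpret v2: module_hom "scl M" "scl N" "snd v a" for a by (rule V)
  interpret v2': module_hom "scl U" "scl N" "\<lambda>a. snd v a x" for x by (rule V)
  interpret w1: module_hom "scl M" "scl N" "fst w" by (rule W)
  interpret w2: module_hom "scl M" "scl N" "snd w a" for a by (rule W)
  interpret w2': module_hom "scl U" "scl N" "\<lambda>a. snd w a x" for x by (rule W)
  show ?thesis
    unfolding cocycles_def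
  proof (intro CollectI conjI allI ballI)
    have "module_hom (scl M) (scl N) (fst (v - w))"
      by unfold_locales (auto simp: v1.add w1.add v1.scale w1.scale dN.m1.scale_right_diff_distrib)
    then show "fst (v - w) \<in> Hom_deg (- 1) M N"
      using V(4) W(4) gr_closed(3)[OF gN] by (simp add: Hom_deg_def)
    have "module_hom (scl M) (scl N) (snd (v - w) a)" for a
      by unfold_locales (auto simp: v2.add w2.add v2.scale w2.scale dN.m1.scale_right_diff_distrib)
    moreover have "module_hom (scl U) (scl N) (\<lambda>a. snd (v - w) a x)" for x
      by unfold_locales (auto simp: v2'.add w2'.add v2'.scale w2'.scale dN.m1.scale_right_diff_distrib)
    ultimately show "snd (v - w) \<in> Bil_deg0 U M N"
      using V(5) W(5) gr_closed(3)[OF gN] by (simp add: Bil_deg0_def)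
    show "mdif N (fst (v - w) x) + fst (v - w) (mdif M x) = 0" for x
      using V(6)[of x] W(6)[of x] by (simp add: dN.diff algebra_simps add_eq_0_iff)
    show "mdif N (snd (v - w) a x) + fst (v - w) (act M a x) =
        snd (v - w) (dif U a) x + ksign i (snd (v - w) a (mdif M x) + act N a (fst (v - w) x))"
      if a: "a \<in> gr U i" for i a x
    proof -
      have "mdif N (snd (v - w) a x) + fst (v - w) (act M a x) =
          (mdif N (snd v a x) + fst v (act M a x)) - (mdif N (snd w a x) + fst w (act M a x))"
        by (simp add: dN.diff)
      also have "\<dots> = snd (v - w) (dif U a) x + ksign i (snd (v - w) a (mdif M x) + act N a (fst (v - w) x))"
        unfolding V(7)[OF a] W(7)[OF a] by (simp add: aN.diff ksign_def)
      finally show ?thesis .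
    qed
    show "snd (v - w) (mul U a b) x = act N a (snd (v - w) b x) + snd (v - w) a (act M b x)" for a b x
      by (simp add: V(8) W(8) aN.diff)
    show "snd (v - w) (unit U) x = 0" for x
      by (simp add: V(9) W(9))
  qed
qed

lemma cocycles_neg: "v \<in> cocycles U M N \<Longrightarrow> - v \<in> cocycles U M N"
  using cocycles_diff[OF cocycles_0] by simp

lemma cocycles_add: "v \<in> cocycles U M N \<Longrightarrow> w \<in> cocycles U M N \<Longrightarrow> v + w \<in> cocycles U M N"
  using cocycles_diff[of v "- w"] cocycles_neg by simp

lemma coboundary_cocycle:
  assumes \<theta>: "\<theta> \<in> Hom_deg 0 M N"
  shows "coboundary M N \<theta> \<in> cocycles U M N"
proof -
  interpret \<theta>: module_hom "scl M" "scl N" \<theta> using \<theta> by (simp add: Hom_deg_def)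
  have \<theta>_gr: "\<theta> x \<in> gr N i" if "x \<in> gr M i" for x i
    using \<theta> that by (auto simp: Hom_deg_def)
  have c1: "fst (coboundary M N \<theta>) x = \<theta> (mdif M x) - mdif N (\<theta> x)" for x
    by (simp add: coboundary_def)
  have c2: "snd (coboundary M N \<theta>) a x = \<theta> (act M a x) - act N a (\<theta> x)" for a x
    by (simp add: coboundary_def)
  show ?thesis
    unfolding cocycles_def
  proof (intro CollectI conjI allI ballI)
    have "module_hom (scl M) (scl N) (fst (coboundary M N \<theta>))"
      by unfold_locales (auto simp: c1 dM.add dN.add \<theta>.add dM.scale dN.scale \<theta>.scale dN.m1.scale_right_diff_distrib)
    then show "fst (coboundary M N \<theta>) \<in> Hom_deg (- 1) M N"
      by (auto simp: Hom_deg_def c1 intro!: gr_closed(3)[OF gN] \<theta>_gr dg_moduleD(9)[OF M] dg_moduleD(9)[OF N])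
    have "module_hom (scl M) (scl N) (snd (coboundary M N \<theta>) a)" for a
      by unfold_locales (auto simp: c2 aM.add aN.add \<theta>.add aM.scale aN.scale \<theta>.scale dN.m1.scale_right_diff_distrib)
    moreover have "module_hom (scl U) (scl N) (\<lambda>a. snd (coboundary M N \<theta>) a x)" for x
      by unfold_locales
        (auto simp: c2 aM'.add aN'.add \<theta>.add aM'.scale aN'.scale \<theta>.scale dN.m1.scale_right_diff_distrib)
    ultimately show "snd (coboundary M N \<theta>) \<in> Bil_deg0 U M N"
      by (auto simp: Bil_deg0_def c2 intro!: gr_closed(3)[OF gN] \<theta>_gr dg_moduleD(10)[OF M] dg_moduleD(10)[OF N])
    show "mdif N (fst (coboundary M N \<theta>) x) + fst (coboundary M N \<theta>) (mdif M x) = 0" for x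
      by (simp add: c1 dN.diff dg_moduleD(6)[OF M] dg_moduleD(6)[OF N] \<theta>.zero)
    show "mdif N (snd (coboundary M N \<theta>) a x) + fst (coboundary M N \<theta>) (act M a x) =
        snd (coboundary M N \<theta>) (dif U a) x +
        ksign i (snd (coboundary M N \<theta>) a (mdif M x) + act N a (fst (coboundary M N \<theta>) x))"
      if a: "a \<in> gr U i" for i a x
      by (simp add: c1 c2 dN.diff aN.diff dg_moduleD(11)[OF M a] dg_moduleD(11)[OF N a] \<theta>.add
          module_hom_ksign[OF \<theta>.module_hom_axioms] ksign_add ksign_diff)
    show "snd (coboundary M N \<theta>) (mul U a b) x =
        act N a (snd (coboundary M N \<theta>) b x) + snd (coboundary M N \<theta>) a (act M b x)" for a b x
      by (simp add: c2 aN.diff dg_moduleD(7)[OF M] dg_moduleD(7)[OF N])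
    show "snd (coboundary M N \<theta>) (unit U) x = 0" for x
      by (simp add: c2 dg_moduleD(8)[OF M] dg_moduleD(8)[OF N])
  qed
qed

lemma ext_class_eq_iff:
  assumes v: "v \<in> cocycles U M N" and w: "w \<in> cocycles U M N"
  shows "ext_class U M N v = ext_class U M N w \<longleftrightarrow>
    yoneda_equiv (twisted_ext M N v) (twisted_ext M N w)"
proof
  assume "ext_class U M N v = ext_class U M N w"
  moreover have "twisted_ext M N w \<in> ext_class U M N w"
    using twisted_ext_extension[OF w] yoneda_equiv_refl by (simp add: ext_class_def)
  ultimately have "twisted_ext M N w \<in> ext_class U M N v" by simp
  then show "yoneda_equiv (twisted_ext M N v) (twisted_ext M N w)"
    by (simp add: ext_class_def)
next
  assume "yoneda_equiv (twisted_ext M N v) (twisted_ext M N w)"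
  moreover from this have "yoneda_equiv (twisted_ext M N w) (twisted_ext M N v)"
    by (rule yoneda_equiv_sym[OF twisted_ext_extension[OF v] twisted_ext_extension[OF w]])
  ultimately show "ext_class U M N v = ext_class U M N w"
    unfolding ext_class_def by (auto intro: yoneda_equiv_trans)
qed

lemma ext_class_add:
  assumes v: "v \<in> cocycles U M N" and w: "w \<in> cocycles U M N"
  shows "ext_class U M N (v + w) =
    {E. extension U M N E \<and> (\<exists>E1 \<in> ext_class U M N v. \<exists>E2 \<in> ext_class U M N w. baer_sum E1 E2 E)}"
proof (intro equalityI subsetI CollectI conjI)
  fix E assume E: "E \<in> ext_class U M N (v + w)"
  obtain X f g where XE: "E = (X, f, g)" by (rule prod_cases3)
  from E obtain h where "h \<in> dg_hom (twisted_sum M N (v + w)) X" "bij h"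
      "\<And>n. h (n, 0) = f n" "\<And>x. g (h x) = snd x"
    unfolding XE ext_class_def twisted_ext_def mem_Collect_eq
    by (elim conjE yoneda_equivE) (rule that)
  then have "baer_sum (twisted_ext M N v) (twisted_ext M N w) E"
    unfolding XE by (rule baer_sum_twisted_ext[OF v w])
  moreover have "twisted_ext M N u \<in> ext_class U M N u" if "u \<in> cocycles U M N" for u
    using twisted_ext_extension[OF that] yoneda_equiv_refl by (simp add: ext_class_def)
  ultimately show "\<exists>E1 \<in> ext_class U M N v. \<exists>E2 \<in> ext_class U M N w. baer_sum E1 E2 E"
    using v w by blast
  show "extension U M N E" using E by (simp add: ext_class_def)
next
  fix E :: "('f, 'u, 'm, 'n, 'n \<times> 'm) ses"
  assume "E \<in> {E. extension U M N E \<and>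
    (\<exists>E1 \<in> ext_class U M N v. \<exists>E2 \<in> ext_class U M N w. baer_sum E1 E2 E)}"
  then obtain E1 E2 where E: "extension U M N E" "E1 \<in> ext_class U M N v" "E2 \<in> ext_class U M N w"
    "baer_sum E1 E2 E" by blast
  obtain X f g X1 f1 g1 X2 f2 g2 where
    XE: "E = (X, f, g)" "E1 = (X1, f1, g1)" "E2 = (X2, f2, g2)" by (metis prod_cases3)
  have "yoneda_equiv (twisted_ext M N (v + w)) (X, f, g)"
    using E unfolding XE ext_class_def
    by (intro yoneda_equiv_baer_sum[OF v w cocycles_add[OF v w], of X1 f1 g1 X2 f2 g2]) simp_all
  with E(1) show "E \<in> ext_class U M N (v + w)"
    by (simp add: XE ext_class_def)
qed

text \<open>
  The neutral element of \<open>YExt\<close> consists of the split extensions; these are the extensions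
  equivalent to the untwisted direct sum.
\<close>

lemma splits_iff_in_ext_class_0:
  assumes E: "extension U M N (X, f, g)"
  shows "(\<exists>\<sigma> \<in> dg_hom M X. g \<circ> \<sigma> = id) \<longleftrightarrow> yoneda_equiv (twisted_ext M N 0) (X, f, g)"
proof
  note X = extensionD(1)[OF E]
  note f = dg_homD[OF extensionD(2)[OF E]]
  interpret dX: module_hom "scl X" "scl X" "mdif X" by (rule dg_moduleD[OF X])
  interpret aX: module_hom "scl X" "scl X" "act X a" for a by (rule dg_moduleD[OF X])
  interpret f: module_hom "scl N" "scl X" f by (rule f)
  interpret g: module_hom "scl X" "scl M" g using extensionD(3)[OF E] by (rule dg_homD)
  assume "\<exists>\<sigma> \<in> dg_hom M X. g \<circ> \<sigma> = id"
  then obtain \<sigma> where \<sigma>: "\<sigma> \<in> dg_hom M X" and g\<sigma>: "\<And>x. g (\<sigma> x) = x"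
    by (auto simp: fun_eq_iff)
  interpret \<sigma>: module_hom "scl M" "scl X" \<sigma> using \<sigma> by (rule dg_homD)
  let ?h = "\<lambda>(n, m). f n + \<sigma> m"
  have "?h \<in> dg_hom (twisted_sum M N 0) X"
    unfolding dg_hom_def Hom_deg_def
  proof (intro CollectI conjI allI ballI)
    show "module_hom (scl (twisted_sum M N 0)) (scl X) ?h"
      unfolding module_hom_iff using twisted_sum_module dX.m1.module_axioms
      by (auto simp: twisted_sum_def f.add f.scale \<sigma>.add \<sigma>.scale dX.m1.scale_right_distrib)
    show "?h x \<in> gr X (i + 0)" if "x \<in> gr (twisted_sum M N 0) i" for i x
      using that f(3) dg_homD(3)[OF \<sigma>] gr_closed(2)[OF dg_moduleD(1)[OF X]]
      by (auto simp: twisted_sum_def)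
    show "?h (mdif (twisted_sum M N 0) x) = mdif X (?h x)" for x
      by (cases x) (simp add: twisted_sum_def dX.add f dg_homD[OF \<sigma>])
    show "?h (act (twisted_sum M N 0) a x) = act X a (?h x)" for a x
      by (cases x) (simp add: twisted_sum_def aX.add f dg_homD[OF \<sigma>])
  qed
  then show "yoneda_equiv (twisted_ext M N 0) (X, f, g)"
    using twisted_ext_extension[OF cocycles_0] E unfolding twisted_ext_def
    by (intro yoneda_equivI) (auto simp: \<sigma>.zero g.add g\<sigma> extensionD(7)[OF E])
next
  assume "yoneda_equiv (twisted_ext M N 0) (X, f, g)"
  then obtain h where h: "h \<in> dg_hom (twisted_sum M N 0) X" "\<And>x. g (h x) = snd x"
    unfolding twisted_ext_def by (rule yoneda_equivE) (rule that)
  have "(\<lambda>m. (0, m)) \<in> dg_hom M (twisted_sum M N 0)"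
    unfolding dg_hom_def Hom_deg_def module_hom_iff
    using twisted_sum_module dM.m1.module_axioms gr_closed(1)[OF gN]
    by (auto simp: twisted_sum_def dN.zero aN.zero)
  from dg_hom_compose[OF this h(1)] show "\<exists>\<sigma> \<in> dg_hom M X. g \<circ> \<sigma> = id"
    by (rule bexI[rotated]) (simp add: fun_eq_iff h(2))
qed

text \<open>
  A splitting has the form \<open>x \<mapsto> (\<theta> x, x)\<close>, and it is a morphism iff \<open>v\<close> is the coboundary of \<open>\<theta>\<close>.
\<close>

lemma twisted_ext_splits_iff:
  assumes v: "v \<in> cocycles U M N"
  shows "(\<exists>\<sigma> \<in> dg_hom M (twisted_sum M N v). snd \<circ> \<sigma> = id) \<longleftrightarrow> v \<in> coboundary M N ` Hom_deg 0 M N"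
proof
  assume "\<exists>\<sigma> \<in> dg_hom M (twisted_sum M N v). snd \<circ> \<sigma> = id"
  then obtain \<sigma> where \<sigma>: "\<sigma> \<in> dg_hom M (twisted_sum M N v)" and snd\<sigma>: "\<And>x. snd (\<sigma> x) = x"
    by (auto simp: fun_eq_iff)
  interpret \<sigma>: module_hom "scl M" "scl (twisted_sum M N v)" \<sigma> using \<sigma> by (rule dg_homD)
  define \<theta> where "\<theta> = (\<lambda>x. fst (\<sigma> x))"
  have \<sigma>_eq: "\<sigma> x = (\<theta> x, x)" for x
    by (simp add: \<theta>_def prod_eq_iff snd\<sigma>)
  have "module_hom (scl M) (scl N) \<theta>"
    by unfold_locales (simp_all add: \<theta>_def \<sigma>.add \<sigma>.scale twisted_sum_def split: prod.split)
  moreover have "\<theta> x \<in> gr N i" if "x \<in> gr M i" for x i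
    using dg_homD(3)[OF \<sigma> that] by (simp add: \<sigma>_eq twisted_sum_def)
  ultimately have "\<theta> \<in> Hom_deg 0 M N"
    by (simp add: Hom_deg_def)
  moreover have "v = coboundary M N \<theta>"
    using dg_homD(4)[OF \<sigma>] dg_homD(5)[OF \<sigma>]
    by (auto simp: \<sigma>_eq twisted_sum_def coboundary_def prod_eq_iff fun_eq_iff algebra_simps)
  ultimately show "v \<in> coboundary M N ` Hom_deg 0 M N" by blast
next
  assume "v \<in> coboundary M N ` Hom_deg 0 M N"
  then obtain \<theta> where \<theta>: "\<theta> \<in> Hom_deg 0 M N" and v_eq: "v = coboundary M N \<theta>" by blast
  have "(\<lambda>x. (\<theta> x, x)) \<in> dg_hom M (twisted_sum M N v)"
    unfolding dg_hom_def Hom_deg_def module_hom_iff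
    using twisted_sum_module dM.m1.module_axioms \<theta>
    by (auto simp: twisted_sum_def v_eq coboundary_def Hom_deg_def module_hom_iff)
  then show "\<exists>\<sigma> \<in> dg_hom M (twisted_sum M N v). snd \<circ> \<sigma> = id"
    by (rule bexI[rotated]) (simp add: fun_eq_iff)
qed

text \<open>
  The class map from cocycles respects the operations and is onto, so it transports the group axioms
  to \<open>YExt\<close>, where the Baer sum is only a relation between representatives. The first isomorphism
  theorem then applies.
\<close>

theorem YExt_iso_cocycles_mod_coboundaries:
  "coboundary M N ` Hom_deg 0 M N \<lhd> add_group (cocycles U M N) \<and>
   add_group (cocycles U M N) Mod coboundary M N ` Hom_deg 0 M N \<cong> YExt U M N"
proof -
  let ?G = "add_group (cocycles U M N)" and ?c = "ext_class U M N"
  have G: "group ?G"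
  proof (rule groupI)
    fix v assume "v \<in> carrier ?G"
    then show "\<exists>w\<in>carrier ?G. w \<otimes>\<^bsub>?G\<^esub> v = \<one>\<^bsub>?G\<^esub>"
      by (intro bexI[of _ "- v"]) (simp_all add: add_group_def cocycles_neg)
  qed (auto simp: add_group_def cocycles_0 cocycles_add add.assoc)
  interpret G: group ?G by (rule G)
  let ?R = "{(E :: ('f, 'u, 'm, 'n, 'n \<times> 'm) ses, E' :: ('f, 'u, 'm, 'n, 'n \<times> 'm) ses).
    extension U M N E \<and> extension U M N E' \<and> yoneda_equiv E E'}"
  have class_eq: "?c v = ?R `` {twisted_ext M N v}" if "v \<in> cocycles U M N" for v
    using twisted_ext_extension[OF that] by (auto simp: ext_class_def)
  have image: "?c ` carrier ?G = carrier (YExt U M N)"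
  proof (intro equalityI subsetI)
    fix C assume "C \<in> ?c ` carrier ?G"
    then obtain v where v: "v \<in> cocycles U M N" and C: "C = ?c v"
      by (auto simp: add_group_def)
    show "C \<in> carrier (YExt U M N)"
      unfolding C class_eq[OF v] YExt_def YExt_set_def partial_object.simps
      using twisted_ext_extension[OF v] by (intro quotientI) simp
  next
    fix C assume "C \<in> carrier (YExt U M N)"
    then have "C \<in> {E. extension U M N E} // ?R"
      by (simp add: YExt_def YExt_set_def)
    then obtain E where C: "C = ?R `` {E}" and "E \<in> {E. extension U M N E}"
      by (rule quotientE) (rule that)
    then have E: "extension U M N E" by simp
    obtain v where v: "v \<in> cocycles U M N" "yoneda_equiv (twisted_ext M N v) E"
      using extension_equiv_twisted E by (metis prod_cases3)
    then have "(twisted_ext M N v, E) \<in> ?R"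
      using E twisted_ext_extension by simp
    then have "C = ?c v"
      unfolding C class_eq[OF v(1)] by (rule equiv_class_eq[OF yoneda_equiv_relation, symmetric])
    then show "C \<in> ?c ` carrier ?G" using v by (simp add: add_group_def)
  qed
  have hom: "?c \<in> hom ?G (YExt U M N)"
  proof (rule homI)
    show "?c v \<in> carrier (YExt U M N)" if "v \<in> carrier ?G" for v
      using that image by blast
    show "?c (v \<otimes>\<^bsub>?G\<^esub> w) = ?c v \<otimes>\<^bsub>YExt U M N\<^esub> ?c w" if "v \<in> carrier ?G" "w \<in> carrier ?G" for v w
      using that by (simp add: YExt_def add_group_def ext_class_add)
  qed
  have one: "?c \<one>\<^bsub>?G\<^esub> = \<one>\<^bsub>YExt U M N\<^esub>"
    using splits_iff_in_ext_class_0 by (auto simp: YExt_def add_group_def ext_class_def)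
  have "YExt U M N\<lparr>carrier := ?c ` carrier ?G, one := ?c \<one>\<^bsub>?G\<^esub>\<rparr> = YExt U M N"
    unfolding image one by simp
  then have "group (YExt U M N)"
    using G.hom_imp_img_group[OF hom] by simp
  then interpret c: group_hom ?G "YExt U M N" ?c
    using hom G by (intro group_hom.intro group_hom_axioms.intro)
  have "kernel ?G (YExt U M N) ?c = coboundary M N ` Hom_deg 0 M N"
  proof -
    have iff: "?c v = \<one>\<^bsub>YExt U M N\<^esub> \<longleftrightarrow> v \<in> coboundary M N ` Hom_deg 0 M N" if v: "v \<in> cocycles U M N" for v
    proof -
      have "?c v = \<one>\<^bsub>YExt U M N\<^esub> \<longleftrightarrow> ?c 0 = ?c v"
        using one by (auto simp: add_group_def)
      also have "\<dots> \<longleftrightarrow> yoneda_equiv (twisted_ext M N 0) (twisted_ext M N v)"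
        by (rule ext_class_eq_iff[OF cocycles_0 v])
      also have "\<dots> \<longleftrightarrow> (\<exists>\<sigma> \<in> dg_hom M (twisted_sum M N v). snd \<circ> \<sigma> = id)"
        using splits_iff_in_ext_class_0 twisted_ext_extension[OF v]
        unfolding twisted_ext_def by blast
      finally show ?thesis using twisted_ext_splits_iff[OF v] by blast
    qed
    have "kernel ?G (YExt U M N) ?c = {v \<in> cocycles U M N. ?c v = \<one>\<^bsub>YExt U M N\<^esub>}"
      by (simp add: kernel_def add_group_def)
    also have "\<dots> = {v \<in> cocycles U M N. v \<in> coboundary M N ` Hom_deg 0 M N}"
      by (rule Collect_cong) (metis iff)
    also have "\<dots> = coboundary M N ` Hom_deg 0 M N"
      using coboundary_cocycle by blast
    finally show ?thesis .
  qed
  then show ?thesis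
    using c.normal_kernel c.FactGroup_iso[OF image] by simp
qed

end

section \<open>The tangent space of the variety of DG module structures\<close>

text \<open>
  The structure on \<open>M[\<epsilon>]\<close> deformed by \<open>v\<close>. A pair \<open>(x, y)\<close> stands for \<open>x + y \<epsilon>\<close>, so the second
  entry is the submodule: the opposite order to \<open>twisted_sum\<close>.
\<close>

definition eps_extension ::
  "('f::comm_ring_1, 'u::ab_group_add, 'm::ab_group_add) dg_mod \<Rightarrow>
    ('m \<Rightarrow> 'm) \<times> ('u \<Rightarrow> 'm \<Rightarrow> 'm) \<Rightarrow> ('f dual, 'u \<times> 'u, 'm \<times> 'm) dg_mod" where
  "eps_extension M v =
     \<lparr>scl = (\<lambda>r (x, y). (scl M (dual_re r) x, scl M (dual_re r) y + scl M (dual_eps r) x)),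
      gr = (\<lambda>i. gr M i \<times> gr M i),
      mdif = (\<lambda>(x, y). (mdif M x, mdif M y + fst v x)),
      act = (\<lambda>(a, b) (x, y). (act M a x, act M a y + act M b x + snd v a x))\<rparr>"

text \<open>
  The part of each axiom without \<open>\<epsilon>\<close> holds since \<open>M\<close> is a DG module. The part with \<open>\<epsilon>\<close>, evaluated
  at elements \<open>(a, 0)\<close> and \<open>(x, 0)\<close>, is the corresponding cocycle equation; for other elements it
  follows by \<open>F[\<epsilon>]\<close>-linearity.
\<close>

lemma dg_module_eps_extension_iff:
  fixes U :: "('f::field, 'u::ab_group_add) dg_alg" and M :: "('f, 'u, 'm::ab_group_add) dg_mod"
  assumes U: "dg_algebra U" and M: "dg_module U M"
  shows "dg_module (alg_eps U) (eps_extension M v) \<longleftrightarrow> v \<in> cocycles U M M"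
proof
  interpret dg_module_pair U M M by unfold_locales (rule M)+
  have gU: "graded_module U" using U by (simp add: dg_algebra_def)
  let ?T = "eps_extension M v"
  assume T: "dg_module (alg_eps U) ?T"
  interpret dT: module_hom "scl ?T" "scl ?T" "mdif ?T" by (rule dg_moduleD[OF T])
  interpret aT: module_hom "scl ?T" "scl ?T" "act ?T a" for a by (rule dg_moduleD[OF T])
  interpret aT': module_hom "scl (alg_eps U)" "scl ?T" "\<lambda>a. act ?T a x" for x by (rule dg_moduleD[OF T])
  have v1: "fst v x = snd (mdif ?T (x, 0))" for x
    by (simp add: eps_extension_def dM.zero)
  have v2: "snd v a x = snd (act ?T (a, 0) (x, 0))" for a x
    by (simp add: eps_extension_def aM.zero aM'.zero)
  have act_eq: "act ?T (a, 0) (x, 0) = (act M a x, snd v a x)" and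
    dif_eq: "mdif ?T (x, y) = (mdif M x, mdif M y + fst v x)" for a x y
    by (simp_all add: eps_extension_def aM.zero aM'.zero)
  have scl_eq: "scl ?T (Dual r 0) (x, y) = (scl M r x, scl M r y)" for r x y
    by (simp add: eps_extension_def)
  have sclU_eq: "scl (alg_eps U) (Dual r 0) (a, 0) = (scl U r a, 0)" for r a
    by (simp add: alg_eps_def aM'.m1.scale_zero_left)
  show "v \<in> cocycles U M M"
    unfolding cocycles_def
  proof (intro CollectI conjI allI ballI)
    have "fst v (x + y) = fst v x + fst v y" for x y
      using dT.add[of "(x, 0)" "(y, 0)"] by (simp add: v1)
    moreover have "fst v (scl M r x) = scl M r (fst v x)" for r x
      using dT.scale[of "Dual r 0" "(x, 0)"] by (simp add: scl_eq dif_eq dM.zero)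
    moreover have "fst v x \<in> gr M (i - 1)" if "x \<in> gr M i" for x i
      using dg_moduleD(9)[OF T, of "(x, 0)" i] that gr_closed(1)[OF gM]
      by (simp add: eps_extension_def dM.zero)
    ultimately show "fst v \<in> Hom_deg (- 1) M M"
      using dM.m1.module_axioms by (simp add: Hom_deg_def module_hom_iff)
    have "snd v a (x + y) = snd v a x + snd v a y" for a x y
      using aT.add[of "(a, 0)" "(x, 0)" "(y, 0)"] by (simp add: act_eq)
    moreover have "snd v a (scl M r x) = scl M r (snd v a x)" for a r x
      using aT.scale[of "(a, 0)" "Dual r 0" "(x, 0)"] by (simp add: act_eq scl_eq)
    moreover have "snd v (a + b) x = snd v a x + snd v b x" for a b x
      using aT'.add[of "(a, 0)" "(b, 0)" "(x, 0)"] by (simp add: act_eq)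
    moreover have "snd v (scl U r a) x = scl M r (snd v a x)" for r a x
      using aT'.scale[of "Dual r 0" "(a, 0)" "(x, 0)"] by (simp add: act_eq scl_eq sclU_eq)
    moreover have "snd v a x \<in> gr M (i + j)" if "a \<in> gr U i" "x \<in> gr M j" for a x i j
      using dg_moduleD(10)[OF T, of "(a, 0)" i "(x, 0)" j] that gr_closed(1)[OF gM] gr_closed(1)[OF gU]
      unfolding act_eq by (simp add: eps_extension_def alg_eps_def)
    ultimately show "snd v \<in> Bil_deg0 U M M"
      using dM.m1.module_axioms aM'.m1.module_axioms by (simp add: Bil_deg0_def module_hom_iff)
    show "mdif M (fst v x) + fst v (mdif M x) = 0" for x
      using dg_moduleD(6)[OF T, of "(x, 0)"] by (simp add: dif_eq dM.zero zero_prod_def)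
    show "mdif M (snd v a x) + fst v (act M a x) =
        snd v (dif U a) x + ksign i (snd v a (mdif M x) + act M a (fst v x))"
      if "a \<in> gr U i" for i a x
      using dg_moduleD(11)[OF T, of "(a, 0)" i "(x, 0)"] that gr_closed(1)[OF gU]
        U
      by (cases "even i")
        (auto simp: alg_eps_def eps_extension_def ksign_def dg_algebra_def Hom_deg_def module_hom.zero
          dM.zero aM.zero aM'.zero algebra_simps)
    show "snd v (mul U a b) x = act M a (snd v b x) + snd v a (act M b x)" for a b x
      using dg_moduleD(7)[OF T, of "(a, 0)" "(b, 0)" "(x, 0)"] U
        module_hom.zero[of "scl U" "scl U" "mul U a"] module_hom.zero[of "scl U" "scl U" "\<lambda>a. mul U a b"]
      by (simp add: alg_eps_def eps_extension_def dg_algebra_def Bil_deg0_def aM.zero aM'.zero)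
    show "snd v (unit U) x = 0" for x
      using dg_moduleD(8)[OF T, of "(x, 0)"]
      by (simp add: alg_eps_def eps_extension_def aM.zero aM'.zero)
  qed
next
  interpret dg_module_pair U M M by unfold_locales (rule M)+
  let ?T = "eps_extension M v"
  assume v: "v \<in> cocycles U M M"
  note D = cocyclesD[OF v]
  interpret v1: module_hom "scl M" "scl M" "fst v" by (rule D)
  interpret v2: module_hom "scl M" "scl M" "snd v a" for a by (rule D)
  interpret v2': module_hom "scl U" "scl M" "\<lambda>a. snd v a x" for x by (rule D)
  note scl_simps = dM.m1.scale_right_distrib dM.m1.scale_left_distrib
    aM'.m1.scale_right_distrib aM'.m1.scale_left_distrib
  have mT: "Modules.module (scl ?T)"
    by unfold_locales
      (auto simp: eps_extension_def plus_dual_def times_dual_def one_dual_def scl_simps algebra_simps)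
  have mU: "Modules.module (scl (alg_eps U))"
    by unfold_locales
      (auto simp: alg_eps_def plus_dual_def times_dual_def one_dual_def scl_simps algebra_simps)
  show "dg_module (alg_eps U) ?T"
    unfolding dg_module_def
  proof (intro conjI allI ballI)
    show "graded_module ?T"
      unfolding graded_module_def
    proof (intro conjI allI mT)
      show "module.subspace (scl ?T) (gr ?T i)" for i
        unfolding module.subspace_def[OF mT]
        using gr_closed[OF gM] by (auto simp: eps_extension_def zero_prod_def)
      show "\<exists>!c. (\<forall>i. c i \<in> gr ?T i) \<and> finite {i. c i \<noteq> 0} \<and> p = (\<Sum>i | c i \<noteq> 0. c i)" for p
        using graded_decomposition_Times[OF gM gM, of p] by (simp add: eps_extension_def)
    qed
    have "module_hom (scl ?T) (scl ?T) (mdif ?T)"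
      unfolding module_hom_iff using mT
      by (auto simp: eps_extension_def dM.add dM.scale v1.add v1.scale scl_simps algebra_simps)
    then show "mdif ?T \<in> Hom_deg (- 1) ?T ?T"
      using D(4) dg_moduleD(9)[OF M] gr_closed(2)[OF gM]
      by (auto simp: Hom_deg_def eps_extension_def)
    show "mdif ?T (mdif ?T p) = 0" for p
      using D(6) by (cases p) (simp add: eps_extension_def zero_prod_def dM.add dg_moduleD(6)[OF M])
    have "module_hom (scl ?T) (scl ?T) (act ?T a)" for a
      unfolding module_hom_iff using mT
      by (cases a) (auto simp: eps_extension_def aM.add aM.scale v2.add v2.scale scl_simps algebra_simps)
    moreover have "module_hom (scl (alg_eps U)) (scl ?T) (\<lambda>a. act ?T a p)" for p
      unfolding module_hom_iff using mT mU
      by (cases p) (auto simp: eps_extension_def alg_eps_def aM'.add aM'.scale v2'.add v2'.scale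
          scl_simps algebra_simps)
    ultimately show "act ?T \<in> Bil_deg0 (alg_eps U) ?T ?T"
      using D(5) dg_moduleD(10)[OF M] gr_closed(2)[OF gM]
      by (auto simp: Bil_deg0_def eps_extension_def alg_eps_def)
    show "mdif ?T (act ?T a p) = act ?T (dif (alg_eps U) a) p + ksign i (act ?T a (mdif ?T p))"
      if a: "a \<in> gr (alg_eps U) i" for i a p
    proof (cases a; cases p)
      fix b c x y assume [simp]: "a = (b, c)" "p = (x, y)"
      have bc: "b \<in> gr U i" "c \<in> gr U i" using a by (simp_all add: alg_eps_def)
      have 1: "mdif M (snd v b x) =
          snd v (dif U b) x + ksign i (snd v b (mdif M x) + act M b (fst v x)) - fst v (act M b x)"
        using D(7)[OF bc(1), of x] by (simp add: algebra_simps)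
      show ?thesis
        using dg_moduleD(11)[OF M bc(1)] dg_moduleD(11)[OF M bc(2)]
        by (simp add: eps_extension_def alg_eps_def 1 dM.add aM.add ksign_add)
          (simp add: ksign_def)
    qed
    show "act ?T (mul (alg_eps U) a b) p = act ?T a (act ?T b p)" for a b p
      by (cases a; cases b; cases p)
        (simp add: eps_extension_def alg_eps_def D(8) dg_moduleD(7)[OF M] aM.add aM'.add algebra_simps)
    show "act ?T (unit (alg_eps U)) p = p" for p
      by (cases p) (simp add: eps_extension_def alg_eps_def D(9) dg_moduleD(8)[OF M] aM'.zero)
  qed
qed

lemma tangent_Mod_eq_cocycles:
  fixes U :: "('f::field, 'u::ab_group_add) dg_alg" and W :: "('f, 'w::ab_group_add) graded_mod"
  assumes U: "dg_algebra U" and M: "M \<in> Mod_var U W"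
  shows "tangent_Mod U W M = cocycles U (with_struct W M) (with_struct W M)"
proof -
  have "with_struct (graded_eps W) (with_eps M v) = eps_extension (with_struct W M) v" for v
    by (simp add: with_struct_def graded_eps_def with_eps_def eps_extension_def)
  moreover have "dg_module U (with_struct W M)"
    using M by (simp add: Mod_var_def)
  ultimately show ?thesis
    by (intro Set.set_eqI) (simp add: tangent_Mod_def Mod_var_def dg_module_eps_extension_iff[OF U])
qed

section \<open>The tangent space of an orbit\<close>

text \<open>
  The inverse of \<open>1 + t \<theta>\<close> as a fraction with denominator \<open>d\<close> and numerator \<open>\<Sum> t\<^sup>i q\<^sub>i\<close>. Put
  \<open>\<eta> = - \<theta>\<close>. Comparing coefficients in \<open>(1 - t \<eta>) (\<Sum> t\<^sup>i q\<^sub>i) = d\<close> gives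
  \<open>q\<^sub>i = \<Sum>\<^sub>j\<^sub>\<le>\<^sub>i d\<^sub>j \<eta>\<^sup>i\<^sup>-\<^sup>j\<close>, and the sum stops at \<open>i = n\<close> if \<open>d\<close> is the reversal of a monic polynomial of
  degree \<open>n\<close> annihilating \<open>\<eta>\<close>.
\<close>

lemma one_plus_scaled_inverse:
  fixes W :: "('f::field, 'w::ab_group_add) graded_mod"
  assumes W: "graded_module W" "finite_dim W" and \<theta>: "\<theta> \<in> Hom_deg 0 W W"
  shows "\<exists>d n q. poly d 0 = 1 \<and> (\<forall>i. q i \<in> Hom_deg 0 W W) \<and>
    (\<forall>t x. (\<Sum>i<n. scl W (t ^ i) (q i (x + scl W t (\<theta> x)))) = scl W (poly d t) x) \<and>
    (\<forall>t x. (\<Sum>i<n. scl W (t ^ i) (q i x)) + scl W t (\<theta> (\<Sum>i<n. scl W (t ^ i) (q i x))) =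
      scl W (poly d t) x)"
proof -
  have sW: "vector_space (scl W)"
    using W(1) by (simp add: graded_module_def module_iff_vector_space)
  interpret W: vector_space "scl W" by (rule sW)
  interpret P: vector_space "\<lambda>r (f :: 'w \<Rightarrow> 'w) x. scl W r (f x)"
    by (rule vector_space_pointwise) (rule sW)
  have sub: "W.subspace (gr W i)" for i
    using W(1) by (simp add: graded_module_def)
  interpret \<theta>: module_hom "scl W" "scl W" \<theta> using \<theta> by (simp add: Hom_deg_def)
  define \<eta> where "\<eta> = (\<lambda>x. - \<theta> x)"
  have \<eta>_gr: "\<eta> x \<in> gr W i" if "x \<in> gr W i" for x i
    using that \<theta> sub W.subspace_neg by (auto simp: \<eta>_def Hom_deg_def)
  have "module_hom (scl W) (scl W) \<eta>"
    by unfold_locales (auto simp: \<eta>_def \<theta>.add \<theta>.scale algebra_simps)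
  then interpret \<eta>: module_hom "scl W" "scl W" \<eta> .
  have \<eta>_pow: "module_hom (scl W) (scl W) (\<eta> ^^ i)" for i
  proof (induction i)
    case 0
    show ?case by unfold_locales auto
  next
    case (Suc i)
    show ?case using module_hom_compose[OF Suc \<eta>.module_hom_axioms] by (simp add: comp_def)
  qed
  have \<eta>_pow_gr: "(\<eta> ^^ j) x \<in> gr W i" if "x \<in> gr W i" for x i j
    using that by (induction j) (auto intro: \<eta>_gr)
  have \<eta>_comm: "(\<eta> ^^ i) (\<eta> x) = \<eta> ((\<eta> ^^ i) x)" for i x
    by (simp add: funpow_swap1)
  obtain E where "finite E" "{\<theta>. module_hom (scl W) (scl W) \<theta>} \<subseteq> P.span E"
    using finite_span_endomorphisms[OF sW] W(2) unfolding finite_dim_def by metis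
  then obtain n where "\<eta> ^^ n \<in> P.span ((\<lambda>i. \<eta> ^^ i) ` {..<n})"
    using P.ex_in_span_initial[of E "\<lambda>i. \<eta> ^^ i"] \<eta>_pow by blast
  then obtain c where c: "\<eta> ^^ n = (\<Sum>i<n. (\<lambda>x. scl W (c i) ((\<eta> ^^ i) x)))"
    using P.span_image_finite[of "{..<n}" "\<eta> ^^ n" "\<lambda>i. \<eta> ^^ i"] by blast
  \<comment> \<open>the reversed coefficients of the annihilating polynomial \<open>X\<^sup>n - \<Sum> c\<^sub>i X\<^sup>i\<close>\<close>
  define a where "a = (\<lambda>j. if j = 0 then 1 else - c (n - j))"
  define d where "d = (\<Sum>j\<le>n. monom (a j) j)"
  define q where "q = (\<lambda>i x. \<Sum>j\<le>i. scl W (a j) ((\<eta> ^^ (i - j)) x))"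
  have q_Suc: "q (Suc i) x = scl W (a (Suc i)) x + \<eta> (q i x)" for i x
  proof -
    have "\<eta> (q i x) = (\<Sum>j\<le>i. scl W (a j) ((\<eta> ^^ (Suc i - j)) x))"
      unfolding q_def \<eta>.sum by (intro sum.cong) (auto simp: \<eta>.scale Suc_diff_le)
    then show ?thesis by (simp add: q_def add.commute)
  qed
  have q_n: "q n x = 0" for x
  proof -
    have "q n x = (\<eta> ^^ n) x + (\<Sum>j\<in>{1..n}. scl W (a j) ((\<eta> ^^ (n - j)) x))"
      unfolding q_def by (simp add: atMost_atLeast0 sum.atLeast_Suc_atMost a_def)
    also have "(\<Sum>j\<in>{1..n}. scl W (a j) ((\<eta> ^^ (n - j)) x)) =
        (\<Sum>i<n. scl W (- c i) ((\<eta> ^^ i) x))"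
      by (rule sum.reindex_bij_witness[of _ "\<lambda>i. n - i" "\<lambda>j. n - j"]) (auto simp: a_def)
    also have "\<dots> = - (\<eta> ^^ n) x"
      by (simp add: c sum_fun_apply sum_negf)
    finally show ?thesis by simp
  qed
  have telescope: "(\<Sum>i<m. scl W (t ^ i) (q i x)) - scl W t (\<Sum>i<m. scl W (t ^ i) (\<eta> (q i x))) =
      scl W (\<Sum>j\<le>m. a j * t ^ j) x - scl W (t ^ m) (q m x)" for m t x
  proof (induction m)
    case 0
    show ?case by (simp add: q_def a_def)
  next
    case (Suc m)
    have "scl W (t ^ Suc m) (q (Suc m) x) =
        scl W (a (Suc m) * t ^ Suc m) x + scl W t (scl W (t ^ m) (\<eta> (q m x)))"
      by (simp add: q_Suc W.scale_right_distrib mult.commute)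
    with Suc show ?case
      by (simp add: W.scale_right_distrib W.scale_left_distrib algebra_simps)
  qed
  have d: "poly d t = (\<Sum>j\<le>n. a j * t ^ j)" for t
    by (simp add: d_def poly_sum poly_monom)
  have q_hom: "module_hom (scl W) (scl W) (q i)" for i
  proof -
    interpret \<eta>i: module_hom "scl W" "scl W" "\<eta> ^^ j" for j by (rule \<eta>_pow)
    show ?thesis
      by unfold_locales
        (auto simp: q_def \<eta>i.add \<eta>i.scale W.scale_right_distrib sum.distrib W.scale_sum_right mult.commute)
  qed
  have q_gr: "q i x \<in> gr W k" if "x \<in> gr W k" for i k x
    unfolding q_def using sub \<eta>_pow_gr[OF that] by (intro W.subspace_sum W.subspace_scale) auto
  have q_comm: "q i (\<eta> x) = \<eta> (q i x)" for i x
    by (simp add: q_def \<eta>.sum \<eta>.scale \<eta>_comm)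
  have main: "(\<Sum>i<n. scl W (t ^ i) (q i x)) + scl W t (\<theta> (\<Sum>i<n. scl W (t ^ i) (q i x))) =
      scl W (poly d t) x" for t x
    using telescope[where m = n] 
    by (simp add: d q_n \<eta>_def \<theta>.sum \<theta>.scale sum_negf)
  have "(\<Sum>i<n. scl W (t ^ i) (q i (x + scl W t (\<theta> x)))) =
      (\<Sum>i<n. scl W (t ^ i) (q i x)) + scl W t (\<theta> (\<Sum>i<n. scl W (t ^ i) (q i x)))" for t x
  proof -
    interpret qi: module_hom "scl W" "scl W" "q i" for i by (rule q_hom)
    have "q i (\<theta> x) = \<theta> (q i x)" for i
      using q_comm[of i x] by (simp add: \<eta>_def qi.neg)
    then show ?thesis
      by (simp add: qi.add qi.scale \<theta>.sum \<theta>.scale W.scale_right_distrib sum.distrib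
          W.scale_sum_right mult.commute)
  qed
  moreover have "poly d 0 = 1"
    by (simp add: d a_def power_0_left if_distrib cong: if_cong)
  ultimately show ?thesis
    using main q_hom q_gr by (intro exI[of _ d] exI[of _ n] exI[of _ q]) (auto simp: Hom_deg_def)
qed
lemma sum_struct_apply:
  fixes f :: "'i \<Rightarrow> ('w \<Rightarrow> 'n::ab_group_add) \<times> ('u \<Rightarrow> 'w \<Rightarrow> 'n)"
  shows "fst (\<Sum>i\<in>S. f i) x = (\<Sum>i\<in>S. fst (f i) x)"
    "snd (\<Sum>i\<in>S. f i) a x = (\<Sum>i\<in>S. snd (f i) a x)"
  by (induction S rule: infinite_finite_induct) auto

lemma vector_space_struct_scl:
  fixes W :: "('f::field, 'w::ab_group_add) graded_mod"
  assumes "vector_space (scl W)"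
  shows "vector_space (struct_scl W :: 'f \<Rightarrow> ('u, 'w) dg_struct \<Rightarrow> ('u, 'w) dg_struct)"
proof -
  interpret vector_space "scl W" by (rule assms)
  show ?thesis
    by unfold_locales (auto simp: struct_scl_def fun_eq_iff scale_right_distrib scale_left_distrib)
qed

lemma dg_structD:
  fixes U :: "('r::comm_ring_1, 'u::ab_group_add) dg_alg" and W :: "('r, 'w::ab_group_add) graded_mod"
  assumes "M \<in> Mod_var U W"
  shows "graded_module W" "fst M \<in> Hom_deg (- 1) W W" "snd M \<in> Bil_deg0 U W W"
    "module_hom (scl W) (scl W) (fst M)" "module_hom (scl W) (scl W) (snd M a)"
  using assms
  by (auto simp: Mod_var_def with_struct_def dg_module_def graded_module_def Hom_deg_def Bil_deg0_def)

lemma coboundary_in_ambient: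
  fixes U :: "('f::field, 'u::ab_group_add) dg_alg" and W :: "('f, 'w::ab_group_add) graded_mod"
  assumes M: "M \<in> Mod_var U W" and \<theta>: "\<theta> \<in> Hom_deg 0 W W"
  shows "coboundary (with_struct W M) (with_struct W M) \<theta> \<in> ambient U W"
proof -
  interpret dg_module_pair U "with_struct W M" "with_struct W M"
    using M by unfold_locales (simp_all add: Mod_var_def)
  have "coboundary (with_struct W M) (with_struct W M) \<theta> \<in>
      cocycles U (with_struct W M) (with_struct W M)"
    using \<theta> by (intro coboundary_cocycle) (simp add: Hom_deg_def with_struct_def)
  then show ?thesis
    by (simp add: cocycles_def ambient_def mem_Times_iff Hom_deg_def Bil_deg0_def with_struct_def)
qed

text \<open>
  With \<open>\<alpha> = 1 + t \<theta>\<close> and \<open>v = [\<theta>, D]\<close>, the identity \<open>\<alpha> D - (D + t v) \<alpha> = - t\<^sup>2 v \<theta>\<close> gives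
  \<open>\<alpha> D \<alpha>\<^sup>-\<^sup>1 = D + t v - t\<^sup>2 v \<theta> \<alpha>\<^sup>-\<^sup>1\<close>, so \<open>v\<close> is the velocity of a rational curve in the orbit.
\<close>

lemma coboundary_tangent_to_orbit:
  fixes U :: "('f::field, 'u::ab_group_add) dg_alg" and W :: "('f, 'w::ab_group_add) graded_mod"
  assumes inf: "infinite (UNIV :: 'f set)" and W: "finite_dim W" and M: "M \<in> Mod_var U W"
    and \<theta>: "\<theta> \<in> Hom_deg 0 W W"
  shows "coboundary (with_struct W M) (with_struct W M) \<theta> \<in> tangent_orbit U W M"
proof -
  note D = dg_structD[OF M]
  have sW: "vector_space (scl W)"
    using D(1) by (simp add: graded_module_def module_iff_vector_space)
  interpret W: vector_space "scl W" by (rule sW)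
  have sub: "W.subspace (gr W i)" for i
    using D(1) by (simp add: graded_module_def)
  interpret \<theta>: module_hom "scl W" "scl W" \<theta> using \<theta> by (simp add: Hom_deg_def)
  from one_plus_scaled_inverse[OF D(1) W \<theta>]
  obtain d n q where d0: "poly d 0 = 1" and q: "\<forall>i. q i \<in> Hom_deg 0 W W"
    and q_left: "\<forall>t x. (\<Sum>i<n. scl W (t ^ i) (q i (x + scl W t (\<theta> x)))) = scl W (poly d t) x"
    and q_right: "\<forall>t x. (\<Sum>i<n. scl W (t ^ i) (q i x)) + scl W t (\<theta> (\<Sum>i<n. scl W (t ^ i) (q i x))) =
      scl W (poly d t) x"
    by (elim exE conjE) (rule that)
  interpret q: module_hom "scl W" "scl W" "q i" for i using q by (simp add: Hom_deg_def)
  define Q where "Q = (\<lambda>t x. \<Sum>i<n. scl W (t ^ i) (q i x))"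
  define \<alpha> where "\<alpha> = (\<lambda>t x. x + scl W t (\<theta> x))"
  have \<alpha>Q: "\<alpha> t (Q t x) = scl W (poly d t) x" and Q\<alpha>: "Q t (\<alpha> t x) = scl W (poly d t) x" for t x
    using q_left q_right by (auto simp: Q_def \<alpha>_def)
  have \<alpha>_hom: "module_hom (scl W) (scl W) (\<alpha> t)" for t
    by unfold_locales (simp_all add: \<alpha>_def \<theta>.add \<theta>.scale W.scale_right_distrib mult.commute)
  have Q_hom: "module_hom (scl W) (scl W) (Q t)" for t
    by unfold_locales
      (simp_all add: Q_def q.add q.scale W.scale_right_distrib sum.distrib W.scale_sum_right mult.commute)
  interpret \<alpha>: module_hom "scl W" "scl W" "\<alpha> t" for t by (rule \<alpha>_hom)
  interpret Q: module_hom "scl W" "scl W" "Q t" for t by (rule Q_hom)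
  have inverse: "\<alpha> t (scl W (1 / poly d t) (Q t x)) = x" "scl W (1 / poly d t) (Q t (\<alpha> t x)) = x"
    if "poly d t \<noteq> 0" for t x
    using that by (simp_all add: \<alpha>.scale \<alpha>Q Q\<alpha>)
  have \<alpha>_GL: "\<alpha> t \<in> GL0 W" if "poly d t \<noteq> 0" for t
  proof -
    have "bij (\<alpha> t)"
      using inverse[OF that] by (intro bijI' ) metis+
    moreover have "\<alpha> t x \<in> gr W i" if "x \<in> gr W i" for x i
      using that \<theta> sub by (auto simp: \<alpha>_def Hom_deg_def intro!: W.subspace_add W.subspace_scale)
    ultimately show ?thesis
      using \<alpha>_hom by (simp add: GL0_def Hom_deg_def)
  qed
  have inv_\<alpha>: "scl W (poly d t) (inv_into UNIV (\<alpha> t) x) = Q t x" if "poly d t \<noteq> 0" for t x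
  proof -
    have "inv_into UNIV (\<alpha> t) x = scl W (1 / poly d t) (Q t x)"
      using \<alpha>_GL[OF that] inverse(1)[OF that] by (auto simp: GL0_def intro!: inv_f_eq bij_is_inj)
    with that show ?thesis by simp
  qed
  have conj: "scl W (poly d t) (\<alpha> t (D (inv_into UNIV (\<alpha> t) x))) =
      scl W (poly d t) (D x + scl W t (\<theta> (D x) - D (\<theta> x))) +
      scl W (t\<^sup>2) (\<Sum>i<n. scl W (t ^ i) (D (\<theta> (\<theta> (q i x))) - \<theta> (D (\<theta> (q i x)))))"
    if D: "module_hom (scl W) (scl W) D" and t: "poly d t \<noteq> 0" for D t x
  proof -
    interpret D: module_hom "scl W" "scl W" D by (rule D)
    define y where "y = Q t x"
    have dx: "scl W (poly d t) x = y + scl W t (\<theta> y)"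
      using \<alpha>Q[of t x] by (simp add: \<alpha>_def y_def)
    have "scl W (poly d t) (\<alpha> t (D (inv_into UNIV (\<alpha> t) x))) = \<alpha> t (D y)"
      by (simp add: y_def flip: inv_\<alpha>[OF t] \<alpha>.scale D.scale)
    also have "\<dots> = D y + scl W t (\<theta> (D y))" by (simp add: \<alpha>_def)
    also have "\<dots> = D (scl W (poly d t) x) +
        scl W t (\<theta> (D (scl W (poly d t) x)) - D (\<theta> (scl W (poly d t) x))) +
        scl W (t\<^sup>2) (D (\<theta> (\<theta> y)) - \<theta> (D (\<theta> y)))"
      unfolding dx
      by (simp add: D.add D.scale \<theta>.add \<theta>.scale W.scale_right_distrib W.scale_right_diff_distrib
          power2_eq_square)
    also have "D (\<theta> (\<theta> y)) - \<theta> (D (\<theta> y)) =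
        (\<Sum>i<n. scl W (t ^ i) (D (\<theta> (\<theta> (q i x))) - \<theta> (D (\<theta> (q i x)))))"
      by (simp add: y_def Q_def D.sum \<theta>.sum D.scale \<theta>.scale W.scale_right_diff_distrib sum_subtractf)
    finally show ?thesis
      by (simp add: D.scale \<theta>.scale W.scale_right_distrib W.scale_right_diff_distrib mult.commute)
  qed
  define r :: "nat \<Rightarrow> ('u, 'w) dg_struct" where
    "r = (\<lambda>i. (\<lambda>x. fst M (\<theta> (\<theta> (q i x))) - \<theta> (fst M (\<theta> (q i x))),
      \<lambda>a x. snd M a (\<theta> (\<theta> (q i x))) - \<theta> (snd M a (\<theta> (q i x)))))"
  show ?thesis
    unfolding tangent_orbit_def
  proof (rule zariski_tangent_rational_curve[OF inf vector_space_struct_scl[OF sW]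
        coboundary_in_ambient[OF M \<theta>] d0])
    fix t assume t: "poly d t \<noteq> 0"
    show "GL_act (\<alpha> t) M \<in> GL_orbit W M"
      using \<alpha>_GL[OF t] by (simp add: GL_orbit_def)
    show "struct_scl W (poly d t) (GL_act (\<alpha> t) M) = struct_scl W (poly d t)
        (M + struct_scl W t (coboundary (with_struct W M) (with_struct W M) \<theta>)) +
        struct_scl W (t\<^sup>2) (\<Sum>i<n. struct_scl W (t ^ i) (r i))"
    proof (intro prod_eqI ext)
      fix x
      show "fst (struct_scl W (poly d t) (GL_act (\<alpha> t) M)) x = fst (struct_scl W (poly d t)
          (M + struct_scl W t (coboundary (with_struct W M) (with_struct W M) \<theta>)) +
          struct_scl W (t\<^sup>2) (\<Sum>i<n. struct_scl W (t ^ i) (r i))) x"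
        using conj[OF D(4) t, of x]
        by (simp add: struct_scl_def GL_act_def coboundary_def with_struct_def sum_struct_apply r_def)
    next
      fix a x
      show "snd (struct_scl W (poly d t) (GL_act (\<alpha> t) M)) a x = snd (struct_scl W (poly d t)
          (M + struct_scl W t (coboundary (with_struct W M) (with_struct W M) \<theta>)) +
          struct_scl W (t\<^sup>2) (\<Sum>i<n. struct_scl W (t ^ i) (r i))) a x"
        using conj[OF D(5) t, of a x]
        by (simp add: struct_scl_def GL_act_def coboundary_def with_struct_def sum_struct_apply r_def)
    qed
  qed
qed

text \<open>
  The rank condition applies to the maps \<open>\<psi> \<theta>\<close> sending a structure \<open>N\<close> to the coboundary of \<open>\<theta>\<close>
  regarded as a map from \<open>M\<close> to \<open>N\<close>: at \<open>N = \<alpha> \<cdot> M\<close>, the value of \<open>\<psi> \<theta>\<close> is obtained from the value of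
  \<open>\<psi> (\<alpha>\<^sup>-\<^sup>1 \<theta>)\<close> at \<open>M\<close> by composition with \<open>\<alpha>\<close>. The member \<open>\<psi> id\<close> is \<open>N \<mapsto> M - N\<close>, which vanishes at
  \<open>M\<close> and takes the value \<open>- v\<close> at \<open>M + v\<close>.
\<close>

lemma tangent_orbit_subset_coboundaries:
  fixes U :: "('f::field, 'u::ab_group_add) dg_alg" and W :: "('f, 'w::ab_group_add) graded_mod"
  assumes inf: "infinite (UNIV :: 'f set)" and W: "finite_dim W" and M: "M \<in> Mod_var U W"
  shows "tangent_orbit U W M \<subseteq> coboundary (with_struct W M) (with_struct W M) ` Hom_deg 0 W W"
proof
  fix v assume v: "v \<in> tangent_orbit U W M"
  note D = dg_structD[OF M]
  have sW: "vector_space (scl W)"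
    using D(1) by (simp add: graded_module_def module_iff_vector_space)
  interpret W: vector_space "scl W" by (rule sW)
  interpret S: vector_space "struct_scl W :: 'f \<Rightarrow> ('u, 'w) dg_struct \<Rightarrow> ('u, 'w) dg_struct"
    by (rule vector_space_struct_scl[OF sW])
  interpret P: vector_space "\<lambda>r (f :: 'w \<Rightarrow> 'w) x. scl W r (f x)"
    by (rule vector_space_pointwise) (rule sW)
  have sub: "W.subspace (gr W i)" for i
    using D(1) by (simp add: graded_module_def)
  interpret d: module_hom "scl W" "scl W" "fst M" by (rule D)
  interpret m: module_hom "scl W" "scl W" "snd M a" for a by (rule D)
  define \<psi> :: "('w \<Rightarrow> 'w) \<Rightarrow> ('u, 'w) dg_struct \<Rightarrow> ('u, 'w) dg_struct"
    where "\<psi> = (\<lambda>\<theta> N. coboundary (with_struct W M) (with_struct W N) \<theta>)"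
  have \<psi>: "\<psi> \<theta> N = (\<lambda>x. \<theta> (fst M x) - fst N (\<theta> x), \<lambda>a x. \<theta> (snd M a x) - snd N a (\<theta> x))" for \<theta> N
    by (simp add: \<psi>_def coboundary_def with_struct_def)
  let ?I = "(\<lambda>\<theta>. \<psi> \<theta> M) ` Hom_deg 0 W W"
  have \<psi>_hom: "module_hom (\<lambda>r f x. scl W r (f x)) (struct_scl W) (\<lambda>\<theta>. \<psi> \<theta> M)"
    by unfold_locales
      (auto simp: \<psi> struct_scl_def fun_eq_iff d.add m.add d.scale m.scale W.scale_right_diff_distrib)
  interpret \<psi>: module_hom "\<lambda>r f x. scl W r (f x)" "struct_scl W" "\<lambda>\<theta>. \<psi> \<theta> M"
    by (rule \<psi>_hom)
  have "P.subspace (Hom_deg 0 W W)"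
    unfolding P.subspace_def
  proof (intro conjI ballI allI)
    show "0 \<in> Hom_deg 0 W W"
      using sub W.subspace_0 by (auto simp: Hom_deg_def module_hom_iff W.module_axioms)
  next
    fix f g assume "f \<in> Hom_deg 0 W W" "g \<in> Hom_deg 0 W W"
    then show "f + g \<in> Hom_deg 0 W W"
      using sub W.subspace_add by (auto simp: Hom_deg_def module_hom_iff W.scale_right_distrib)
  next
    fix r f assume "f \<in> Hom_deg 0 W W"
    then show "(\<lambda>x. scl W r (f x)) \<in> Hom_deg 0 W W"
      using sub W.subspace_scale
      by (auto simp: Hom_deg_def module_hom_iff W.scale_right_distrib mult.commute)
  qed
  then have I_sub: "S.subspace ?I"
    by (rule \<psi>.subspace_image)
  obtain E where E: "finite E" "{\<theta>. module_hom (scl W) (scl W) \<theta>} \<subseteq> P.span E"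
    using finite_span_endomorphisms[OF sW] W unfolding finite_dim_def by metis
  then have "Hom_deg 0 W W \<subseteq> P.span E"
    by (auto simp: Hom_deg_def)
  then have I_fin: "?I \<subseteq> S.span ((\<lambda>\<theta>. \<psi> \<theta> M) ` E)"
    using \<psi>.span_image[of E] by blast
  have id: "id \<in> Hom_deg 0 W W"
    by (auto simp: Hom_deg_def module_hom_iff W.module_axioms)
  have "\<psi> id (M + v) \<in> (\<lambda>\<psi>. \<psi> M) ` (\<psi> ` Hom_deg 0 W W)"
  proof (rule zariski_tangent_rank_condition[OF inf S.vector_space_axioms S.vector_space_axioms
        v[unfolded tangent_orbit_def], where B = "(\<lambda>\<theta>. \<psi> \<theta> M) ` E"])
    show "S.subspace ((\<lambda>\<psi>. \<psi> M) ` (\<psi> ` Hom_deg 0 W W))"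
      "(\<lambda>\<psi>. \<psi> M) ` (\<psi> ` Hom_deg 0 W W) \<subseteq> S.span ((\<lambda>\<theta>. \<psi> \<theta> M) ` E)"
      using I_sub I_fin by (simp_all only: image_image)
    show "\<psi> id \<in> \<psi> ` Hom_deg 0 W W" using id by blast
    show "\<psi> id M = 0" by (auto simp: \<psi> zero_prod_def fun_eq_iff)
  next
    fix \<phi> assume "\<phi> \<in> \<psi> ` Hom_deg 0 W W"
    then obtain \<theta> where \<phi>: "\<phi> = \<psi> \<theta>" by blast
    have "module_hom (struct_scl W) (struct_scl W)
        (\<lambda>N :: ('u, 'w) dg_struct. (\<lambda>x. - fst N (\<theta> x), \<lambda>a x. - snd N a (\<theta> x)))"
      by unfold_locales (auto simp: struct_scl_def fun_eq_iff)
    moreover have "\<phi> N = \<phi> 0 + (\<lambda>x. - fst N (\<theta> x), \<lambda>a x. - snd N a (\<theta> x))" for N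
      by (simp add: \<phi> \<psi> fun_eq_iff)
    ultimately show "\<exists>\<phi>'. module_hom (struct_scl W) (struct_scl W) \<phi>' \<and> (\<forall>N. \<phi> N = \<phi> 0 + \<phi>' N)"
      by blast
  next
    fix N assume "N \<in> GL_orbit W M"
    then obtain \<alpha> where \<alpha>: "\<alpha> \<in> Hom_deg 0 W W" "bij \<alpha>" and N: "N = GL_act \<alpha> M"
      by (auto simp: GL_orbit_def GL0_def)
    interpret \<alpha>: module_hom "scl W" "scl W" \<alpha> using \<alpha>(1) by (simp add: Hom_deg_def)
    define \<beta> where "\<beta> = inv_into UNIV \<alpha>"
    have \<alpha>\<beta>: "\<alpha> (\<beta> x) = x" and \<beta>\<alpha>: "\<beta> (\<alpha> x) = x" for x
      using \<alpha>(2) by (simp_all add: \<beta>_def bij_is_surj surj_f_inv_f bij_is_inj)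
    show "\<exists>T. module_hom (struct_scl W) (struct_scl W) T \<and>
      (\<forall>\<phi>\<in>\<psi> ` Hom_deg 0 W W. \<exists>\<phi>'\<in>\<psi> ` Hom_deg 0 W W. \<phi> N = T (\<phi>' M))"
    proof (intro exI conjI ballI)
      show "module_hom (struct_scl W) (struct_scl W)
          (\<lambda>N :: ('u, 'w) dg_struct. (\<lambda>x. \<alpha> (fst N x), \<lambda>a x. \<alpha> (snd N a x)))"
        by unfold_locales (auto simp: struct_scl_def fun_eq_iff \<alpha>.add \<alpha>.scale)
    next
      fix \<phi> assume "\<phi> \<in> \<psi> ` Hom_deg 0 W W"
      then obtain \<theta> where \<theta>: "\<theta> \<in> Hom_deg 0 W W" and \<phi>: "\<phi> = \<psi> \<theta>" by blast
      have "\<beta> \<in> Hom_deg 0 W W"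
        using Hom_deg_0_inverse[OF D(1) D(1) \<alpha>] by (simp add: \<beta>_def)
      then have "\<beta> \<circ> \<theta> \<in> Hom_deg 0 W W"
        using \<theta> by (auto simp: Hom_deg_def intro: module_hom_compose)
      moreover have "\<phi> N = (\<lambda>x. \<alpha> (fst (\<psi> (\<beta> \<circ> \<theta>) M) x), \<lambda>a x. \<alpha> (snd (\<psi> (\<beta> \<circ> \<theta>) M) a x))"
        by (simp add: \<phi> \<psi> N GL_act_def fun_eq_iff \<alpha>.diff \<alpha>\<beta> \<beta>_def[symmetric])
      ultimately show "\<exists>\<phi>'\<in>\<psi> ` Hom_deg 0 W W. \<phi> N = (\<lambda>x. \<alpha> (fst (\<phi>' M) x), \<lambda>a x. \<alpha> (snd (\<phi>' M) a x))"
        by blast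
    qed
  qed (use E in auto)
  moreover have "\<psi> id (M + v) = - v"
    by (simp add: \<psi> prod_eq_iff fun_eq_iff)
  ultimately have "- v \<in> ?I" by (simp only: image_image)
  then have "v \<in> ?I" using S.subspace_neg[OF I_sub, of "- v"] by simp
  then show "v \<in> coboundary (with_struct W M) (with_struct W M) ` Hom_deg 0 W W"
    by (simp add: \<psi>_def)
qed
section \<open>Tangent spaces and extensions\<close>

theorem theorem2:
  fixes U :: "('f::alg_closed_field, 'u::ab_group_add) dg_alg"
    and W :: "('f, 'w::ab_group_add) graded_mod"
    and M :: "('u, 'w) dg_struct"
  assumes "dg_algebra U" and "finite_dim U"
    and "graded_module W" and "finite_dim W"
    and "M \<in> Mod_var U W"
  shows "tangent_orbit U W M \<lhd> add_group (tangent_Mod U W M) \<and>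
    add_group (tangent_Mod U W M) Mod tangent_orbit U W M
      \<cong> YExt U (with_struct W M) (with_struct W M)"
proof -
  let ?M = "with_struct W M"
  interpret dg_module_pair U ?M ?M
    using assms by unfold_locales (simp_all add: Mod_var_def)
  have "Hom_deg 0 ?M ?M = Hom_deg 0 W W"
    by (simp add: Hom_deg_def with_struct_def)
  then have "tangent_orbit U W M = coboundary ?M ?M ` Hom_deg 0 ?M ?M"
    using tangent_orbit_subset_coboundaries[OF infinite_UNIV_alg_closed_field assms(4,5)]
      coboundary_tangent_to_orbit[OF infinite_UNIV_alg_closed_field assms(4,5)] by auto
  then show ?thesis
    using YExt_iso_cocycles_mod_coboundaries tangent_Mod_eq_cocycles[OF assms(1,5)] by simp
qed

end
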